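(* Let $\mathbb V$ be a Schubert representation of $\widehat H_n$ with equivariant parameters $t_1,\dots,t_n$. For $1\le i\le k$ let $R_i$ be the $\mathbb F$-linear operator on the span of $\{\mathcal Y_\nu:\nu\subseteq(n-k)^k\}$ given by $$R_i(\mathcal Y_\nu)=t_{\nu_i+k+1-i}\,\mathcal Y_\nu+\sum_\mu\bigl(\hbar-(p-q)t_{\mathtt h(\mu/\nu)}\bigr)p^{\operatorname{ht}(\mu/\nu)-1}q^{\operatorname{wd}(\mu/\nu)-1}\,\mathcal Y_\mu,$$ the sum over $\mu\subseteq(n-k)^k$ such that $\mu/\nu$ is a ribbon with head in row $i$. Then for $\lambda\subseteq(n-k)^k$ and $0\le r\le k$, $$e_r(x_1,\dots,x_k)\cdot\mathcal Y_\lambda=\sum_{1\le i_1<\cdots<i_r\le k}R_{i_r}\cdots R_{i_1}(\mathcal Y_\lambda).$$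
   Context: $\widehat H_n$: the $\mathbb Q[p,q,\hbar]$-algebra generated by $T_1,\dots,T_{n-1},x_1,\dots,x_n$ with $(T_i+p)(T_i-q)=0$, braid relations, $x_ix_j=x_jx_i$, $T_ix_j=x_jT_i$ ($j\ne i,i+1$), $T_ix_i=x_{i+1}T_i+(\hbar-(p-q)x_i)$, $T_ix_{i+1}=x_iT_i-(\hbar-(p-q)x_i)$; $T_w$ via reduced words. Schubert representation: field $\mathbb F$ with $t_1,\dots,t_n\in\mathbb F$, ring map $\mathbb Q[p,q,\hbar]\to\mathbb F$, $\mathbb F$-space $\mathbb V$ with $\widehat H_n$-action, basis $\mathcal Y_w=T_{w^{-1}w_0}\mathcal Y_{w_0}$ ($w_0$ longest), and $\mathbb F$-linear $\operatorname{ev}$ with $\operatorname{ev}(\mathcal Y_w)\ne0\iff w=\mathrm{id}$, $\operatorname{ev}(x_i\mathcal Y_w)=t_i\operatorname{ev}(\mathcal Y_w)$. For $\nu\subseteq(n-k)^k$ ($n-k\ge\nu_1\ge\dots\ge\nu_k\ge0$), $w_\nu$ is given by $w_\nu(k+1-i)=\nu_i+k+1-i$ ($1\le i\le k$), increasing on $\{k+1,\dots,n\}$, and $\mathcal Y_\nu=\sum_{v\in S_k\times S_{n-k}}p^{\ell(v)}\mathcal Y_{w_\nu v}$. Ribbon: nonempty connected skew shape $\eta=\mu/\nu$ with no $2\times2$ square (Young diagrams, rows top to bottom); head = top-right box; $\operatorname{ht},\operatorname{wd}$ = numbers of rows, columns; if the head is in row $i$, $\mathtt h(\eta)=\mu_i+k+1-i$.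 *)

theory Defs
  imports Complex_Main "HOL-Combinatorics.Permutations"
begin

section \<open>Permutations of {1..n}\<close>

text \<open>Permutations in S_n are functions nat => nat permuting {1..n} (identity outside).\<close>

definition sref :: "nat \<Rightarrow> nat \<Rightarrow> nat" where
  "sref a = (\<lambda>j. if j = a then a + 1 else if j = a + 1 then a else j)"

definition perm_len :: "nat \<Rightarrow> (nat \<Rightarrow> nat) \<Rightarrow> nat" where
  "perm_len n w = card {(i, j). 1 \<le> i \<and> i < j \<and> j \<le> n \<and> w j < w i}"

definition longest :: "nat \<Rightarrow> nat \<Rightarrow> nat" where
  "longest n = (\<lambda>i. if 1 \<le> i \<and> i \<le> n then n + 1 - i else i)"

text \<open>A reduced word [a_1,...,a_l] of w: w = s_{a_1} o ... o s_{a_l} with l = length of w.\<close>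
definition reduced_word :: "nat \<Rightarrow> (nat \<Rightarrow> nat) \<Rightarrow> nat list \<Rightarrow> bool" where
  "reduced_word n w as \<longleftrightarrow> set as \<subseteq> {1..<n} \<and> foldr (\<lambda>a f. sref a \<circ> f) as id = w
      \<and> length as = perm_len n w"

text \<open>T_w = T_{a_1} ... T_{a_l} for a reduced word (as operators on V).\<close>
definition Tw :: "nat \<Rightarrow> (nat \<Rightarrow> 'v \<Rightarrow> 'v) \<Rightarrow> (nat \<Rightarrow> nat) \<Rightarrow> 'v \<Rightarrow> 'v" where
  "Tw n T w = foldr (\<lambda>a g. T a \<circ> g) (SOME as. reduced_word n w as) id"

text \<open>Basis vector Y_w = T_{w^{-1} w_0} Y_{w_0}, where y0 = Y_{w_0}.\<close>
definition Ybas :: "nat \<Rightarrow> (nat \<Rightarrow> 'v \<Rightarrow> 'v) \<Rightarrow> 'v \<Rightarrow> (nat \<Rightarrow> nat) \<Rightarrow> 'v" where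
  "Ybas n T y0 w = Tw n T (inv w \<circ> longest n) y0"

section \<open>Schubert representations\<close>

text \<open>p, q, h are the images of p, q, hbar under the ring map Q[p,q,hbar] -> F (F of characteristic 0);
  T i, X i are the actions of the generators T_i, x_i on V, which must be F-linear and satisfy
  the defining relations of the affine Hecke algebra.\<close>
definition schubert_rep ::
  "nat \<Rightarrow> ('f::field_char_0 \<Rightarrow> 'v::ab_group_add \<Rightarrow> 'v) \<Rightarrow> (nat \<Rightarrow> 'v \<Rightarrow> 'v) \<Rightarrow> (nat \<Rightarrow> 'v \<Rightarrow> 'v)
    \<Rightarrow> 'f \<Rightarrow> 'f \<Rightarrow> 'f \<Rightarrow> (nat \<Rightarrow> 'f) \<Rightarrow> 'v \<Rightarrow> ('v \<Rightarrow> 'f) \<Rightarrow> bool" where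
  "schubert_rep n scale T X p q h t y0 ev \<longleftrightarrow>
     vector_space scale
   \<and> (\<forall>i \<in> {1..<n}. Vector_Spaces.linear scale scale (T i))
   \<and> (\<forall>i \<in> {1..n}. Vector_Spaces.linear scale scale (X i))
   \<comment> \<open>(T_i + p)(T_i - q) = 0\<close>
   \<and> (\<forall>i \<in> {1..<n}. \<forall>v. T i (T i v) + scale (p - q) (T i v) - scale (p * q) v = 0)
   \<comment> \<open>braid relations\<close>
   \<and> (\<forall>i \<in> {1..<n}. \<forall>j \<in> {1..<n}. (i + 2 \<le> j \<or> j + 2 \<le> i) \<longrightarrow> (\<forall>v. T i (T j v) = T j (T i v)))
   \<and> (\<forall>i. 1 \<le> i \<and> i + 1 < n \<longrightarrow> (\<forall>v. T i (T (i+1) (T i v)) = T (i+1) (T i (T (i+1) v))))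
   \<comment> \<open>x_i x_j = x_j x_i\<close>
   \<and> (\<forall>i \<in> {1..n}. \<forall>j \<in> {1..n}. \<forall>v. X i (X j v) = X j (X i v))
   \<comment> \<open>T_i x_j = x_j T_i for j \<noteq> i, i+1\<close>
   \<and> (\<forall>i \<in> {1..<n}. \<forall>j \<in> {1..n}. j \<noteq> i \<and> j \<noteq> i + 1 \<longrightarrow> (\<forall>v. T i (X j v) = X j (T i v)))
   \<comment> \<open>T_i x_i = x_{i+1} T_i + (hbar - (p-q) x_i)\<close>
   \<and> (\<forall>i \<in> {1..<n}. \<forall>v. T i (X i v) = X (i+1) (T i v) + (scale h v - scale (p - q) (X i v)))
   \<comment> \<open>T_i x_{i+1} = x_i T_i - (hbar - (p-q) x_i)\<close>
   \<and> (\<forall>i \<in> {1..<n}. \<forall>v. T i (X (i+1) v) = X i (T i v) - (scale h v - scale (p - q) (X i v)))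
   \<comment> \<open>the Y_w, w in S_n, form a basis\<close>
   \<and> inj_on (Ybas n T y0) {w. w permutes {1..n}}
   \<and> \<not> module.dependent scale (Ybas n T y0 ` {w. w permutes {1..n}})
   \<and> module.span scale (Ybas n T y0 ` {w. w permutes {1..n}}) = UNIV
   \<comment> \<open>the evaluation functional\<close>
   \<and> Vector_Spaces.linear scale (*) ev
   \<and> (\<forall>w. w permutes {1..n} \<longrightarrow> (ev (Ybas n T y0 w) \<noteq> 0 \<longleftrightarrow> w = id))
   \<and> (\<forall>w i. w permutes {1..n} \<and> i \<in> {1..n} \<longrightarrow> ev (X i (Ybas n T y0 w)) = t i * ev (Ybas n T y0 w))"

section \<open>Partitions in the k x (n-k) box\<close>

text \<open>A partition nu in (n-k)^k is a function with nu i for 1 <= i <= k, zero elsewhere.\<close>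
definition parts :: "nat \<Rightarrow> nat \<Rightarrow> (nat \<Rightarrow> nat) set" where
  "parts n k = {\<nu>. (\<forall>i. 1 \<le> i \<and> i \<le> k \<longrightarrow> \<nu> i \<le> n - k)
                  \<and> (\<forall>i j. 1 \<le> i \<and> i \<le> j \<and> j \<le> k \<longrightarrow> \<nu> j \<le> \<nu> i)
                  \<and> (\<forall>i. \<not> (1 \<le> i \<and> i \<le> k) \<longrightarrow> \<nu> i = 0)}"

text \<open>w_nu: w_nu(k+1-i) = nu_i + k+1-i for 1<=i<=k, increasing on {k+1..n}.\<close>
definition wpart :: "nat \<Rightarrow> nat \<Rightarrow> (nat \<Rightarrow> nat) \<Rightarrow> nat \<Rightarrow> nat" where
  "wpart n k \<nu> = (\<lambda>j. if 1 \<le> j \<and> j \<le> k then \<nu> (k + 1 - j) + j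
       else if k < j \<and> j \<le> n then
         sorted_list_of_set ({1..n} - (\<lambda>i. \<nu> i + k + 1 - i) ` {1..k}) ! (j - k - 1)
       else j)"

text \<open>S_k x S_{n-k}: permutations of {1..n} stabilising {1..k}.\<close>
definition Sk_young :: "nat \<Rightarrow> nat \<Rightarrow> (nat \<Rightarrow> nat) set" where
  "Sk_young n k = {v. v permutes {1..n} \<and> v ` {1..k} = {1..k}}"

definition Ypart :: "nat \<Rightarrow> nat \<Rightarrow> ('f::field \<Rightarrow> 'v::ab_group_add \<Rightarrow> 'v) \<Rightarrow> (nat \<Rightarrow> 'v \<Rightarrow> 'v)
    \<Rightarrow> 'v \<Rightarrow> 'f \<Rightarrow> (nat \<Rightarrow> nat) \<Rightarrow> 'v" where
  "Ypart n k scale T y0 p \<nu> =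
     (\<Sum>v \<in> Sk_young n k. scale (p ^ perm_len n v) (Ybas n T y0 (wpart n k \<nu> \<circ> v)))"

section \<open>Ribbons\<close>

definition cells :: "nat \<Rightarrow> (nat \<Rightarrow> nat) \<Rightarrow> (nat \<Rightarrow> nat) \<Rightarrow> (nat \<times> nat) set" where
  "cells k \<mu> \<nu> = {(i, j). 1 \<le> i \<and> i \<le> k \<and> \<nu> i < j \<and> j \<le> \<mu> i}"

definition adjacent :: "nat \<times> nat \<Rightarrow> nat \<times> nat \<Rightarrow> bool" where
  "adjacent a b \<longleftrightarrow> (fst a = fst b \<and> (snd a + 1 = snd b \<or> snd b + 1 = snd a))
                   \<or> (snd a = snd b \<and> (fst a + 1 = fst b \<or> fst b + 1 = fst a))"

definition is_ribbon :: "nat \<Rightarrow> (nat \<Rightarrow> nat) \<Rightarrow> (nat \<Rightarrow> nat) \<Rightarrow> bool" where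
  "is_ribbon k \<mu> \<nu> \<longleftrightarrow>
     (\<forall>i. 1 \<le> i \<and> i \<le> k \<longrightarrow> \<nu> i \<le> \<mu> i)
   \<and> cells k \<mu> \<nu> \<noteq> {}
   \<and> (\<forall>a \<in> cells k \<mu> \<nu>. \<forall>b \<in> cells k \<mu> \<nu>.
        (a, b) \<in> {(c, d). c \<in> cells k \<mu> \<nu> \<and> d \<in> cells k \<mu> \<nu> \<and> adjacent c d}\<^sup>*)
   \<and> \<not> (\<exists>i j. (i, j) \<in> cells k \<mu> \<nu> \<and> (i, j+1) \<in> cells k \<mu> \<nu>
             \<and> (i+1, j) \<in> cells k \<mu> \<nu> \<and> (i+1, j+1) \<in> cells k \<mu> \<nu>)"

text \<open>Row of the head (top-right box) = topmost row containing a box.\<close>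
definition head_row :: "nat \<Rightarrow> (nat \<Rightarrow> nat) \<Rightarrow> (nat \<Rightarrow> nat) \<Rightarrow> nat" where
  "head_row k \<mu> \<nu> = Min (fst ` cells k \<mu> \<nu>)"

definition head_col :: "nat \<Rightarrow> (nat \<Rightarrow> nat) \<Rightarrow> (nat \<Rightarrow> nat) \<Rightarrow> nat" where
  "head_col k \<mu> \<nu> = \<mu> (head_row k \<mu> \<nu>) + k + 1 - head_row k \<mu> \<nu>"

definition rib_ht :: "nat \<Rightarrow> (nat \<Rightarrow> nat) \<Rightarrow> (nat \<Rightarrow> nat) \<Rightarrow> nat" where
  "rib_ht k \<mu> \<nu> = card (fst ` cells k \<mu> \<nu>)"

definition rib_wd :: "nat \<Rightarrow> (nat \<Rightarrow> nat) \<Rightarrow> (nat \<Rightarrow> nat) \<Rightarrow> nat" where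
  "rib_wd k \<mu> \<nu> = card (snd ` cells k \<mu> \<nu>)"

section \<open>The operators R_i\<close>

text \<open>Elements of span{Y_nu} are written as coefficient functions c over parts n k,
  standing for the vector sum_nu c(nu) Y_nu.  Rco i acts on coefficients as the
  linear extension of R_i: the Y_mu-coefficient of R_i(sum_nu c nu Y_nu).\<close>
definition Rco :: "nat \<Rightarrow> nat \<Rightarrow> 'f::field \<Rightarrow> 'f \<Rightarrow> 'f \<Rightarrow> (nat \<Rightarrow> 'f) \<Rightarrow> nat
    \<Rightarrow> ((nat \<Rightarrow> nat) \<Rightarrow> 'f) \<Rightarrow> ((nat \<Rightarrow> nat) \<Rightarrow> 'f)" where
  "Rco n k p q h t i c = (\<lambda>\<mu>. t (\<mu> i + k + 1 - i) * c \<mu>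
     + (\<Sum>\<nu> \<in> {\<nu> \<in> parts n k. is_ribbon k \<mu> \<nu> \<and> head_row k \<mu> \<nu> = i}.
          (h - (p - q) * t (head_col k \<mu> \<nu>)) * p ^ (rib_ht k \<mu> \<nu> - 1) * q ^ (rib_wd k \<mu> \<nu> - 1) * c \<nu>))"

definition vec_of :: "nat \<Rightarrow> nat \<Rightarrow> ('f::field \<Rightarrow> 'v::ab_group_add \<Rightarrow> 'v) \<Rightarrow> (nat \<Rightarrow> 'v \<Rightarrow> 'v)
    \<Rightarrow> 'v \<Rightarrow> 'f \<Rightarrow> ((nat \<Rightarrow> nat) \<Rightarrow> 'f) \<Rightarrow> 'v" where
  "vec_of n k scale T y0 p c = (\<Sum>\<mu> \<in> parts n k. scale (c \<mu>) (Ypart n k scale T y0 p \<mu>))"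

end

theory Submission
  imports Defs "HOL-Combinatorics.Multiset_Permutations" "HOL-Library.Function_Algebras"
begin

text \<open>The theorem is equivalent to the identity
  \<open>(1 + z x\<^sub>1) \<cdots> (1 + z x\<^sub>k) Y\<^sub>\<lambda> = (1 + z R\<^sub>k) \<cdots> (1 + z R\<^sub>1) Y\<^sub>\<lambda>\<close> for all scalars \<open>z\<close>.
  A partition \<open>\<lambda>\<close> is encoded by the set \<open>A = {\<lambda>\<^sub>i + k + 1 - i}\<close>, and \<open>Y\<^sub>\<lambda>\<close> is the sum of the
  \<open>p\<^bsup>inv\<^esup> Y\<^sub>w\<close> over the permutations \<open>w\<close> with \<open>w{1..k} = A\<close>, \<open>inv\<close> counting the inversions inside the
  two blocks.  The identity is proved by induction on \<open>n\<close>: those \<open>Y\<^sub>w\<close> with \<open>w(1) = n\<close> span a representation of the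
  same kind for \<open>n - 1\<close>, on which \<open>x\<^sub>1\<close> is the scalar \<open>t\<^sub>n\<close>.  If \<open>n \<in> A\<close>, then \<open>Y\<^sub>\<lambda>\<close> is obtained from that
  subspace by a partial symmetriser commuting with the product.  If \<open>n \<notin> A\<close>, then one moreover has to move
  \<open>n\<close> behind the first block by \<open>T\<^sub>k \<cdots> T\<^sub>1\<close>; commuting the product past it leaves exactly one correction term,
  which corresponds to a ribbon whose head is at \<open>n\<close>.  Only the relations of the algebra and the fact
  that \<open>Y\<close> of the longest permutation is an eigenvector of all \<open>x\<^sub>i\<close> are needed; the latter follows from the
  properties of the evaluation.\<close>

subsection \<open>Reduced words\<close>

text \<open>The full product is used rather than a single e_r because a factor in x_1 splits off
  from it, which lets n drop by one, while its symmetry in x_1, ..., x_k makes it commute with every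
  T_i inside a block. Pulling this product through \<open>T_k ... T_1\<close> produces an error at
  each of the k steps. Since the vector below is a q-eigenvector of \<open>T_2, ..., T_k\<close>,
  these errors assemble into one partial symmetriser applied to the product over x_2, ..., x_k. The
  symmetriser of the second block is still waiting outside; relative to the smaller representation
  it begins one place earlier, at the last letter a of the first block. Releasing a costs a factor p
  for each larger element of A and a factor q for each letter between a and n outside A. These
  numbers are ht - 1 and wd - 1 of the ribbon that replaces a by n. The order
  \<open>R_k ... R_1\<close> fits the same recursion: only R_1 changes the first row, and the first
  row is the largest element of the encoding set.\<close>

lemma sref_eq_transpose: "sref a = transpose a (Suc a)"
  by (auto simp: sref_def transpose_def fun_eq_iff)

lemma sref_apply: "sref a j = (if j = a then Suc a else if j = Suc a then a else j)"
  by (simp add: sref_def)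

lemma sref_permutes: "1 \<le> a \<Longrightarrow> a < n \<Longrightarrow> sref a permutes {1..n}"
  unfolding sref_eq_transpose by (rule permutes_swap_id) auto

lemma sref_sref [simp]: "sref a (sref a x) = x"
  by (auto simp: sref_apply)

lemma sref_comp_sref [simp]: "sref a \<circ> (sref a \<circ> f) = f"
  by (auto simp: fun_eq_iff)

lemma inv_sref [simp]: "inv (sref a) = sref a"
  by (rule inv_unique_comp) (auto simp: fun_eq_iff)

lemma inv_sref_comp:
  assumes "u permutes {1..n}"
  shows "inv (sref a \<circ> u) = inv u \<circ> sref a"
proof -
  have "bij (sref a)" by (simp add: sref_eq_transpose)
  then show ?thesis using o_inv_distrib[of "sref a" u] permutes_bij[OF assms] by simp
qed

section \<open>Inversions and length\<close>

definition inversions :: "nat \<Rightarrow> (nat \<Rightarrow> nat) \<Rightarrow> (nat \<times> nat) set" where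
  "inversions n w = {(i, j). 1 \<le> i \<and> i < j \<and> j \<le> n \<and> w j < w i}"

lemma perm_len_inversions: "perm_len n w = card (inversions n w)"
  by (simp add: perm_len_def inversions_def)

lemma finite_inversions [simp]: "finite (inversions n w)"
  by (rule finite_subset[of _ "{1..n} \<times> {1..n}"]) (auto simp: inversions_def)

lemma perm_len_id [simp]: "perm_len n id = 0"
proof -
  have "inversions n id = {}" by (auto simp: inversions_def)
  then show ?thesis by (simp add: perm_len_inversions)
qed

lemma sref_less_iff:
  assumes "x \<noteq> y" "{x, y} \<noteq> {a, Suc a}"
  shows "sref a x < sref a y \<longleftrightarrow> x < y"
  using assms by (auto simp: sref_apply)

text \<open>Left multiplication by \<open>sref a\<close> exchanges the two consecutive values a and
  a + 1, so only the pair of positions carrying them changes its order. That pair becomes an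
  inversion because a stood before a + 1.\<close>

lemma perm_len_sref_comp:
  assumes u: "u permutes {1..n}" and a: "1 \<le> a" "a < n" and asc: "inv u a < inv u (Suc a)"
  shows "perm_len n (sref a \<circ> u) = Suc (perm_len n u)"
proof -
  define i0 j0 where "i0 = inv u a" and "j0 = inv u (Suc a)"
  have ui: "u i0 = a" "u j0 = Suc a"
    using permutes_inverses(1)[OF u] by (auto simp: i0_def j0_def)
  have inu: "inv u permutes {1..n}" using u by (rule permutes_inv)
  have rng: "i0 \<in> {1..n}" "j0 \<in> {1..n}"
    using a permutes_in_image[OF inu] by (auto simp: i0_def j0_def)
  have inj: "u x = u y \<longleftrightarrow> x = y" for x y using permutes_inj[OF u] by (auto dest: injD)
  have "inversions n (sref a \<circ> u) = insert (i0, j0) (inversions n u)"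
  proof (intro set_eqI)
    fix ij :: "nat \<times> nat"
    obtain i j where ij: "ij = (i, j)" by force
    show "ij \<in> inversions n (sref a \<circ> u) \<longleftrightarrow> ij \<in> insert (i0, j0) (inversions n u)"
    proof (cases "{i, j} = {i0, j0}")
      case True
      then have "(i = i0 \<and> j = j0) \<or> (i = j0 \<and> j = i0)" by (auto simp: doubleton_eq_iff)
      then show ?thesis using rng asc ui unfolding i0_def[symmetric] j0_def[symmetric]
        by (auto simp: ij inversions_def sref_apply)
    next
      case False
      have "{u i, u j} \<noteq> {a, Suc a}"
        using False inj ui by (metis doubleton_eq_iff)
      then have "i \<noteq> j \<Longrightarrow> sref a (u j) < sref a (u i) \<longleftrightarrow> u j < u i"
        using sref_less_iff[of "u j" "u i" a] inj by (auto simp: insert_commute)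
      then show ?thesis using False by (auto simp: ij inversions_def)
    qed
  qed
  moreover have "(i0, j0) \<notin> inversions n u" using ui by (auto simp: inversions_def)
  ultimately show ?thesis by (simp add: perm_len_inversions)
qed

lemma perm_len_sref_comp_desc:
  assumes u: "u permutes {1..n}" and a: "1 \<le> a" "a < n" and "inv u (Suc a) < inv u a"
  shows "perm_len n u = Suc (perm_len n (sref a \<circ> u))"
proof -
  have "sref a \<circ> u permutes {1..n}"
    using permutes_compose[OF u sref_permutes[OF a]] .
  moreover have "inv (sref a \<circ> u) a < inv (sref a \<circ> u) (Suc a)"
    using assms(4) by (simp add: inv_sref_comp[OF u]) (simp add: sref_apply)
  ultimately show ?thesis using perm_len_sref_comp[of "sref a \<circ> u" n a] a by simp
qed

lemma inv_Suc_neq: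
  assumes "u permutes {1..n}" shows "inv u (Suc a) \<noteq> inv u a"
  using permutes_inj[OF permutes_inv[OF assms]] by (metis injD n_not_Suc_n)

lemma permutes_increasing_eq_id:
  fixes f :: "nat \<Rightarrow> nat"
  assumes f: "f permutes {1..n}" and inc: "\<And>a. 1 \<le> a \<Longrightarrow> a < n \<Longrightarrow> f a < f (Suc a)"
  shows "f = id"
proof
  fix x
  have ge: "i \<le> f i" if "1 \<le> i" "i \<le> n" for i
    using that
  proof (induction i rule: nat_induct_at_least)
    case base
    then show ?case using permutes_in_image[OF f, of 1] by auto
  next
    case (Suc m)
    then show ?case using inc[of m] by auto
  qed
  have le: "j < n \<Longrightarrow> f (n - j) \<le> n - j" for j
  proof (induction j)
    case 0
    then show ?case using permutes_in_image[OF f, of n] by auto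
  next
    case (Suc j)
    then have "f (n - Suc j) < f (Suc (n - Suc j))" by (intro inc) auto
    then show ?case using Suc by (simp add: Suc_diff_Suc)
  qed
  show "f x = id x"
  proof (cases "x \<in> {1..n}")
    case True
    then show ?thesis using ge[of x] le[of "n - x"] by auto
  next
    case False
    then show ?thesis using f by (simp add: permutes_def)
  qed
qed

section \<open>Words in the simple transpositions\<close>

definition word_perm :: "nat list \<Rightarrow> nat \<Rightarrow> nat" where
  "word_perm as = foldr (\<lambda>a f. sref a \<circ> f) as id"

lemma word_perm_simps [simp]:
  "word_perm [] = id" "word_perm (a # as) = sref a \<circ> word_perm as"
  by (simp_all add: word_perm_def)

lemma reduced_word_iff:
  "reduced_word n w as \<longleftrightarrow> set as \<subseteq> {1..<n} \<and> word_perm as = w \<and> length as = perm_len n w"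
  by (simp add: reduced_word_def word_perm_def)

lemma word_perm_permutes:
  "set as \<subseteq> {1..<n} \<Longrightarrow> word_perm as permutes {1..n}"
proof (induction as)
  case Nil
  then show ?case by (simp del: id_apply add: permutes_id)
next
  case (Cons a as)
  then have "word_perm as permutes {1..n}" "sref a permutes {1..n}"
    using sref_permutes[of a n] by auto
  then show ?case unfolding word_perm_simps by (rule permutes_compose)
qed

text \<open>Each letter changes the length by one, up or down. The bound shows that the first letter
  of a reduced word lengthens the permutation of its tail, so that the tail is reduced as
  well.\<close>

lemma perm_len_word_perm_le:
  "set as \<subseteq> {1..<n} \<Longrightarrow> perm_len n (word_perm as) \<le> length as"
proof (induction as)
  case (Cons a as)
  have w: "word_perm as permutes {1..n}" using Cons.prems by (intro word_perm_permutes) auto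
  have a: "1 \<le> a" "a < n" and IH: "perm_len n (word_perm as) \<le> length as" using Cons by auto
  have "perm_len n (sref a \<circ> word_perm as) \<le> Suc (perm_len n (word_perm as))"
  proof (cases "inv (word_perm as) a < inv (word_perm as) (Suc a)")
    case True
    then show ?thesis using perm_len_sref_comp[OF w a] by linarith
  next
    case False
    then show ?thesis using perm_len_sref_comp_desc[OF w a] inv_Suc_neq[OF w, of a] by linarith
  qed
  then show ?case using IH unfolding word_perm_simps list.size by linarith
qed simp

lemma reduced_word_permutes: "reduced_word n w as \<Longrightarrow> w permutes {1..n}"
  unfolding reduced_word_iff using word_perm_permutes by blast

lemma reduced_word_ConsI:
  assumes "reduced_word n (sref a \<circ> w) as" "w permutes {1..n}" "1 \<le> a" "a < n"
    "inv w (Suc a) < inv w a"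
  shows "reduced_word n w (a # as)"
  using assms perm_len_sref_comp_desc[OF assms(2-5)] by (auto simp: reduced_word_iff)

lemma reduced_word_ConsD:
  assumes "reduced_word n w (a # as)"
  shows "reduced_word n (sref a \<circ> w) as" "1 \<le> a" "a < n" "inv w (Suc a) < inv w a"
proof -
  have w: "w permutes {1..n}" using assms by (rule reduced_word_permutes)
  show a: "1 \<le> a" "a < n" using assms by (auto simp: reduced_word_iff)
  have eq: "sref a \<circ> w = word_perm as" using assms by (auto simp: reduced_word_iff)
  have as: "set as \<subseteq> {1..<n}" using assms by (auto simp: reduced_word_iff)
  have "perm_len n (sref a \<circ> w) \<le> length as" using perm_len_word_perm_le[OF as] eq by simp
  moreover have "perm_len n w = Suc (length as)" using assms by (simp add: reduced_word_iff)
  ultimately show d: "inv w (Suc a) < inv w a"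
    using perm_len_sref_comp[OF w a] inv_Suc_neq[OF w, of a] by (metis Suc_n_not_le_n le_SucI linorder_neqE_nat)
  show "reduced_word n (sref a \<circ> w) as"
    using perm_len_sref_comp_desc[OF w a d] assms eq by (auto simp: reduced_word_iff)
qed

lemma reduced_word_exists:
  "w permutes {1..n} \<Longrightarrow> \<exists>as. reduced_word n w as"
proof (induction "perm_len n w" arbitrary: w rule: less_induct)
  case less
  show ?case
  proof (cases "\<exists>a. 1 \<le> a \<and> a < n \<and> inv w (Suc a) < inv w a")
    case True
    then obtain a where a: "1 \<le> a" "a < n" "inv w (Suc a) < inv w a" by blast
    have "sref a \<circ> w permutes {1..n}"
      using permutes_compose[OF less.prems sref_permutes[OF a(1,2)]] .
    then obtain as where "reduced_word n (sref a \<circ> w) as"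
      using less.hyps perm_len_sref_comp_desc[OF less.prems a] by (metis lessI)
    then show ?thesis using reduced_word_ConsI[OF _ less.prems a] by blast
  next
    case False
    have "inv w = id"
      using False inv_Suc_neq[OF less.prems]
      by (intro permutes_increasing_eq_id[of _ n] permutes_inv less.prems) (metis linorder_neqE_nat)
    then have "w = id" using permutes_inv_inv[OF less.prems] by (metis inv_id)
    then have "reduced_word n w []" by (simp add: reduced_word_iff)
    then show ?thesis by blast
  qed
qed

definition word_op :: "(nat \<Rightarrow> 'v \<Rightarrow> 'v) \<Rightarrow> nat list \<Rightarrow> 'v \<Rightarrow> 'v" where
  "word_op T as = foldr (\<lambda>a g. T a \<circ> g) as id"

lemma word_op_simps [simp]:
  "word_op T [] = id" "word_op T (a # as) = T a \<circ> word_op T as"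
  by (simp_all add: word_op_def)

text \<open>Matsumoto's theorem; it frees \<open>Tw\<close> from the choice of a reduced word. The
  first letters a and b of the two words are both left descents, so there are reduced words
  beginning with ab and ba (with aba and bab if a and b are adjacent) that share their tail. Each
  given word is linked to one of these by the induction hypothesis, and a single relation links
  these two.\<close>

lemma matsumoto_word_op:
  assumes far: "\<And>i j v. i \<in> {1..<n} \<Longrightarrow> j \<in> {1..<n} \<Longrightarrow> i + 2 \<le> j \<Longrightarrow> T i (T j v) = T j (T i v)"
    and braid: "\<And>i v. 1 \<le> i \<Longrightarrow> Suc i < n \<Longrightarrow> T i (T (Suc i) (T i v)) = T (Suc i) (T i (T (Suc i) v))"
  shows "reduced_word n w as \<Longrightarrow> reduced_word n w bs \<Longrightarrow> word_op T as = word_op T bs"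
proof (induction "length as" arbitrary: w as bs rule: less_induct)
  case less
  have len: "length as = length bs" using less.prems by (simp add: reduced_word_iff)
  note w = reduced_word_permutes[OF less.prems(1)]
  show ?case
  proof (cases as)
    case Nil
    then show ?thesis using len by simp
  next
    case (Cons a as')
    then obtain b bs' where bs: "bs = b # bs'" using len by (cases bs) auto
    note A = reduced_word_ConsD[OF less.prems(1)[unfolded Cons]]
    note B = reduced_word_ConsD[OF less.prems(2)[unfolded bs]]
    have wa: "sref a \<circ> w permutes {1..n}" and wb: "sref b \<circ> w permutes {1..n}"
      using A(1) B(1) reduced_word_permutes by auto
    have IHa: "reduced_word n (sref a \<circ> w) cs \<Longrightarrow> word_op T as' = word_op T cs" for cs
      using less.hyps[OF _ A(1)] Cons by auto
    have IHb: "reduced_word n (sref b \<circ> w) cs \<Longrightarrow> word_op T bs' = word_op T cs" for cs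
      using less.hyps[OF _ B(1)] Cons len bs by auto
    have far': "word_op T as = word_op T bs" if "a + 2 \<le> b \<or> b + 2 \<le> a"
    proof -
      have d: "inv (sref a \<circ> w) (Suc b) < inv (sref a \<circ> w) b"
        "inv (sref b \<circ> w) (Suc a) < inv (sref b \<circ> w) a"
        using that A(4) B(4) by (auto simp: inv_sref_comp[OF w] sref_apply)
      have e: "sref a \<circ> (sref b \<circ> w) = sref b \<circ> (sref a \<circ> w)"
        using that by (auto simp: fun_eq_iff sref_apply)
      have "sref b \<circ> (sref a \<circ> w) permutes {1..n}"
        using permutes_compose[OF wa sref_permutes[OF B(2,3)]] .
      then obtain cs where cs: "reduced_word n (sref b \<circ> (sref a \<circ> w)) cs"
        using reduced_word_exists by blast
      have "word_op T as' = word_op T (b # cs)" "word_op T bs' = word_op T (a # cs)"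
        using IHa[OF reduced_word_ConsI[OF cs wa B(2,3) d(1)]]
          IHb[OF reduced_word_ConsI[OF cs[folded e] wb A(2,3) d(2)]] by auto
      moreover have "T a (T b v) = T b (T a v)" for v
        using that far[of a b v] far[of b a v] A(2,3) B(2,3) by auto
      ultimately show ?thesis by (simp add: Cons bs fun_eq_iff)
    qed
    have near: "word_op T as = word_op T bs" if ab: "b = Suc a \<or> a = Suc b"
    proof -
      have d: "inv (sref a \<circ> w) (Suc b) < inv (sref a \<circ> w) b"
        "inv (sref b \<circ> w) (Suc a) < inv (sref b \<circ> w) a"
        using ab A(4) B(4) by (auto simp: inv_sref_comp[OF w] sref_apply)
      have wba: "sref b \<circ> (sref a \<circ> w) permutes {1..n}" and wab: "sref a \<circ> (sref b \<circ> w) permutes {1..n}"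
        using permutes_compose[OF wa sref_permutes[OF B(2,3)]]
          permutes_compose[OF wb sref_permutes[OF A(2,3)]] by auto
      \<comment> \<open>With c the smaller of a and b, the values c, c + 1, c + 2 stand in reversed
        order in \<open>w\<close>, so three successive reductions are possible.\<close>
      have d2: "inv (sref b \<circ> (sref a \<circ> w)) (Suc a) < inv (sref b \<circ> (sref a \<circ> w)) a"
        "inv (sref a \<circ> (sref b \<circ> w)) (Suc b) < inv (sref a \<circ> (sref b \<circ> w)) b"
        using ab A(4) B(4)
        by (auto simp: inv_sref_comp[OF w] inv_sref_comp[OF wa] inv_sref_comp[OF wb] sref_apply)
      have e: "sref a \<circ> (sref b \<circ> (sref a \<circ> w)) = sref b \<circ> (sref a \<circ> (sref b \<circ> w))"
        using ab by (auto simp: fun_eq_iff sref_apply)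
      have "sref a \<circ> (sref b \<circ> (sref a \<circ> w)) permutes {1..n}"
        using permutes_compose[OF wba sref_permutes[OF A(2,3)]] .
      then obtain cs where cs: "reduced_word n (sref a \<circ> (sref b \<circ> (sref a \<circ> w))) cs"
        using reduced_word_exists by blast
      have "word_op T as' = word_op T (b # a # cs)"
        using IHa[OF reduced_word_ConsI[OF reduced_word_ConsI[OF cs wba A(2,3) d2(1)] wa B(2,3) d(1)]] .
      moreover have "word_op T bs' = word_op T (a # b # cs)"
        using IHb[OF reduced_word_ConsI[OF reduced_word_ConsI[OF cs[unfolded e] wab B(2,3) d2(2)] wb A(2,3) d(2)]] .
      moreover have "T a (T b (T a v)) = T b (T a (T b v))" for v
        using ab braid[of a v] braid[of b v] A(2,3) B(2,3) by auto
      ultimately show ?thesis by (simp add: Cons bs fun_eq_iff)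
    qed
    have "word_op T as = word_op T bs" if "a = b"
      using IHa B(1) that by (simp add: Cons bs)
    then show ?thesis using far' near by linarith
  qed
qed

lemma longest_permutes: "longest n permutes {1..n}"
proof (rule bij_imp_permutes)
  show "bij_betw (longest n) {1..n} {1..n}"
    by (rule bij_betw_byWitness[of _ "longest n"]) (auto simp: longest_def)
qed (auto simp: longest_def)

lemma longest_longest [simp]: "longest n (longest n x) = x"
  by (auto simp: longest_def)

lemma inv_longest [simp]: "inv (longest n) = longest n"
  by (rule inv_unique_comp) (auto simp: fun_eq_iff)

text \<open>Since \<open>Y\<^sub>w\<close> is built from \<open>w\<^sup>-\<^sup>1 w\<^sub>0\<close>, a right descent of \<open>w\<close> is a left ascent there.\<close>

lemma Ybas_descent:
  assumes far: "\<And>i j v. i \<in> {1..<n} \<Longrightarrow> j \<in> {1..<n} \<Longrightarrow> i + 2 \<le> j \<Longrightarrow> T i (T j v) = T j (T i v)"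
    and braid: "\<And>i v. 1 \<le> i \<Longrightarrow> Suc i < n \<Longrightarrow> T i (T (Suc i) (T i v)) = T (Suc i) (T i (T (Suc i) v))"
    and w: "w permutes {1..n}" and i: "1 \<le> i" "i < n" and desc: "w (Suc i) < w i"
  shows "T i (Ybas n T y0 w) = Ybas n T y0 (w \<circ> sref i)"
proof -
  define u where "u = inv w \<circ> longest n"
  have u: "u permutes {1..n}" unfolding u_def
    using permutes_compose[OF longest_permutes permutes_inv[OF w]] .
  have iu: "inv u = longest n \<circ> w"
    using o_inv_distrib[of "inv w" "longest n"] permutes_bij[OF longest_permutes]
      permutes_bij[OF permutes_inv[OF w]] permutes_inv_inv[OF w] by (simp add: u_def)
  have "w i \<in> {1..n}" "w (Suc i) \<in> {1..n}" using permutes_in_image[OF w] i by auto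
  then have lt: "inv u i < inv u (Suc i)" using desc by (auto simp: iu longest_def)
  have su: "sref i \<circ> u permutes {1..n}" using permutes_compose[OF u sref_permutes[OF i]] .
  have ws: "inv (w \<circ> sref i) \<circ> longest n = sref i \<circ> u"
    using o_inv_distrib[of w "sref i"] permutes_bij[OF w] permutes_bij[OF sref_permutes[OF i]]
    by (simp add: u_def comp_assoc)
  define as where "as = (SOME as. reduced_word n u as)"
  have as: "reduced_word n u as" unfolding as_def using reduced_word_exists[OF u] by (rule someI_ex)
  define bs where "bs = (SOME as. reduced_word n (sref i \<circ> u) as)"
  have bs: "reduced_word n (sref i \<circ> u) bs"
    unfolding bs_def using reduced_word_exists[OF su] by (rule someI_ex)
  have "reduced_word n (sref i \<circ> u) (i # as)"
    using as lt by (intro reduced_word_ConsI su i) (auto simp: inv_sref_comp[OF u] sref_apply)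
  then have "word_op T (i # as) = word_op T bs"
    using matsumoto_word_op[of n T, OF far braid] bs by blast
  then show ?thesis unfolding Ybas_def Tw_def word_op_def[symmetric] ws u_def[symmetric] as_def[symmetric] bs_def[symmetric]
    by (simp add: fun_eq_iff)
qed

lemma Ybas_longest: "Ybas n T y0 (longest n) = y0"
proof -
  have e: "inv (longest n) \<circ> longest n = id" by (auto simp: fun_eq_iff)
  have "reduced_word n id = (\<lambda>as. as = [])"
    by (auto simp: reduced_word_iff intro!: ext)
  then show ?thesis unfolding Ybas_def Tw_def e by simp
qed

subsection \<open>The vector \<open>Y\<close> of the longest permutation\<close>

lemma perm_len_le_longest: "perm_len n w \<le> perm_len n (longest n)"
  unfolding perm_len_inversions
  by (rule card_mono[OF finite_inversions]) (auto simp: inversions_def longest_def)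

lemma permutes_Suc_neq: "w permutes S \<Longrightarrow> w (Suc j) \<noteq> w j"
  using permutes_inj[of w S] by (metis injD n_not_Suc_n)

lemma inv_comp_sref:
  assumes "w permutes {1..n}" "1 \<le> j" "j < n"
  shows "inv (w \<circ> sref j) = sref j \<circ> inv w"
  using o_inv_distrib[of w "sref j"] permutes_bij[OF assms(1)] permutes_bij[OF sref_permutes[OF assms(2,3)]]
  by simp

lemma perm_len_inv_comp_sref_desc:
  assumes w: "w permutes {1..n}" and j: "1 \<le> j" "j < n" and "w (Suc j) < w j"
  shows "perm_len n (inv w) = Suc (perm_len n (inv (w \<circ> sref j)))"
  using perm_len_sref_comp_desc[OF permutes_inv[OF w] j] assms(4)
  by (simp only: inv_comp_sref[OF w j] permutes_inv_inv[OF w])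

lemma perm_len_inv_comp_sref_asc:
  assumes w: "w permutes {1..n}" and j: "1 \<le> j" "j < n" and "w j < w (Suc j)"
  shows "perm_len n (inv (w \<circ> sref j)) = Suc (perm_len n (inv w))"
  using perm_len_sref_comp[OF permutes_inv[OF w] j] assms(4)
  by (simp only: inv_comp_sref[OF w j] permutes_inv_inv[OF w])

text \<open>The coordinate of \<open>v\<close> at a permutation \<open>u\<close> with a descent at \<open>j\<close> is that of
  \<open>(T\<^sub>j + p - q) v\<close> at \<open>u s\<^sub>j\<close>; thus all coordinates of \<open>x\<^sub>i Y\<^sub>w\<close> are reduced to evaluations.\<close>

lemma schubert_rep_longest_eigen:
  assumes rep: "schubert_rep n scale T X p q h t y0 ev" and i: "i \<in> {1..n}"
  shows "X i y0 = scale (t (n + 1 - i)) y0"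
proof -
  interpret vector_space scale using rep by (simp add: schubert_rep_def)
  define Y where "Y = Ybas n T y0"
  define S where "S = {w. w permutes {1..n::nat}}"
  have linT: "Vector_Spaces.linear scale scale (T j)" if "1 \<le> j" "j < n" for j
    using rep that by (simp add: schubert_rep_def)
  have linX: "Vector_Spaces.linear scale scale (X j)" if "j \<in> {1..n}" for j
    using rep that by (simp add: schubert_rep_def)
  have linev: "Vector_Spaces.linear scale (*) ev"
    using rep by (simp add: schubert_rep_def)
  have quad: "T j (T j v) + scale (p - q) (T j v) - scale (p * q) v = 0" if "1 \<le> j" "j < n" for j v
    using rep that by (simp add: schubert_rep_def)
  have far: "T j (X l v) = X l (T j v)" if "1 \<le> j" "j < n" "l \<in> {1..n}" "l \<noteq> j" "l \<noteq> Suc j" for j l v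
    using rep that by (simp add: schubert_rep_def)
  have TX: "T j (X j v) = X (Suc j) (T j v) + (scale h v - scale (p - q) (X j v))" if "1 \<le> j" "j < n" for j v
    using rep that by (simp add: schubert_rep_def)
  have TX': "T j (X (Suc j) v) = X j (T j v) - (scale h v - scale (p - q) (X j v))" if "1 \<le> j" "j < n" for j v
    using rep that by (simp add: schubert_rep_def)
  have inj: "inj_on Y S" and ind: "independent (Y ` S)" and sp: "span (Y ` S) = UNIV"
    using rep by (simp_all add: schubert_rep_def Y_def S_def)
  have ev0: "w \<in> S \<Longrightarrow> (ev (Y w) \<noteq> 0) = (w = id)" for w
    using rep by (simp add: schubert_rep_def Y_def S_def)
  have evX: "w \<in> S \<Longrightarrow> j \<in> {1..n} \<Longrightarrow> ev (X j (Y w)) = t j * ev (Y w)" for w j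
    using rep by (simp add: schubert_rep_def Y_def S_def)
  have Sfin: "finite S" unfolding S_def by (rule finite_permutations) simp
  have Ss: "w \<circ> sref j \<in> S" if "w \<in> S" "1 \<le> j" "j < n" for w j
    using that permutes_compose[OF sref_permutes[OF that(2,3)], of w] by (simp add: S_def)
  have idS: "id \<in> S" unfolding S_def mem_Collect_eq by (rule permutes_id)
  have Td: "T j (Y w) = Y (w \<circ> sref j)" if "w \<in> S" "1 \<le> j" "j < n" "w (Suc j) < w j" for w j
    unfolding Y_def using that rep by (intro Ybas_descent) (auto simp: schubert_rep_def S_def)
  have ss: "(w \<circ> sref j) \<circ> sref j = w" for w :: "nat \<Rightarrow> nat" and j by (auto simp: fun_eq_iff)
  have Ta: "T j (Y w) = scale (p * q) (Y (w \<circ> sref j)) - scale (p - q) (Y w)"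
    if "w \<in> S" "1 \<le> j" "j < n" "w j < w (Suc j)" for w j
  proof -
    have "T j (Y (w \<circ> sref j)) = Y w"
      using Td[OF Ss[OF that(1-3)] that(2,3)] that(4) by (simp add: ss sref_apply)
    then show ?thesis using quad[OF that(2,3), of "Y (w \<circ> sref j)"] by (simp add: algebra_simps)
  qed
  define c where "c u v = representation (Y ` S) v (Y u)" for u v
  have inspan: "v \<in> span (Y ` S)" for v using sp by simp
  have c_add: "c u (v + v') = c u v + c u v'" for u v v'
    unfolding c_def by (simp add: representation_add[OF ind inspan inspan])
  have c_scale: "c u (scale a v) = a * c u v" for u v a
    unfolding c_def by (simp add: representation_scale[OF ind inspan])
  have c_diff: "c u (v - v') = c u v - c u v'" for u v v'
    unfolding c_def by (simp add: representation_diff[OF ind inspan inspan])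
  have c_zero: "c u 0 = 0" for u unfolding c_def by (simp add: representation_zero)
  have c_Y: "c u (Y w) = (if u = w then 1 else 0)" if "u \<in> S" "w \<in> S" for u w
    unfolding c_def using representation_basis[OF ind, of "Y w"] that inj
    by (auto dest: inj_onD)
  have expand: "v = (\<Sum>u\<in>S. scale (c u v) (Y u))" for v
  proof -
    have "v = (\<Sum>b\<in>Y ` S. scale (representation (Y ` S) v b) b)"
      using sum_representation_eq[OF ind inspan, of "Y ` S" v] Sfin by simp
    then show ?thesis by (simp add: sum.reindex[OF inj] c_def)
  qed
  have rec: "c u v = c (u \<circ> sref j) (T j v) + (p - q) * c (u \<circ> sref j) v"
    if u: "u \<in> S" "1 \<le> j" "j < n" "u (Suc j) < u j" for u j v
  proof -
    let ?u = "u \<circ> sref j"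
    interpret T: Vector_Spaces.linear scale scale "T j" using linT u(2,3) .
    have u': "?u \<in> S" using Ss u by blast
    have "v \<in> span (Y ` S)" by (rule inspan)
    then show ?thesis
    proof (induction rule: span_induct_alt)
      case base
      then show ?case by (simp add: c_zero T.zero)
    next
      case (step a y v)
      then obtain w where w: "y = Y w" "w \<in> S" by auto
      have eq: "?u = w \<circ> sref j \<longleftrightarrow> u = w" by (metis ss)
      have eq2: "?u = w \<longleftrightarrow> u = w \<circ> sref j" by (metis ss)
      \<comment> \<open>The summand \<open>p - q\<close> is chosen for the case of an ascent: there
        \<open>T_j Y_w + (p - q) Y_w\<close> is a multiple of \<open>Y\<close> at
        \<open>w s_j\<close>, and no component at \<open>w\<close> remains. At a descent
        \<open>T_j\<close> only relabels the basis vector.\<close>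
      have y: "c u y = c ?u (T j y) + (p - q) * c ?u y"
      proof (cases "w (Suc j) < w j")
        case True
        then have "?u \<noteq> w" using u(4) by (auto simp: sref_apply)
        then show ?thesis using Td[OF w(2) u(2,3) True] w u' u(1) Ss[OF w(2) u(2,3)] eq
          by (simp add: c_Y)
      next
        case False
        moreover have "w (Suc j) \<noteq> w j"
          using w(2) permutes_Suc_neq unfolding S_def by blast
        ultimately have F: "w j < w (Suc j)" by simp
        then have "u \<noteq> w" using u(4) by auto
        then show ?thesis using Ta[OF w(2) u(2,3) F] w u' u(1) Ss[OF w(2) u(2,3)] eq
          by (simp add: c_Y c_diff c_scale)
      qed
      show ?case unfolding c_add c_scale T.add T.scale step(2) y by (simp only: algebra_simps)
    qed
  qed
  \<comment> \<open>Triangularity of x_l: among the coordinates of \<open>x_l Y_w\<close> at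
    permutations no longer than \<open>w\<close>, only the one at \<open>w\<close> survives. Lengths
    of inverses appear because right multiplication by \<open>s_j\<close> is left multiplication on
    the inverse, where the length lemmas apply.\<close>
  have tri: "u \<in> S \<Longrightarrow> w \<in> S \<Longrightarrow> l \<in> {1..n} \<Longrightarrow> perm_len n (inv u) \<le> perm_len n (inv w)
      \<Longrightarrow> c u (X l (Y w)) = (if u = w then t (w l) else 0)" for u w l
  proof (induction "perm_len n (inv u)" arbitrary: u w l rule: less_induct)
    case less
    note u = less.prems(1) and w = less.prems(2)
    show ?case
    proof (cases "\<exists>j. 1 \<le> j \<and> j < n \<and> u (Suc j) < u j")
      case False
      have neq: "u (Suc j) \<noteq> u j" for j
        using u permutes_Suc_neq unfolding S_def by blast
      have "u j < u (Suc j)" if "1 \<le> j" "j < n" for j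
        using False neq[of j] that by (metis linorder_neqE_nat)
      then have uid: "u = id" using u permutes_increasing_eq_id[of u n] by (auto simp: S_def)
      interpret ev: Vector_Spaces.linear scale "(*)" ev using linev .
      \<comment> \<open>Only the basis vector at \<open>id\<close> has nonzero evaluation, so
        \<open>ev\<close> reads off the coordinate at \<open>id\<close> up to a nonzero
        factor.\<close>
      have evs: "ev v = c id v * ev (Y id)" for v
      proof -
        have "ev v = (\<Sum>u\<in>S. c u v * ev (Y u))"
          by (subst expand[of v]) (simp add: ev.sum ev.scale)
        also have "\<dots> = (\<Sum>u\<in>S. if u = id then c id v * ev (Y id) else 0)"
          using ev0 by (intro sum.cong) auto
        also have "\<dots> = c id v * ev (Y id)" using idS Sfin by (subst sum.delta) auto
        finally show ?thesis .
      qed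
      have nz: "ev (Y id) \<noteq> 0" using ev0[OF idS] by blast
      have "c id (X l (Y w)) * ev (Y id) = t l * (c id (Y w) * ev (Y id))"
        using evX[OF w less.prems(3)] evs by metis
      then have "c id (X l (Y w)) = t l * c id (Y w)" using nz by simp
      then show ?thesis unfolding uid using c_Y[OF idS w] by auto
    next
      case True
      then obtain j where j: "1 \<le> j" "j < n" "u (Suc j) < u j" by blast
      let ?u = "u \<circ> sref j"
      have us: "u permutes {1..n}" and ws: "w permutes {1..n}" using u w by (auto simp: S_def)
      have u': "?u \<in> S" using Ss u j by blast
      have lu: "perm_len n (inv u) = Suc (perm_len n (inv ?u))"
        using perm_len_inv_comp_sref_desc[OF us j] .
      have IH: "w' \<in> S \<Longrightarrow> l' \<in> {1..n} \<Longrightarrow> perm_len n (inv ?u) \<le> perm_len n (inv w')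
        \<Longrightarrow> c ?u (X l' (Y w')) = (if ?u = w' then t (w' l') else 0)" for w' l'
        using less.hyps[of ?u w' l'] lu u' by simp
      have uw: "?u \<noteq> w" using lu less.prems(4) by auto
      \<comment> \<open>Since \<open>u s_j\<close> is strictly shorter than \<open>w\<close>, its
        coordinates in \<open>Y_w\<close> and in all \<open>x_l Y_w\<close> vanish. This removes the
        term with \<open>p - q\<close> from \<open>rec\<close> and the inhomogeneous terms from the
        commutation of \<open>T_j\<close> with x_l.\<close>
      have z1: "c ?u (X l' (Y w)) = 0" if "l' \<in> {1..n}" for l'
        using IH[OF w that] uw lu less.prems(4) by simp
      have z2: "c ?u (Y w) = 0" using c_Y[OF u' w] uw by simp
      have sl: "sref j l \<in> {1..n}" using j less.prems(3) by (auto simp: sref_apply)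
      have jn: "j \<in> {1..n}" "Suc j \<in> {1..n}" using j by auto
      have "c u (X l (Y w)) = c ?u (T j (X l (Y w)))"
        using rec[OF u j] z1[OF less.prems(3)] by simp
      also have "\<dots> = c ?u (X (sref j l) (T j (Y w)))"
      proof -
        consider "l = j" | "l = Suc j" | "l \<noteq> j" "l \<noteq> Suc j" by blast
        then show ?thesis
        proof cases
          case 1
          then show ?thesis using TX[OF j(1,2), of "Y w"] z1[OF jn(1)] z2
            by (simp add: sref_apply c_add c_diff c_scale)
        next
          case 2
          then show ?thesis using TX'[OF j(1,2), of "Y w"] z1[OF jn(1)] z2
            by (simp add: sref_apply c_add c_diff c_scale)
        next
          case 3
          then show ?thesis using far[OF j(1,2) less.prems(3) 3, of "Y w"]
            by (simp add: sref_apply)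
        qed
      qed
      also have "\<dots> = (if u = w then t (w l) else 0)"
      proof (cases "w (Suc j) < w j")
        case True
        have "perm_len n (inv ?u) \<le> perm_len n (inv (w \<circ> sref j))"
          using perm_len_inv_comp_sref_desc[OF ws j(1,2) True] lu less.prems(4) by simp
        then have "c ?u (X (sref j l) (Y (w \<circ> sref j))) = (if ?u = w \<circ> sref j then t ((w \<circ> sref j) (sref j l)) else 0)"
          using IH Ss[OF w j(1,2)] sl by blast
        moreover have "?u = w \<circ> sref j \<longleftrightarrow> u = w" by (metis ss)
        ultimately show ?thesis using Td[OF w j(1,2) True] by simp
      next
        case False
        moreover have "w (Suc j) \<noteq> w j"
          using ws by (rule permutes_Suc_neq)
        ultimately have F: "w j < w (Suc j)" by simp
        interpret X: Vector_Spaces.linear scale scale "X (sref j l)" using linX[OF sl] .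
        have lw: "perm_len n (inv (w \<circ> sref j)) = Suc (perm_len n (inv w))"
          using perm_len_inv_comp_sref_asc[OF ws j(1,2) F] .
        then have "?u \<noteq> w \<circ> sref j" using lu less.prems(4) by auto
        then have "c ?u (X (sref j l) (Y (w \<circ> sref j))) = 0"
          using IH[OF Ss[OF w j(1,2)] sl] lw lu less.prems(4) by simp
        moreover have "u \<noteq> w" using F j by auto
        ultimately show ?thesis using Ta[OF w j(1,2) F] z1[OF sl]
          by (simp add: X.diff X.scale c_diff c_scale)
      qed
      finally show ?thesis .
    qed
  qed
  have LS: "longest n \<in> S" using longest_permutes by (simp add: S_def)
  have Yl: "Y (longest n) = y0" by (simp add: Y_def Ybas_longest)
  \<comment> \<open>No permutation is longer than \<open>longest n\<close>, so for
    \<open>w = longest n\<close> the claim \<open>tri\<close> covers every coordinate.\<close>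
  have "X i y0 = (\<Sum>u\<in>S. scale (c u (X i y0)) (Y u))" by (rule expand)
  also have "\<dots> = (\<Sum>u\<in>S. if u = longest n then scale (t (longest n i)) y0 else 0)"
  proof (rule sum.cong)
    fix u assume u: "u \<in> S"
    then have "c u (X i y0) = (if u = longest n then t (longest n i) else 0)"
      using tri[OF u LS i] perm_len_le_longest[of n "inv u"] by (simp add: Yl)
    then show "scale (c u (X i y0)) (Y u) = (if u = longest n then scale (t (longest n i)) y0 else 0)"
      by (simp add: Yl)
  qed simp
  also have "\<dots> = scale (t (longest n i)) y0" using LS Sfin by (subst sum.delta) auto
  finally show ?thesis using i by (simp add: longest_def)
qed

subsection \<open>Commutation relations\<close>

text \<open>The homogeneous relations are required for all indices, which spares range conditions in
  products over intervals. The quadratic relation and the two relations with an inhomogeneous term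
  keep \<open>1 \<le> i < n\<close>, as they would fail for operators set to zero outside the
  range.\<close>

locale affine_hecke = vector_space scale
  for scale :: "'f::field \<Rightarrow> 'v::ab_group_add \<Rightarrow> 'v"  (infixr \<open>*s\<close> 75) +
  fixes n :: nat and T X :: "nat \<Rightarrow> 'v \<Rightarrow> 'v" and p q h :: 'f
  assumes linear_T: "Vector_Spaces.linear scale scale (T i)"
    and linear_X: "Vector_Spaces.linear scale scale (X i)"
    and T_T: "1 \<le> i \<Longrightarrow> i < n \<Longrightarrow> T i (T i v) = (p * q) *s v - (p - q) *s T i v"
    and T_far: "i + 2 \<le> j \<Longrightarrow> T i (T j v) = T j (T i v)"
    and T_braid: "T i (T (Suc i) (T i v)) = T (Suc i) (T i (T (Suc i) v))"
    and X_X: "X i (X j v) = X j (X i v)"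
    and T_X_far: "j \<noteq> i \<Longrightarrow> j \<noteq> Suc i \<Longrightarrow> T i (X j v) = X j (T i v)"
    and T_X: "1 \<le> i \<Longrightarrow> i < n \<Longrightarrow> T i (X i v) = X (Suc i) (T i v) + (h *s v - (p - q) *s X i v)"
    and T_X_Suc: "1 \<le> i \<Longrightarrow> i < n \<Longrightarrow> T i (X (Suc i) v) = X i (T i v) - (h *s v - (p - q) *s X i v)"
begin

abbreviation lin :: "('v \<Rightarrow> 'v) \<Rightarrow> bool" where
  "lin F \<equiv> Vector_Spaces.linear scale scale F"

lemma lin_simps:
  assumes "lin F"
  shows "F (u + v) = F u + F v" "F (u - v) = F u - F v" "F (a *s v) = a *s F v" "F 0 = 0"
    "F (sum f A) = (\<Sum>x\<in>A. F (f x))"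
proof -
  interpret Vector_Spaces.linear scale scale F by fact
  show "F (u + v) = F u + F v" "F (u - v) = F u - F v" "F (a *s v) = a *s F v" "F 0 = 0"
    "F (sum f A) = (\<Sum>x\<in>A. F (f x))"
    by (simp_all add: add diff scale zero sum)
qed

lemma linI:
  assumes "\<And>u v. F (u + v) = F u + F v" "\<And>a v. F (a *s v) = a *s F v"
  shows "lin F"
  by unfold_locales (simp_all add: assms algebra_simps)

lemmas T_lin [simp] = lin_simps[OF linear_T]
lemmas X_lin [simp] = lin_simps[OF linear_X]

text \<open>The product \<open>T_{b-1} ... T_a\<close>, with T_a applied first. On words it carries
  the letter in position a to position b, provided that letter exceeds all those it passes.\<close>

definition Tdown :: "nat \<Rightarrow> nat \<Rightarrow> 'v \<Rightarrow> 'v" where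
  "Tdown a b = fold T [a..<b]"

text \<open>The generating function, in z, of the elementary symmetric polynomials in x_a, ...,
  x_{b-1}.\<close>

definition Egen :: "'f \<Rightarrow> nat \<Rightarrow> nat \<Rightarrow> 'v \<Rightarrow> 'v" where
  "Egen z a b = fold (\<lambda>i v. v + z *s X i v) [a..<b]"

text \<open>The sum over the minimal representatives of the cosets of \<open>S_1 x S_{j-1}\<close>
  in \<open>S_j\<close>, acting on positions a, ..., a + j - 1. The power of p in
  \<open>Psym_sum\<close> is the number of inversions of a largest letter that has been carried over
  l letters and has j - 1 - l letters behind it.\<close>

primrec Psym :: "nat \<Rightarrow> nat \<Rightarrow> 'v \<Rightarrow> 'v" where
  "Psym a 0 v = 0"
| "Psym a (Suc j) v = p *s Psym a j v + Tdown a (a + j) v"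

lemma Tdown_refl [simp]: "b \<le> a \<Longrightarrow> Tdown a b v = v"
  by (simp add: Tdown_def)

lemma Tdown_Suc: "a \<le> b \<Longrightarrow> Tdown a (Suc b) v = T b (Tdown a b v)"
  by (simp add: Tdown_def)

lemma Tdown_Cons: "a < b \<Longrightarrow> Tdown a b v = Tdown (Suc a) b (T a v)"
  by (simp add: Tdown_def upt_conv_Cons)

lemma Tdown_append: "b \<le> c \<Longrightarrow> a \<le> b \<Longrightarrow> Tdown b c (Tdown a b v) = Tdown a c v"
  by (induction c rule: dec_induct) (auto simp: Tdown_Suc)

lemma Egen_refl [simp]: "b \<le> a \<Longrightarrow> Egen z a b v = v"
  by (simp add: Egen_def)

lemma Egen_Suc: "a \<le> b \<Longrightarrow> Egen z a (Suc b) v = Egen z a b v + z *s X b (Egen z a b v)"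
  by (simp add: Egen_def)

lemma Egen_Cons: "a < b \<Longrightarrow> Egen z a b v = Egen z (Suc a) b (v + z *s X a v)"
  by (simp add: Egen_def upt_conv_Cons)

lemma Egen_append: "b \<le> c \<Longrightarrow> a \<le> b \<Longrightarrow> Egen z b c (Egen z a b v) = Egen z a c v"
  by (induction c rule: dec_induct) (auto simp: Egen_Suc)

lemma linear_Tdown: "lin (Tdown a b)"
proof (rule linI)
  show "Tdown a b (u + v) = Tdown a b u + Tdown a b v" for u v
    by (induction b) (auto simp: Tdown_def)
  show "Tdown a b (c *s v) = c *s Tdown a b v" for c v
    by (induction b) (auto simp: Tdown_def)
qed

lemma linear_Egen: "lin (Egen z a b)"
proof (rule linI)
  show "Egen z a b (u + v) = Egen z a b u + Egen z a b v" for u v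
    by (induction b) (auto simp: Egen_def algebra_simps)
  show "Egen z a b (c *s v) = c *s Egen z a b v" for c v
    by (induction b) (auto simp: Egen_def algebra_simps)
qed

lemmas Tdown_lin [simp] = lin_simps[OF linear_Tdown]
lemmas Egen_lin [simp] = lin_simps[OF linear_Egen]

lemma linear_Psym: "lin (Psym a j)"
proof (rule linI)
  show "Psym a j (u + v) = Psym a j u + Psym a j v" for u v
    by (induction j) (auto simp: algebra_simps)
  show "Psym a j (c *s v) = c *s Psym a j v" for c v
    by (induction j) (auto simp: algebra_simps)
qed

lemmas Psym_lin [simp] = lin_simps[OF linear_Psym]

lemma Psym_sum: "Psym a j v = (\<Sum>l<j. p ^ (j - Suc l) *s Tdown a (a + l) v)"
proof (induction j)
  case (Suc j)
  have "(\<Sum>l<j. p ^ (j - l) *s Tdown a (a + l) v) = (\<Sum>l<j. p *s (p ^ (j - Suc l) *s Tdown a (a + l) v))"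
    by (intro sum.cong) (auto simp: Suc_diff_Suc power_Suc[symmetric] simp del: power_Suc)
  then show ?case by (simp add: Suc scale_sum_right)
qed simp

section \<open>Commuting operators past the products and symmetrisers\<close>

lemma Tdown_comm:
  assumes "\<And>i v. a \<le> i \<Longrightarrow> i < b \<Longrightarrow> F (T i v) = T i (F v)"
  shows "F (Tdown a b v) = Tdown a b (F v)"
  using assms by (induction b) (auto simp: Tdown_def)

lemma Psym_comm:
  assumes "lin F" "\<And>i v. a \<le> i \<Longrightarrow> Suc i < a + j \<Longrightarrow> F (T i v) = T i (F v)"
  shows "F (Psym a j v) = Psym a j (F v)"
  using assms(2)
proof (induction j)
  case (Suc j)
  have "F (Tdown a (a + j) v) = Tdown a (a + j) (F v)"
    using Suc.prems by (intro Tdown_comm) auto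
  then show ?case using Suc by (simp add: lin_simps[OF assms(1)])
qed (simp add: lin_simps[OF assms(1)])

lemma Egen_comm:
  assumes "lin F" "\<And>i v. a \<le> i \<Longrightarrow> i < b \<Longrightarrow> F (X i v) = X i (F v)"
  shows "F (Egen z a b v) = Egen z a b (F v)"
  using assms(2) by (induction b) (auto simp: Egen_def lin_simps[OF assms(1)])

lemma X_Egen: "X i (Egen z a b v) = Egen z a b (X i v)"
  by (rule Egen_comm[OF linear_X X_X])

lemma Egen_Suc_inner: "a \<le> b \<Longrightarrow> Egen z a (Suc b) v = Egen z a b (v + z *s X b v)"
  by (simp add: Egen_Suc X_Egen)

lemma T_Tdown_far: "b < i \<or> Suc i < a \<Longrightarrow> T i (Tdown a b v) = Tdown a b (T i v)"
  by (rule Tdown_comm) (auto intro: T_far T_far[symmetric])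

lemma T_Egen_far:
  "b \<le> i \<or> Suc i < a \<Longrightarrow> T i (Egen z a b v) = Egen z a b (T i v)"
  by (rule Egen_comm[OF linear_T T_X_far]) auto

text \<open>Only the factors with x_i and x_{i+1} interact with T_i. In T_i (x_i + x_{i+1}) and in
  T_i x_i x_{i+1} the inhomogeneous terms cancel, so the product of the two factors commutes with
  T_i.\<close>

lemma T_Egen:
  assumes "1 \<le> i" "i < n" "a \<le> i" "Suc i < b"
  shows "T i (Egen z a b v) = Egen z a b (T i v)"
proof -
  have split: "Egen z a b v = Egen z (Suc (Suc i)) b (Egen z i (Suc (Suc i)) (Egen z a i v))" for v
    using assms by (simp add: Egen_append)
  have pair: "T i (Egen z i (Suc (Suc i)) v) = Egen z i (Suc (Suc i)) (T i v)" for v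
  proof -
    have 1: "T i (X (Suc i) (X i v)) = X (Suc i) (X i (T i v))"
      using assms X_X[of i "Suc i"] by (simp add: T_X T_X_Suc algebra_simps)
    show ?thesis
      using assms by (simp add: Egen_Suc 1) (simp add: T_X T_X_Suc algebra_simps)
  qed
  show ?thesis
    unfolding split by (simp add: T_Egen_far pair)
qed

text \<open>One braid relation, applied where T_{i+1} meets \<open>T_{i+1} T_i\<close>; all other
  generators are far away. The index drops because a letter carried to the right pushes those it
  passes one place to the left.\<close>

lemma Tdown_T_Suc:
  assumes "a \<le> i" "Suc i < b"
  shows "Tdown a b (T (Suc i) v) = T i (Tdown a b v)"
proof -
  have split: "Tdown a b v = Tdown (Suc (Suc i)) b (T (Suc i) (T i (Tdown a i v)))" for v
    using assms by (simp add: Tdown_append flip: Tdown_Suc)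
  have "Tdown a b (T (Suc i) v) = Tdown (Suc (Suc i)) b (T (Suc i) (T i (T (Suc i) (Tdown a i v))))"
    unfolding split by (simp only: T_Tdown_far[OF disjI1[OF lessI]])
  also have "\<dots> = Tdown (Suc (Suc i)) b (T i (T (Suc i) (T i (Tdown a i v))))"
    by (simp only: T_braid)
  also have "\<dots> = T i (Tdown a b v)"
    unfolding split by (simp only: T_Tdown_far[OF disjI2[OF lessI]])
  finally show ?thesis .
qed

lemma Tdown_Psym_Suc:
  "a + j \<le> b \<Longrightarrow> Tdown a b (Psym (Suc a) j v) = Psym a j (Tdown a b v)"
proof (induction j)
  case (Suc j)
  have "l \<le> j \<Longrightarrow> Tdown a b (Tdown (Suc a) (Suc a + l) v) = Tdown a (a + l) (Tdown a b v)" for l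
    using Suc.prems by (induction l) (auto simp: Tdown_Suc Tdown_T_Suc)
  then show ?case using Suc by simp
qed simp

text \<open>The double symmetriser has the right factor p + T_a, as it treats the two leading
  letters alike, and (p + T_a) T_a = q (p + T_a) is the quadratic relation. The recursion
  \<open>rec\<close> exhibits this factor one term at a time.\<close>

lemma Psym_Psym_T:
  assumes "1 \<le> a" "a < n"
  shows "Psym a (Suc k) (Psym (Suc a) k (T a v)) = q *s Psym a (Suc k) (Psym (Suc a) k v)"
proof (induction k)
  case (Suc k)
  let ?D = "Tdown (Suc a) (Suc a + k)"
  have rec: "Psym a (Suc (Suc k)) (Psym (Suc a) (Suc k) w) =
      (p * p) *s Psym a (Suc k) (Psym (Suc a) k w) + Psym a (Suc k) (?D (p *s w + T a w))" for w
  proof -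
    have "Psym a (Suc (Suc k)) (Psym (Suc a) (Suc k) w) =
      p *s Psym a (Suc k) (Psym (Suc a) (Suc k) w) + Tdown a (a + Suc k) (Psym (Suc a) (Suc k) w)"
      by (rule Psym.simps)
    also have "Tdown a (a + Suc k) (Psym (Suc a) (Suc k) w) = Psym a (Suc k) (?D (T a w))"
      by (subst Tdown_Psym_Suc) (simp_all only: Tdown_Cons[of a "a + Suc k"] order.refl, simp)
    finally show ?thesis by (simp add: scale_right_distrib del: Psym.simps(2) add: Psym.simps(2)[of "Suc a"])
  qed
  have "p *s T a v + T a (T a v) = q *s (p *s v + T a v)"
    by (simp add: T_T[OF assms] algebra_simps)
  then show ?case unfolding rec by (simp del: Psym.simps add: Suc scale_right_distrib mult.commute)
qed simp

text \<open>The induction uses \<open>z (\<hbar> - (p-q) x\<^sub>b) = (p - q + z \<hbar>) - (p-q) (1 + z x\<^sub>b)\<close>: in the second summand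
  the factor \<open>1 + z x\<^sub>b\<close> completes the product to one commuting with the \<open>T\<^sub>i\<close>.\<close>

lemma Egen_Tdown:
  assumes "1 \<le> a"
  shows "a + k \<le> n \<Longrightarrow> (\<And>i. a < i \<Longrightarrow> i < a + k \<Longrightarrow> T i v = q *s v) \<Longrightarrow>
    Egen z a (a + k) (Tdown a (a + k) v) = Tdown a (a + k) (Egen z (Suc a) (Suc (a + k)) v)
      + z *s Psym a k (Egen z (Suc a) (a + k) (h *s v - (p - q) *s X a v))"
proof (induction k arbitrary: v)
  case (Suc k)
  define b where "b = a + k"
  have b: "1 \<le> b" "b < n" "a \<le> b" using assms Suc.prems(1) by (auto simp: b_def)
  define c where "c = p - q"
  define u where "u = Tdown a b v"
  define v' where "v' = v + z *s X (Suc b) v"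
  define w where "w = Egen z (Suc a) (Suc b) v"
  define e where "e = Egen z (Suc a) b (h *s v - c *s X a v)"
  define y where "y = Egen z (Suc a) (Suc b) (h *s v - c *s X a v)"
  define D where "D = Tdown a b"
  have linD: "lin D" unfolding D_def by (rule linear_Tdown)
  note D_lin = lin_simps[OF linD]
  have inv: "T i v = q *s v" if "a < i" "i < Suc b" for i
    using Suc.prems(2)[of i] that by (simp add: b_def)
  have IH: "Egen z a b (D v) = D w + z *s Psym a k e"
    using Suc.IH[of v] Suc.prems by (simp add: b_def D_def w_def e_def c_def)
  have XD: "X i (Tdown a b v) = Tdown a b (X i v)" if "b < i" for i v
    using that by (intro Tdown_comm) (auto simp: T_X_far)
  \<comment> \<open>The induction hypothesis is used twice: at \<open>v'\<close> for the term in
    which x_b has passed through T_b and become x_{b+1}, and at \<open>v\<close> for the remaining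
    term.\<close>
  have IH': "Egen z a b (D v') = D (Egen z (Suc a) (Suc b) v')
      + z *s Psym a k (Egen z (Suc a) b (h *s v' - c *s X a v'))"
  proof -
    have "T i v' = q *s v'" if "a < i" "i < a + k" for i
      using that inv[of i] by (simp add: v'_def T_X_far b_def algebra_simps)
    then show ?thesis
      using Suc.IH[of v'] Suc.prems(1) by (simp add: b_def D_def c_def)
  qed
  have 1: "Egen z a (Suc b) (T b u) = T b (Egen z a b (D v')) + z *s Egen z a b (h *s u - c *s X b u)"
  proof -
    have "X b (T b u) = T b (X (Suc b) u) + (h *s u - c *s X b u)"
      using T_X_Suc[OF b(1,2), of u] by (simp add: c_def)
    moreover have "D v' = u + z *s X (Suc b) u"
      by (simp add: v'_def u_def XD D_def)
    ultimately have "T b u + z *s X b (T b u) = T b (D v') + z *s (h *s u - c *s X b u)"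
      by (simp add: scale_right_distrib)
    then show ?thesis
      using b by (simp only: Egen_Suc_inner T_Egen_far[OF disjI1[OF order.refl]] Egen_lin)
  qed
  have 2: "T b (Egen z a b (D v')) = Tdown a (Suc b) (Egen z (Suc a) (Suc (Suc b)) v)
      + z *s (p *s Psym a k y - (c + z * h) *s Psym a k e)"
  proof -
    have "T b (D (Egen z (Suc a) (Suc b) v')) = Tdown a (Suc b) (Egen z (Suc a) (Suc (Suc b)) v)"
      using b by (simp add: Tdown_Suc v'_def Egen_Suc_inner[of "Suc a" "Suc b"] D_def)
    moreover have "T b (Psym a k (Egen z (Suc a) b (h *s v' - c *s X a v')))
        = p *s Psym a k y - (c + z * h) *s Psym a k e"
    proof (cases "k = 0")
      \<comment> \<open>For k = 0 the symmetriser is the empty sum. For k > 0 the index b exceeds a,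
        so \<open>v\<close> is a q-eigenvector of T_b; its image \<open>T b v'\<close> then splits
        into a term with factor p, needed for \<open>Psym a (Suc k)\<close>, and a multiple of
        \<open>v\<close>.\<close>
      case False
      then have ab: "a < b" by (simp add: b_def)
      have Tv: "T b v = q *s v" using inv ab by simp
      have Tv': "T b v' = p *s (v + z *s X b v) - (c + z * h) *s v"
        by (simp add: v'_def T_X_Suc[OF b(1,2)] Tv c_def algebra_simps)
      have "T b (h *s v' - c *s X a v') = h *s T b v' - c *s X a (T b v')"
        using ab by (simp add: T_X_far)
      then have *: "T b (h *s v' - c *s X a v') =
          p *s (h *s v - c *s X a v + z *s X b (h *s v - c *s X a v)) - (c + z * h) *s (h *s v - c *s X a v)"
        unfolding Tv' by (simp add: X_X[of a b] algebra_simps)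
      have "T b (Psym a k (Egen z (Suc a) b (h *s v' - c *s X a v'))) =
         Psym a k (T b (Egen z (Suc a) b (h *s v' - c *s X a v')))"
        by (rule Psym_comm[OF linear_T]) (auto simp: b_def intro: T_far[symmetric])
      also have "\<dots> = Psym a k (Egen z (Suc a) b (T b (h *s v' - c *s X a v')))"
        by (simp only: T_Egen_far[OF disjI1[OF order.refl]])
      also have "\<dots> = p *s Psym a k y - (c + z * h) *s Psym a k e"
        unfolding * y_def using ab by (simp add: Egen_Suc_inner e_def algebra_simps)
      finally show ?thesis .
    qed simp
    ultimately show ?thesis unfolding IH' by simp
  qed
  \<comment> \<open>The completed product passes freely through \<open>D\<close>. What is left over,
    a multiple of \<open>Psym a k e\<close>, cancels against the unwanted term of step 2, and
    \<open>D y\<close> is the new last term of \<open>Psym a (Suc k) y\<close>.\<close>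
  have 3: "z *s Egen z a b (h *s u - c *s X b u) = z *s D y + (z * (c + z * h)) *s Psym a k e"
  proof -
    have "Egen z a (Suc b) u = D (Egen z a (Suc b) v)"
      unfolding u_def D_def using assms b by (intro Tdown_comm T_Egen[symmetric]) auto
    also have "\<dots> = D w + z *s D (Egen z (Suc a) (Suc b) (X a v))"
      using b Egen_Cons[of a "Suc b" z v] by (simp add: w_def D_lin)
    finally have E1: "Egen z a (Suc b) u = D w + z *s D (Egen z (Suc a) (Suc b) (X a v))" .
    have y: "y = h *s w - c *s Egen z (Suc a) (Suc b) (X a v)" by (simp add: y_def w_def)
    have "z *s Egen z a b (h *s u - c *s X b u) = (c + z * h) *s Egen z a b u - c *s Egen z a (Suc b) u"
      using b by (simp add: Egen_Suc_inner algebra_simps)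
    then show ?thesis unfolding E1 y using IH by (simp add: u_def D_def D_lin algebra_simps)
  qed
  have "Egen z a (Suc b) (T b u) = Tdown a (Suc b) (Egen z (Suc a) (Suc (Suc b)) v) + z *s Psym a (Suc k) y"
    unfolding 1 2 3 by (simp add: D_def b_def algebra_simps)
  then show ?case using b by (simp add: b_def u_def y_def c_def Tdown_Suc)
qed simp

end

subsection \<open>Words\<close>

fun inv_list :: "nat list \<Rightarrow> nat" where
  "inv_list [] = 0"
| "inv_list (x # xs) = length (filter (\<lambda>y. y < x) xs) + inv_list xs"

lemma inv_list_insert_max:
  assumes "\<forall>x\<in>set us \<union> set vs. x < N"
  shows "inv_list (us @ N # vs) = inv_list (us @ vs) + length vs"
proof -
  have "filter (\<lambda>y. y < N) vs = vs" using assms by (intro filter_True) auto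
  then show ?thesis using assms by (induction us) auto
qed

lemma inv_list_swap:
  "a < b \<Longrightarrow> inv_list (us @ b # a # vs) = Suc (inv_list (us @ a # b # vs))"
  by (induction us) auto

lemma inv_list_snoc:
  "inv_list (us @ [a]) = inv_list us + length (filter (\<lambda>x. a < x) us)"
  by (induction us) auto

lemma length_filter_distinct:
  "distinct xs \<Longrightarrow> length (filter P xs) = card {x \<in> set xs. P x}"
  using distinct_card[of "filter P xs"] by (simp add: conj_commute)

text \<open>Indexing by the number l of letters in front of N makes the terms match those of
  \<open>Psym_sum\<close>, where N is carried over l letters.\<close>

lemma sum_permutations_insert:
  assumes "finite W" "N \<in> W"
  shows "(\<Sum>xs\<in>permutations_of_set W. f xs) =
    (\<Sum>l<card W. \<Sum>xs\<in>permutations_of_set (W - {N}). f (take l xs @ N # drop l xs))"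
proof -
  have len: "length xs = card W - 1" if "xs \<in> permutations_of_set (W - {N})" for xs
    using that assms by (simp add: length_finite_permutations_of_set)
  have pos: "card W > 0" using assms by (auto simp: card_gt_0_iff)
  have "(\<Sum>xs\<in>permutations_of_set W. f xs) =
     (\<Sum>(l, xs)\<in>{..<card W} \<times> permutations_of_set (W - {N}). f (take l xs @ N # drop l xs))"
  proof (rule sum.reindex_bij_witness[symmetric,
        where i = "\<lambda>xs. (length (takeWhile (\<lambda>x. x \<noteq> N) xs), remove1 N xs)"
          and j = "\<lambda>(l, xs). take l xs @ N # drop l xs"], goal_cases)
    case (1 lx)
    then obtain l xs where lx: "lx = (l, xs)" "l < card W" "xs \<in> permutations_of_set (W - {N})" by auto
    then have N: "N \<notin> set xs" and l: "l \<le> length xs" using len[OF lx(3)] by (auto simp: permutations_of_set_def)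
    have Nt: "N \<notin> set (take l xs)" using N by (meson in_set_takeD)
    then have "takeWhile (\<lambda>x. x \<noteq> N) (take l xs @ N # drop l xs) = take l xs @ takeWhile (\<lambda>x. x \<noteq> N) (N # drop l xs)"
      by (intro takeWhile_append2) blast
    moreover have "remove1 N (take l xs @ N # drop l xs) = xs"
      using Nt by (simp add: remove1_append)
    ultimately show ?case using lx(1) l by simp
  next
    case (2 lx)
    then obtain l xs where lx: "lx = (l, xs)" "l < card W" "xs \<in> permutations_of_set (W - {N})" by auto
    have xs: "set xs = W - {N}" "distinct xs"
      using lx(3) by (auto simp: permutations_of_set_def)
    have u: "set (take l xs) \<union> set (drop l xs) = W - {N}"
      using xs(1) by (metis append_take_drop_id set_append)
    then have "N \<notin> set (take l xs)" "N \<notin> set (drop l xs)" by blast+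
    moreover have "distinct (take l xs @ drop l xs)" using xs(2) by simp
    ultimately have "distinct (take l xs @ N # drop l xs)"
      using set_take_disj_set_drop_if_distinct[OF xs(2) order.refl, of l] by simp
    moreover have "set (take l xs @ N # drop l xs) = W" using u assms(2) by auto
    ultimately show ?case unfolding lx(1) prod.case by (intro permutations_of_setI)
  next
    case (3 xs)
    then have xs: "set xs = W" "distinct xs" by (auto simp: permutations_of_set_def)
    then obtain us vs where uv: "xs = us @ N # vs" "N \<notin> set us"
      using assms split_list_first[of N xs] by auto
    have "takeWhile (\<lambda>x. x \<noteq> N) xs = us @ takeWhile (\<lambda>x. x \<noteq> N) (N # vs)"
      unfolding uv(1) using uv(2) by (intro takeWhile_append2) blast
    then have "takeWhile (\<lambda>x. x \<noteq> N) xs = us" by simp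
    moreover have "remove1 N xs = us @ vs" using uv by (simp add: remove1_append)
    ultimately show ?case using uv by simp
  next
    case (4 xs)
    then have xs: "set xs = W" "distinct xs" by (auto simp: permutations_of_set_def)
    then obtain us vs where uv: "xs = us @ N # vs" "N \<notin> set us"
      using assms split_list_first[of N xs] by auto
    have "takeWhile (\<lambda>x. x \<noteq> N) xs = us @ takeWhile (\<lambda>x. x \<noteq> N) (N # vs)"
      unfolding uv(1) using uv(2) by (intro takeWhile_append2) blast
    then have "takeWhile (\<lambda>x. x \<noteq> N) xs = us" by simp
    moreover have "remove1 N xs = us @ vs" using uv by (simp add: remove1_append)
    moreover have "card W = length xs" using xs distinct_card by force
    ultimately show ?case using uv xs by (auto simp: permutations_of_set_def)
  next
    case (5 lx)
    then show ?case by auto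
  qed
  then show ?thesis by (simp add: sum.cartesian_product)
qed

lemma sum_permutations_snoc:
  assumes "finite A"
  shows "A \<noteq> {} \<Longrightarrow> (\<Sum>xs\<in>permutations_of_set A. f xs) =
    (\<Sum>a\<in>A. \<Sum>us\<in>permutations_of_set (A - {a}). f (us @ [a]))"
proof -
  assume ne: "A \<noteq> {}"
  have "(\<Sum>xs\<in>permutations_of_set A. f xs) =
      (\<Sum>(a, us)\<in>Sigma A (\<lambda>a. permutations_of_set (A - {a})). f (us @ [a]))"
  proof (rule sum.reindex_bij_witness[where i = "\<lambda>(a, us). us @ [a]" and j = "\<lambda>xs. (last xs, butlast xs)"], goal_cases)
    case (1 xs)
    then have "xs \<noteq> []" using ne by (auto simp: permutations_of_set_def)
    then show ?case by simp
  next
    case (2 xs)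
    then have xs: "set xs = A" "distinct xs" by (auto simp: permutations_of_set_def)
    then obtain us a where "xs = us @ [a]" using ne by (cases xs rule: rev_exhaust) auto
    then show ?case using xs by (auto simp: permutations_of_set_def)
  next
    case (3 ax)
    then show ?case by auto
  next
    case (4 ax)
    then obtain a us where "ax = (a, us)" "a \<in> A" "set us = A - {a}" "distinct us"
      by (auto simp: permutations_of_set_def)
    then show ?case by (auto simp: permutations_of_set_def)
  next
    case (5 xs)
    then have "xs \<noteq> []" using ne by (auto simp: permutations_of_set_def)
    then show ?case by simp
  qed
  also have "\<dots> = (\<Sum>a\<in>A. \<Sum>us\<in>permutations_of_set (A - {a}). f (us @ [a]))"
    using assms by (intro sum.Sigma[symmetric]) auto
  finally show ?thesis .
qed

text \<open>The decreasing word n, n - 1, ..., n - m + 1. Freezing it as a prefix leaves the letters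
  1, ..., n - m in the positions after m, so the induction on n takes place inside one fixed
  representation, with m growing.\<close>

definition head_word :: "nat \<Rightarrow> nat \<Rightarrow> nat list" where
  "head_word n m = rev [Suc (n - m)..<Suc n]"

lemma head_word_0 [simp]: "head_word n 0 = []"
  by (simp add: head_word_def)

lemma length_head_word [simp]: "m \<le> n \<Longrightarrow> length (head_word n m) = m"
  by (simp add: head_word_def del: upt_Suc)

lemma set_head_word: "set (head_word n m) = {n - m<..n}"
  by (auto simp: head_word_def)

lemma distinct_head_word [simp]: "distinct (head_word n m)"
  by (simp add: head_word_def)

lemma head_word_Suc: "m < n \<Longrightarrow> head_word n (Suc m) = head_word n m @ [n - m]"
  by (simp add: head_word_def Suc_diff_Suc upt_conv_Cons del: upt_Suc)

text \<open>Basis vectors are indexed by words in one-line notation w(1) ... w(n), so that T_i acts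
  on the neighbouring letters in positions i and i + 1.\<close>

locale hecke_words = affine_hecke scale n T X p q h
  for scale :: "'f::field \<Rightarrow> 'v::ab_group_add \<Rightarrow> 'v"  (infixr \<open>*s\<close> 75)
    and n T X p q h +
  fixes Y :: "nat list \<Rightarrow> 'v" and t :: "nat \<Rightarrow> 'f"
  assumes T_descent: "us @ a # b # vs \<in> permutations_of_set {1..n} \<Longrightarrow> b < a \<Longrightarrow>
      T (Suc (length us)) (Y (us @ a # b # vs)) = Y (us @ b # a # vs)"
    and X_longest: "1 \<le> i \<Longrightarrow> i \<le> n \<Longrightarrow> X i (Y (head_word n n)) = t (n + 1 - i) *s Y (head_word n n)"
begin

lemma T_ascent:
  assumes "us @ a # b # vs \<in> permutations_of_set {1..n}" "a < b"
  shows "T (Suc (length us)) (Y (us @ a # b # vs)) =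
    (p * q) *s Y (us @ b # a # vs) - (p - q) *s Y (us @ a # b # vs)"
proof -
  have perm: "us @ b # a # vs \<in> permutations_of_set {1..n}"
    using assms by (auto simp: permutations_of_set_def)
  have "length (us @ a # b # vs) = n"
    using assms length_finite_permutations_of_set by force
  then have "T (Suc (length us)) (T (Suc (length us)) (Y (us @ b # a # vs))) =
     (p * q) *s Y (us @ b # a # vs) - (p - q) *s T (Suc (length us)) (Y (us @ b # a # vs))"
    by (intro T_T) auto
  then show ?thesis using T_descent[OF perm assms(2)] by simp
qed

text \<open>Every step of the move happens at a descent, where T_i merely exchanges two
  letters.\<close>

lemma Y_insert_max:
  assumes "pre @ N # us @ vs \<in> permutations_of_set {1..n}" "\<forall>x\<in>set us. x < N"
  shows "Y (pre @ us @ N # vs) = Tdown (Suc (length pre)) (Suc (length pre) + length us) (Y (pre @ N # us @ vs))"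
  using assms
proof (induction us arbitrary: vs rule: rev_induct)
  case (snoc u us)
  have "Y (pre @ us @ N # u # vs) = Tdown (Suc (length pre)) (Suc (length pre) + length us) (Y (pre @ N # us @ u # vs))"
    using snoc.prems by (intro snoc.IH) auto
  moreover have "T (Suc (length (pre @ us))) (Y ((pre @ us) @ N # u # vs)) = Y ((pre @ us) @ u # N # vs)"
    using snoc.prems by (intro T_descent) (auto simp: permutations_of_set_def)
  ultimately show ?case by (simp add: Tdown_Suc)
qed simp

definition Ysum :: "nat list \<Rightarrow> nat set \<Rightarrow> nat list \<Rightarrow> 'v" where
  "Ysum pre W post = (\<Sum>xs\<in>permutations_of_set W. p ^ inv_list xs *s Y (pre @ xs @ post))"

definition splits :: "nat list \<Rightarrow> nat set \<Rightarrow> nat list \<Rightarrow> bool" where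
  "splits pre W post \<longleftrightarrow> (\<forall>xs\<in>permutations_of_set W. pre @ xs @ post \<in> permutations_of_set {1..n}) \<and> finite W"

lemma splits_iff:
  "splits pre W post \<longleftrightarrow> finite W \<and> distinct pre \<and> distinct post \<and> set pre \<inter> W = {}
    \<and> set pre \<inter> set post = {} \<and> W \<inter> set post = {} \<and> set pre \<union> W \<union> set post = {1..n}"
proof -
  have "pre @ xs @ post \<in> permutations_of_set {1..n} \<longleftrightarrow> distinct pre \<and> distinct post \<and> set pre \<inter> W = {}
    \<and> set pre \<inter> set post = {} \<and> W \<inter> set post = {} \<and> set pre \<union> W \<union> set post = {1..n}"
    if "xs \<in> permutations_of_set W" for xs
  proof -
    have "set xs = W" "distinct xs" using that by (auto simp: permutations_of_set_def)
    then show ?thesis by (auto simp: permutations_of_set_def Int_Un_distrib Un_assoc)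
  qed
  moreover have "finite W \<Longrightarrow> \<exists>xs. xs \<in> permutations_of_set W"
    by (metis finite_distinct_list permutations_of_setI)
  ultimately show ?thesis unfolding splits_def by meson
qed

text \<open>The largest letter can be carried from the first place of the block to any other by
  generators alone, and its inversions are the letters left behind it. These are the weights of
  \<open>Psym\<close>.\<close>

lemma Ysum_max:
  assumes s: "splits pre W post" and N: "N \<in> W" "\<forall>x\<in>W. x \<le> N"
  shows "Ysum pre W post = Psym (Suc (length pre)) (card W) (Ysum (pre @ [N]) (W - {N}) post)"
proof -
  let ?a = "Suc (length pre)"
  have fin: "finite W" using s by (simp add: splits_def)
  have summand: "p ^ inv_list (take l xs @ N # drop l xs) *s Y (pre @ (take l xs @ N # drop l xs) @ post)
      = p ^ (card W - Suc l) *s Tdown ?a (?a + l) (p ^ inv_list xs *s Y ((pre @ [N]) @ xs @ post))"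
    if l: "l < card W" and xs: "xs \<in> permutations_of_set (W - {N})" for l xs
  proof -
    have sx: "set xs = W - {N}" "distinct xs" using xs by (auto simp: permutations_of_set_def)
    have len: "length xs = card W - 1" using xs fin N by (simp add: length_finite_permutations_of_set)
    have lt: "\<forall>x\<in>set xs. x < N" using sx N by (metis Diff_iff insertI1 order_le_imp_less_or_eq)
    have lt': "\<forall>x\<in>set (take l xs) \<union> set (drop l xs). x < N"
      using lt by (auto dest: in_set_takeD in_set_dropD)
    have "pre @ N # take l xs @ (drop l xs @ post) \<in> permutations_of_set {1..n}"
    proof -
      have "N # xs \<in> permutations_of_set W" using sx N by (auto simp: permutations_of_set_def)
      then have "pre @ (N # xs) @ post \<in> permutations_of_set {1..n}" using s unfolding splits_def by blast
      then show ?thesis by (simp flip: append_assoc)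
    qed
    then have "Y (pre @ take l xs @ N # (drop l xs @ post)) =
      Tdown ?a (?a + length (take l xs)) (Y (pre @ N # take l xs @ (drop l xs @ post)))"
      using lt' by (intro Y_insert_max) auto
    moreover have "length (take l xs) = l" using len l by simp
    moreover have "take l xs @ drop l xs @ post = xs @ post" by simp
    ultimately have "Y (pre @ take l xs @ N # (drop l xs @ post)) = Tdown ?a (?a + l) (Y (pre @ N # xs @ post))"
      by (simp only:)
    moreover have "inv_list (take l xs @ N # drop l xs) = inv_list xs + (card W - Suc l)"
      using inv_list_insert_max[OF lt'] len by simp
    ultimately show ?thesis by (simp add: power_add mult.commute)
  qed
  have "Ysum pre W post = (\<Sum>l<card W. \<Sum>xs\<in>permutations_of_set (W - {N}).
     p ^ (card W - Suc l) *s Tdown ?a (?a + l) (p ^ inv_list xs *s Y ((pre @ [N]) @ xs @ post)))"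
    unfolding Ysum_def sum_permutations_insert[OF fin N(1)] using summand by (intro sum.cong) auto
  then show ?thesis by (simp add: Psym_sum Ysum_def scale_sum_right)
qed

text \<open>Arrangements are paired by exchanging the two letters concerned. If Y has the ascent and
  Y' the descent, they enter as Y + p Y', and T_i (Y + p Y') = p q Y' - (p - q) Y + p Y = q (Y + p
  Y').\<close>

lemma T_Ysum:
  assumes s: "splits pre W post" and i: "length pre < i" "i < length pre + card W"
  shows "T i (Ysum pre W post) = q *s Ysum pre W post"
proof -
  define l where "l = i - Suc (length pre)"
  have il: "i = Suc (length pre + l)" and l: "Suc l < card W" using i by (auto simp: l_def)
  define A where "A = {xs \<in> permutations_of_set W. xs ! l < xs ! Suc l}"
  define D where "D = {xs \<in> permutations_of_set W. xs ! Suc l < xs ! l}"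
  define sw where "sw xs = take l xs @ xs ! Suc l # xs ! l # drop (Suc (Suc l)) xs" for xs :: "nat list"
  have fin: "finite W" using s by (simp add: splits_def)
  have len: "length xs = card W" if "xs \<in> permutations_of_set W" for xs
    using that fin by (simp add: length_finite_permutations_of_set)
  have dec: "xs = take l xs @ xs ! l # xs ! Suc l # drop (Suc (Suc l)) xs"
    if "xs \<in> permutations_of_set W" for xs
    using len[OF that] l by (simp add: Cons_nth_drop_Suc)
  have neq: "xs ! l \<noteq> xs ! Suc l" if "xs \<in> permutations_of_set W" for xs
    using len[OF that] l that by (auto simp: permutations_of_set_def nth_eq_iff_index_eq)
  have swp: "sw xs \<in> permutations_of_set W" if "xs \<in> permutations_of_set W" for xs
  proof -
    \<comment> \<open>Exchanging two entries preserves the multiset of letters, hence both the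
      underlying set and distinctness.\<close>
    have "mset xs = mset (take l xs @ xs ! l # xs ! Suc l # drop (Suc (Suc l)) xs)"
      using dec[OF that] by (rule arg_cong)
    then have "mset (sw xs) = mset xs" by (simp add: sw_def)
    then show ?thesis using that by (metis mset_eq_setD mset_eq_imp_distinct_iff permutations_of_setD permutations_of_setI)
  qed
  have sws: "sw xs ! l = xs ! Suc l" "sw xs ! Suc l = xs ! l" "sw (sw xs) = xs"
    if "xs \<in> permutations_of_set W" for xs
  proof -
    have [simp]: "length (take l xs) = l" "min (length xs) l = l" using len[OF that] l by auto
    show "sw xs ! l = xs ! Suc l" "sw xs ! Suc l = xs ! l"
      by (simp_all add: sw_def nth_append)
    then have "sw (sw xs) = take l xs @ xs ! l # xs ! Suc l # drop (Suc (Suc l)) xs"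
      by (subst sw_def) (simp add: sw_def[of xs])
    then show "sw (sw xs) = xs" using dec[OF that] by simp
  qed
  have U: "permutations_of_set W = A \<union> D" "A \<inter> D = {}" "finite A" "finite D"
    using neq by (auto simp: A_def D_def neq_iff)
  have "bij_betw sw A D"
    by (rule bij_betw_byWitness[of _ sw]) (auto simp: A_def D_def sws swp)
  then have sumD: "(\<Sum>xs\<in>D. f xs) = (\<Sum>xs\<in>A. f (sw xs))" for f :: "nat list \<Rightarrow> 'v"
    using sum.reindex_bij_betw[of sw A D f] by simp
  define g where "g xs = p ^ inv_list xs *s Y (pre @ xs @ post)" for xs
  have Ys: "Ysum pre W post = (\<Sum>xs\<in>A. g xs + g (sw xs))"
    unfolding Ysum_def U(1) g_def[symmetric] using U by (simp add: sum.union_disjoint sumD sum.distrib)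
  have "T i (g xs + g (sw xs)) = q *s (g xs + g (sw xs))" if "xs \<in> A" for xs
  proof -
    have xs: "xs \<in> permutations_of_set W" "xs ! l < xs ! Suc l" using that by (auto simp: A_def)
    let ?u = "take l xs" and ?v = "drop (Suc (Suc l)) xs" and ?x = "xs ! l" and ?y = "xs ! Suc l"
    have lu: "length ?u = l" using len[OF xs(1)] l by simp
    have "pre @ xs @ post \<in> permutations_of_set {1..n}" "pre @ sw xs @ post \<in> permutations_of_set {1..n}"
      using s xs(1) swp by (auto simp: splits_def)
    then have pp: "(pre @ ?u) @ ?x # ?y # (?v @ post) \<in> permutations_of_set {1..n}"
      "(pre @ ?u) @ ?y # ?x # (?v @ post) \<in> permutations_of_set {1..n}"
      by (subst (asm) dec[OF xs(1)], simp_all add: sw_def)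
    have i': "i = Suc (length (pre @ ?u))" using lu il by simp
    have Yx: "Y (pre @ xs @ post) = Y ((pre @ ?u) @ ?x # ?y # (?v @ post))"
      by (subst dec[OF xs(1)]) simp
    have Ysw: "Y (pre @ sw xs @ post) = Y ((pre @ ?u) @ ?y # ?x # (?v @ post))"
      by (simp add: sw_def)
    have TA: "T i (Y (pre @ sw xs @ post)) = Y (pre @ xs @ post)"
      unfolding Yx Ysw i' using pp xs by (intro T_descent)
    have TB: "T i (Y (pre @ xs @ post)) = (p * q) *s Y (pre @ sw xs @ post) - (p - q) *s Y (pre @ xs @ post)"
      unfolding Yx Ysw i' using pp xs by (intro T_ascent)
    have iv: "inv_list (sw xs) = Suc (inv_list xs)"
      unfolding sw_def using inv_list_swap[OF xs(2), of ?u ?v] dec[OF xs(1)] by simp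
    show ?thesis by (simp add: g_def TA TB iv algebra_simps)
  qed
  then show ?thesis unfolding Ys by (simp add: scale_sum_right)
qed

text \<open>Extends \<open>Ysum_max\<close> to a leading letter that need not be the largest. If N
  is the largest, the arrangement with a before N is T applied to the one with N before a. The
  double symmetriser absorbs this T at the price of q, after which N leads and the block without N
  is left to induction. Each letter above a thus contributes one q.\<close>

lemma Psym_Ysum:
  "splits pre W post \<Longrightarrow> a \<in> W \<Longrightarrow>
    Psym (Suc (length pre)) (card W) (Ysum (pre @ [a]) (W - {a}) post)
      = q ^ card {x\<in>W. a < x} *s Ysum pre W post"
proof (induction "card W" arbitrary: pre W)
  case 0
  then show ?case by (auto simp: splits_def)
next
  case (Suc k)
  have fin: "finite W" using Suc.prems by (simp add: splits_def)
  define N where "N = Max W"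
  have "W \<noteq> {}" using Suc.prems(2) by blast
  then have N: "N \<in> W" "\<forall>x\<in>W. x \<le> N" using fin Max_in[of W] by (simp_all add: N_def)
  show ?case
  proof (cases "a = N")
    case True
    then have "{x\<in>W. a < x} = {}" using N by auto
    then have "card {x\<in>W. a < x} = 0" by (simp only: card.empty)
    then show ?thesis using Ysum_max[OF Suc.prems(1) N] True by (simp only: power_0 scale_one)
  next
    case False
    let ?a = "Suc (length pre)"
    have aN: "a < N" using False N Suc.prems(2) by (metis order_le_imp_less_or_eq)
    have k: "card (W - {N}) = k" "card (W - {a}) = k" using Suc.hyps(2) N fin Suc.prems(2) by auto
    have len: "?a < n"
    proof -
      have "card (set pre \<union> W) \<le> card {1..n}"
        using Suc.prems(1) by (intro card_mono) (auto simp: splits_iff)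
      moreover have "card (set pre \<union> W) = length pre + card W"
        using Suc.prems(1) by (subst card_Un_disjoint) (auto simp: splits_iff distinct_card)
      moreover have "card {a, N} \<le> card W" using N Suc.prems fin by (intro card_mono) auto
      ultimately show ?thesis using aN by simp
    qed
    define u where "u = Ysum (pre @ [N] @ [a]) (W - {N} - {a}) post"
    have s1: "splits (pre @ [a]) (W - {a}) post" and s2: "splits (pre @ [N]) (W - {N}) post"
      using Suc.prems N by (auto simp: splits_iff)
    have "Ysum (pre @ [a]) (W - {a}) post = Psym (Suc ?a) k (Ysum ((pre @ [a]) @ [N]) (W - {a} - {N}) post)"
      using Ysum_max[OF s1, of N] N aN k by simp
    \<comment> \<open>In \<open>u\<close> the letter N stands directly before a, a descent, so the
      generator exchanges the two.\<close>
    also have "Ysum ((pre @ [a]) @ [N]) (W - {a} - {N}) post = T ?a u"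
    proof -
      have eq: "W - {a} - {N} = W - {N} - {a}" by auto
      have "T ?a (Y (pre @ N # a # (xs @ post))) = Y (pre @ a # N # (xs @ post))"
        if "xs \<in> permutations_of_set (W - {N} - {a})" for xs
      proof -
        have "N # a # xs \<in> permutations_of_set W"
          using that Suc.prems(2) N aN by (auto simp: permutations_of_set_def)
        then have "pre @ (N # a # xs) @ post \<in> permutations_of_set {1..n}"
          using Suc.prems(1) unfolding splits_def by blast
        then show ?thesis using aN by (intro T_descent) simp_all
      qed
      then show ?thesis unfolding Ysum_def u_def eq by simp
    qed
    finally have "Psym ?a (card W) (Ysum (pre @ [a]) (W - {a}) post)
        = q *s Psym ?a (Suc k) (Psym (Suc ?a) k u)"
      using Psym_Psym_T[of ?a k u] len Suc.hyps(2) by simp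
    also have "Psym (Suc ?a) k u = q ^ card {x\<in>W - {N}. a < x} *s Ysum (pre @ [N]) (W - {N}) post"
      using Suc.hyps(1)[of "W - {N}" "pre @ [N]"] s2 k aN Suc.prems(2) by (simp add: u_def)
    finally have "Psym ?a (card W) (Ysum (pre @ [a]) (W - {a}) post)
       = q ^ Suc (card {x\<in>W - {N}. a < x}) *s Psym ?a (Suc k) (Ysum (pre @ [N]) (W - {N}) post)"
      by (simp del: Psym.simps)
    also have "Psym ?a (Suc k) (Ysum (pre @ [N]) (W - {N}) post) = Ysum pre W post"
      using Ysum_max[OF Suc.prems(1) N] Suc.hyps(2) by simp
    also have "Suc (card {x\<in>W - {N}. a < x}) = card {x\<in>W. a < x}"
    proof -
      have "{x\<in>W. a < x} = insert N {x\<in>W - {N}. a < x}" using N aN by auto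
      then show ?thesis using fin by simp
    qed
    finally show ?thesis .
  qed
qed

text \<open>Downward induction on m from the longest permutation: the letter n - m is carried from
  the end of the longer prefix to its place by generators of index above m, and these commute with
  x_i for i up to m.\<close>

lemma X_head_word:
  "m \<le> n \<Longrightarrow> xs \<in> permutations_of_set {1..n - m} \<Longrightarrow> 1 \<le> i \<Longrightarrow> i \<le> m \<Longrightarrow>
    X i (Y (head_word n m @ xs)) = t (n + 1 - i) *s Y (head_word n m @ xs)"
proof (induction "n - m" arbitrary: m xs)
  case 0
  then have "m = n" "xs = []" by (auto simp: permutations_of_set_def)
  then show ?case using X_longest[of i] 0 by simp
next
  case (Suc N)
  then have Nm: "n - m = Suc N" "m < n" "n - Suc m = N" by auto
  have xs: "set xs = {1..Suc N}" "distinct xs"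
    using Suc.prems(2) unfolding Nm by (auto dest: permutations_of_setD)
  then have "Suc N \<in> set xs" by simp
  then obtain us vs where uv: "xs = us @ Suc N # vs" by (metis split_list)
  have d: "distinct (us @ vs)" "Suc N \<notin> set (us @ vs)" using xs(2) uv by auto
  have "set (us @ vs) = set xs - {Suc N}" using d(2) uv by auto
  also have "\<dots> = {1..n - Suc m}" unfolding xs(1) Nm by auto
  finally have uvs: "set (us @ vs) = {1..n - Suc m}" .
  then have uvp: "us @ vs \<in> permutations_of_set {1..n - Suc m}"
    using d(1) by (rule permutations_of_setI)
  have IH: "X i (Y (head_word n (Suc m) @ us @ vs)) = t (n + 1 - i) *s Y (head_word n (Suc m) @ us @ vs)"
    by (rule Suc.hyps(1)) (use Suc.prems Nm uvp in simp_all)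
  let ?D = "Tdown (Suc m) (Suc m + length us)"
  have "head_word n m @ (n - m) # us @ vs \<in> permutations_of_set {1..n}"
  proof (rule permutations_of_setI)
    have sx: "set ((n - m) # us @ vs) = set xs" using uv Nm by auto
    then have "set (head_word n m @ (n - m) # us @ vs) = {n - m<..n} \<union> {1..n - m}"
      unfolding set_append[of "head_word n m"] set_head_word xs(1) Nm by simp
    also have "\<dots> = {1..n}" using Nm by auto
    finally show "set (head_word n m @ (n - m) # us @ vs) = {1..n}" .
    have "distinct ((n - m) # us @ vs)" using d Nm by simp
    moreover have "set (head_word n m) \<inter> set ((n - m) # us @ vs) = {}"
      unfolding sx set_head_word xs(1) unfolding Nm by auto
    ultimately show "distinct (head_word n m @ (n - m) # us @ vs)"
      by (simp only: distinct_append distinct_head_word simp_thms)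
  qed
  moreover have "\<forall>x\<in>set us. x < n - m"
  proof
    fix x assume "x \<in> set us"
    then have "x \<in> {1..n - Suc m}" using uvs by (metis UnI1 set_append)
    then show "x < n - m" using Nm by simp
  qed
  ultimately have "Y (head_word n m @ us @ (n - m) # vs) = ?D (Y (head_word n m @ (n - m) # us @ vs))"
    using Y_insert_max[of "head_word n m" "n - m" us vs] Suc.prems(1) by simp
  then have Y: "Y (head_word n m @ xs) = ?D (Y (head_word n (Suc m) @ us @ vs))"
    using Nm by (simp add: uv head_word_Suc)
  have "X i (?D v) = ?D (X i v)" for v
    using Suc.prems by (intro Tdown_comm) (auto simp: T_X_far)
  then show ?case by (simp add: Y IH)
qed

end

subsection \<open>The product of the factors \<open>1 + z x\<^sub>i\<close> on symmetrised vectors\<close>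

text \<open>Sets \<open>A \<subseteq> {1..n}\<close> of size \<open>k\<close> encode partitions in the \<open>k \<times> (n - k)\<close> box; moving the element \<open>a\<close>
  of \<open>A\<close> up to \<open>b \<notin> A\<close> adds a ribbon, with one row for each element passed and one column for each gap.\<close>

primrec gcoef :: "'f::field \<Rightarrow> 'f \<Rightarrow> 'f \<Rightarrow> 'f \<Rightarrow> (nat \<Rightarrow> 'f) \<Rightarrow> nat \<Rightarrow> nat set \<Rightarrow> nat set \<Rightarrow> 'f" where
  "gcoef z p q h t 0 A B = 1"
| "gcoef z p q h t (Suc k) A B =
    (if Max B \<in> A then
       (if \<forall>a\<in>A. a \<le> Max B then (1 + z * t (Max B)) * gcoef z p q h t k (A - {Max B}) (B - {Max B}) else 0)
     else if \<forall>a\<in>A. a < Max B then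
       z * (h - (p - q) * t (Max B)) * (\<Sum>a\<in>A. p ^ card {x\<in>A. a < x} * q ^ card ({a<..<Max B} - A)
          * gcoef z p q h t k (A - {a}) (B - {Max B}))
     else 0)"

section \<open>Subsets of fixed size\<close>

definition ksubsets :: "nat \<Rightarrow> nat \<Rightarrow> nat set set" where
  "ksubsets N k = {B. B \<subseteq> {1..N} \<and> card B = k}"

lemma finite_ksubsets [simp]: "finite (ksubsets N k)"
  unfolding ksubsets_def by (rule finite_subset[of _ "Pow {1..N}"]) auto

lemma ksubsets_finite: "B \<in> ksubsets N k \<Longrightarrow> finite B"
  unfolding ksubsets_def using finite_subset[of B "{1..N}"] by simp

lemma ksubsets_0: "ksubsets N 0 = {{}}"
proof -
  have "B = {}" if "B \<subseteq> {1..N}" "card B = 0" for B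
    using that finite_subset[of B "{1..N}"] by auto
  then show ?thesis by (auto simp: ksubsets_def)
qed

lemma ksubsets_Suc:
  "ksubsets (Suc N) (Suc k) = ksubsets N (Suc k) \<union> insert (Suc N) ` ksubsets N k"
proof (intro set_eqI iffI)
  fix B assume B: "B \<in> ksubsets (Suc N) (Suc k)"
  then have sub: "B \<subseteq> {1..Suc N}" and card: "card B = Suc k" by (simp_all add: ksubsets_def)
  have sub': "B - {Suc N} \<subseteq> {1..N}" using sub by fastforce
  show "B \<in> ksubsets N (Suc k) \<union> insert (Suc N) ` ksubsets N k"
  proof (cases "Suc N \<in> B")
    case True
    have "B - {Suc N} \<in> ksubsets N k" using sub' card True by (simp add: ksubsets_def)
    moreover have "B = insert (Suc N) (B - {Suc N})" using True by blast
    ultimately show ?thesis by blast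
  next
    case False
    then have "B \<in> ksubsets N (Suc k)" using sub' card by (simp add: ksubsets_def)
    then show ?thesis by blast
  qed
next
  fix B assume "B \<in> ksubsets N (Suc k) \<union> insert (Suc N) ` ksubsets N k"
  then consider "B \<in> ksubsets N (Suc k)" | C where "B = insert (Suc N) C" "C \<in> ksubsets N k" by blast
  then show "B \<in> ksubsets (Suc N) (Suc k)"
  proof cases
    case 1
    then show ?thesis by (simp add: ksubsets_def subset_iff le_SucI)
  next
    case 2
    then have "finite C" "Suc N \<notin> C" "C \<subseteq> {1..Suc N}" "card C = k"
      using ksubsets_finite[OF 2(2)] by (auto simp: ksubsets_def)
    then show ?thesis unfolding 2(1) by (simp add: ksubsets_def)
  qed
qed

lemma sum_ksubsets_Suc:
  "(\<Sum>B\<in>ksubsets (Suc N) (Suc k). f B) = (\<Sum>B\<in>ksubsets N (Suc k). f B) + (\<Sum>B\<in>ksubsets N k. f (insert (Suc N) B))"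
proof -
  have nin: "Suc N \<notin> B" if "B \<in> ksubsets N j" for B j using that by (auto simp: ksubsets_def)
  have "inj_on (insert (Suc N)) (ksubsets N k)"
    using nin by (intro inj_onI) (metis insert_ident)
  moreover have "ksubsets N (Suc k) \<inter> insert (Suc N) ` ksubsets N k = {}" using nin by auto
  ultimately show ?thesis unfolding ksubsets_Suc by (subst sum.union_disjoint) (auto simp: sum.reindex)
qed

context hecke_words
begin

definition Yset :: "nat \<Rightarrow> nat set \<Rightarrow> 'v" where
  "Yset m A = (\<Sum>xs\<in>permutations_of_set A. p ^ inv_list xs *s Ysum (head_word n m @ xs) ({1..n - m} - A) [])"

lemma Yset_alt:
  "Yset m A = (\<Sum>ys\<in>permutations_of_set ({1..n - m} - A). p ^ inv_list ys *s Ysum (head_word n m) A ys)"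
  unfolding Yset_def Ysum_def scale_sum_right scale_scale
  by (subst sum.swap) (simp add: mult.commute)

lemma head_word_Un: "m \<le> n \<Longrightarrow> set (head_word n m) \<union> {1..n - m} = {1..n}"
  by (auto simp: set_head_word)

lemma head_word_Int: "set (head_word n m) \<inter> {1..n - m} = {}"
  by (auto simp: set_head_word)

lemma splits_left:
  assumes "m \<le> n" "A \<subseteq> {1..n - m}" "ys \<in> permutations_of_set ({1..n - m} - A)"
  shows "splits (head_word n m) A ys"
proof -
  have "set ys = {1..n - m} - A" "distinct ys" using assms by (auto dest: permutations_of_setD)
  moreover have "A \<union> ({1..n - m} - A) = {1..n - m}" using assms(2) by auto
  ultimately show ?thesis
    using assms(2) head_word_Un[OF assms(1)] head_word_Int[of m] finite_subset[OF assms(2)]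
    by (simp add: splits_iff Un_assoc) blast
qed

lemma splits_right:
  assumes "m \<le> n" "A \<subseteq> {1..n - m}" "xs \<in> permutations_of_set A"
  shows "splits (head_word n m @ xs) ({1..n - m} - A) []"
proof -
  have "set xs = A" "distinct xs" using assms by (auto dest: permutations_of_setD)
  moreover have "A \<union> ({1..n - m} - A) = {1..n - m}" using assms(2) by auto
  ultimately show ?thesis
    using assms(2) head_word_Un[OF assms(1)] head_word_Int[of m]
    by (simp add: splits_iff Un_assoc) blast
qed

lemma T_Yset:
  assumes "m \<le> n" "A \<subseteq> {1..n - m}" "m < i" "i < m + card A"
  shows "T i (Yset m A) = q *s Yset m A"
proof -
  have "T i (Ysum (head_word n m) A ys) = q *s Ysum (head_word n m) A ys"
    if "ys \<in> permutations_of_set ({1..n - m} - A)" for ys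
    using assms by (intro T_Ysum splits_left that) auto
  then show ?thesis by (simp add: Yset_alt scale_sum_right mult.commute)
qed

lemma X_Yset:
  assumes "m \<le> n" "A \<subseteq> {1..n - m}" "1 \<le> i" "i \<le> m"
  shows "X i (Yset m A) = t (n + 1 - i) *s Yset m A"
proof -
  have "X i (Y ((head_word n m @ xs) @ ys @ [])) = t (n + 1 - i) *s Y ((head_word n m @ xs) @ ys @ [])"
    if xs: "xs \<in> permutations_of_set A" and ys: "ys \<in> permutations_of_set ({1..n - m} - A)" for xs ys
  proof -
    have "set xs = A" "distinct xs" "set ys = {1..n - m} - A" "distinct ys"
      using xs ys by (auto dest: permutations_of_setD)
    then have "xs @ ys \<in> permutations_of_set {1..n - m}"
      using assms(2) by (intro permutations_of_setI) auto
    then show ?thesis using X_head_word[OF assms(1) _ assms(3,4)] by simp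
  qed
  then show ?thesis by (simp add: Yset_def Ysum_def scale_sum_right mult.commute)
qed

lemma Yset_max_in:
  assumes m: "m < n" and A: "A \<subseteq> {1..n - m}" "n - m \<in> A"
  shows "Yset m A = Psym (Suc m) (card A) (Yset (Suc m) (A - {n - m}))"
proof -
  have eq: "{1..n - Suc m} - (A - {n - m}) = {1..n - m} - A"
  proof -
    have "{1..n - m} = insert (n - m) {1..n - Suc m}" using m by auto
    then show ?thesis using A m by auto
  qed
  have le: "\<forall>x\<in>A. x \<le> n - m" using A(1) by auto
  have "Ysum (head_word n m) A ys = Psym (Suc m) (card A) (Ysum (head_word n (Suc m)) (A - {n - m}) ys)"
    if "ys \<in> permutations_of_set ({1..n - m} - A)" for ys
    using Ysum_max[OF splits_left[OF _ A(1) that] A(2) le] m by (simp add: head_word_Suc)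
  then show ?thesis unfolding Yset_alt eq by simp
qed

text \<open>In \<open>Yset (Suc m) A\<close> the largest letter n - m stands in front of the
  arrangement of A. It is first carried behind that arrangement and then spread over the second
  block, whose largest letter it is.\<close>

lemma Yset_max_notin:
  assumes m: "m < n" and A: "A \<subseteq> {1..n - m}" "n - m \<notin> A"
  shows "Yset m A = Psym (Suc (m + card A)) (n - m - card A)
    (Tdown (Suc m) (Suc (m + card A)) (Yset (Suc m) A))"
proof -
  let ?N = "n - m" and ?R = "{1..n - m} - A"
  have fin: "finite A" using A finite_subset by blast
  have NR: "?N \<in> ?R" using m A by auto
  have R: "?R - {?N} = {1..n - Suc m} - A"
  proof -
    have "{1..n - m} = insert (n - m) {1..n - Suc m}" using m by auto
    then show ?thesis using m by auto
  qed
  have cR: "card ?R = n - m - card A" using A by (simp add: card_Diff_subset fin)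
  have "Ysum (head_word n m @ xs) ?R [] =
      Psym (Suc (m + card A)) (n - m - card A) (Tdown (Suc m) (Suc (m + card A))
        (Ysum (head_word n (Suc m) @ xs) ({1..n - Suc m} - A) []))"
    if xs: "xs \<in> permutations_of_set A" for xs
  proof -
    have len: "length xs = card A" using xs fin by (simp add: length_finite_permutations_of_set)
    have sx: "set xs = A" "distinct xs" using xs by (auto dest: permutations_of_setD)
    have "Ysum (head_word n m @ xs) ?R [] = Psym (Suc (m + card A)) (n - m - card A)
      (Ysum ((head_word n m @ xs) @ [?N]) (?R - {?N}) [])"
      using Ysum_max[OF splits_right[OF _ A(1) xs] NR] m len cR by simp
    moreover have "Y (((head_word n m @ xs) @ [?N]) @ ys @ []) =
        Tdown (Suc m) (Suc (m + card A)) (Y ((head_word n (Suc m) @ xs) @ ys @ []))"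
      if ys: "ys \<in> permutations_of_set (?R - {?N})" for ys
    proof -
      have sy: "set ys = ?R - {?N}" "distinct ys" using ys by (auto dest: permutations_of_setD)
      have "head_word n m @ ?N # xs @ ys \<in> permutations_of_set {1..n}"
      proof (rule permutations_of_setI)
        have s: "set (?N # xs @ ys) = {1..?N}" using sx(1) sy(1) A(1) NR by auto
        show "set (head_word n m @ ?N # xs @ ys) = {1..n}"
          using head_word_Un[of m] m s by (simp only: set_append[of "head_word n m"] less_imp_le)
        have "distinct (?N # xs @ ys)" using sx sy A(2) by auto
        then show "distinct (head_word n m @ ?N # xs @ ys)"
          using head_word_Int[of m] s by (simp only: distinct_append[of "head_word n m"] distinct_head_word simp_thms)
      qed
      moreover have "\<forall>x\<in>set xs. x < ?N"
        using sx A by (metis atLeastAtMost_iff order_le_imp_less_or_eq subsetD)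
      ultimately show ?thesis
        using Y_insert_max[of "head_word n m" ?N xs ys] m len by (simp add: head_word_Suc)
    qed
    ultimately show ?thesis unfolding Ysum_def R by simp
  qed
  then show ?thesis unfolding Yset_def by simp
qed

text \<open>The symmetriser begins at the last position of the first block and so hands the letter a
  standing there to the second block. As last letter, a made one inversion with each larger element
  of A, whence the power of p; the power of q is that of \<open>Psym_Ysum\<close> for a leading
  letter a.\<close>

lemma Psym_Yset:
  assumes m: "m \<le> n" and A: "A \<subseteq> {1..n - m}" "card A = Suc k"
  shows "Psym (Suc (m + k)) (n - m - k) (Yset m A) =
    (\<Sum>a\<in>A. (p ^ card {x\<in>A. a < x} * q ^ card {x\<in>{1..n - m} - A. a < x}) *s Yset m (A - {a}))"
proof -
  let ?R = "{1..n - m} - A"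
  have fin: "finite A" using A finite_subset by blast
  have ne: "A \<noteq> {}" using A by auto
  have le: "card A \<le> n - m" using card_mono[OF _ A(1)] by simp
  have *: "Psym (Suc (m + k)) (n - m - k) (p ^ inv_list (us @ [a]) *s Ysum (head_word n m @ us @ [a]) ?R []) =
     (p ^ card {x\<in>A. a < x} * q ^ card {x\<in>?R. a < x}) *s
        (p ^ inv_list us *s Ysum (head_word n m @ us) ({1..n - m} - (A - {a})) [])"
    if a: "a \<in> A" and us: "us \<in> permutations_of_set (A - {a})" for a us
  proof -
    have su: "set us = A - {a}" "distinct us" using us by (auto dest: permutations_of_setD)
    have len: "length us = k" using us fin a A by (simp add: length_finite_permutations_of_set)
    have R: "{1..n - m} - (A - {a}) - {a} = ?R" "a \<in> {1..n - m} - (A - {a})" using a A by auto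
    have eqR: "{1..n - m} - (A - {a}) = insert a ?R" using a A by auto
    have cR: "card ({1..n - m} - (A - {a})) = n - m - k"
    proof -
      have "card ?R = n - m - Suc k" using card_Diff_subset[OF fin A(1)] A(2) by simp
      moreover have "a \<notin> ?R" using a by simp
      ultimately show ?thesis unfolding eqR using A(2) le by simp
    qed
    have gt: "{x \<in> {1..n - m} - (A - {a}). a < x} = {x\<in>?R. a < x}" by auto
    have "inv_list (us @ [a]) = inv_list us + card {x\<in>A. a < x}"
    proof -
      have "{x \<in> A - {a}. a < x} = {x\<in>A. a < x}" by auto
      then show ?thesis using su by (simp add: inv_list_snoc length_filter_distinct)
    qed
    moreover have "splits (head_word n m @ us) ({1..n - m} - (A - {a})) []"
      using m A us by (intro splits_right) auto
    then have "Psym (Suc (m + k)) (n - m - k) (Ysum (head_word n m @ us @ [a]) ?R []) =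
      q ^ card {x\<in>?R. a < x} *s Ysum (head_word n m @ us) ({1..n - m} - (A - {a})) []"
      using Psym_Ysum[of "head_word n m @ us" "{1..n - m} - (A - {a})" "[]" a] m len R cR gt by simp
    ultimately show ?thesis by (simp add: power_add algebra_simps)
  qed
  have "Psym (Suc (m + k)) (n - m - k) (Yset m A) = (\<Sum>a\<in>A. \<Sum>us\<in>permutations_of_set (A - {a}).
     Psym (Suc (m + k)) (n - m - k) (p ^ inv_list (us @ [a]) *s Ysum (head_word n m @ us @ [a]) ?R []))"
    unfolding Yset_def by (simp only: Psym_lin sum_permutations_snoc[OF fin ne])
  then show ?thesis by (simp only: * Yset_def scale_sum_right cong: sum.cong)
qed

lemma Egen_Yset:
  "m \<le> n \<Longrightarrow> A \<in> ksubsets (n - m) k \<Longrightarrow>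
    Egen z (Suc m) (Suc (m + k)) (Yset m A) = (\<Sum>B\<in>ksubsets (n - m) k. gcoef z p q h t k A B *s Yset m B)"
proof (induction "n - m" arbitrary: m k A)
  case 0
  then have "k = 0" "A = {}" by (auto simp: ksubsets_def)
  then show ?case by (simp add: ksubsets_0)
next
  case (Suc N')
  show ?case
  proof (cases k)
    case 0
    then have "A = {}" using Suc.prems(2) by (simp add: ksubsets_0)
    then show ?thesis using 0 by (simp add: ksubsets_0)
  next
    case (Suc k')
    define N where "N = n - m"
    have N: "N = Suc N'" "n - Suc m = N'" "m < n" "n + 1 - Suc m = N" using Suc.hyps(2) by (auto simp: N_def)
    have A: "A \<subseteq> {1..N}" "card A = k" using Suc.prems by (auto simp: ksubsets_def N_def)
    have finA: "finite A" using A(1) finite_subset by blast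
    have kN: "k \<le> N" using card_mono[OF _ A(1)] A(2) by simp
    have IH: "Egen z (Suc (Suc m)) (Suc (Suc m + j)) (Yset (Suc m) C) =
       (\<Sum>B\<in>ksubsets N' j. gcoef z p q h t j C B *s Yset (Suc m) B)" if "C \<in> ksubsets N' j" for C j
      using Suc.hyps(1)[of "Suc m" C j] that N by simp
    have in_Yset: "Psym (Suc m) k (Yset (Suc m) B) = Yset m (insert N B)" if "B \<in> ksubsets N' k'" for B
    proof -
      have B: "B \<subseteq> {1..N'}" "card B = k'" "finite B" "N \<notin> B"
        using that N ksubsets_finite[OF that] by (auto simp: ksubsets_def)
      then have c: "card (insert N B) = k" "insert N B - {N} = B" using Suc by auto
      have "insert N B \<subseteq> {1..N}" using B(1) N(1) by auto
      then show ?thesis using Yset_max_in[OF N(3), folded N_def, of "insert N B"] c by simp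
    qed
    have MaxN: "Max (insert N B) = N" "insert N B - {N} = B" if "B \<in> ksubsets N' j" for B j
    proof -
      have B: "B \<subseteq> {1..N'}" "finite B" "N \<notin> B"
        using that N ksubsets_finite[OF that] by (auto simp: ksubsets_def)
      show "Max (insert N B) = N" using B N by (intro Max_eqI) auto
      show "insert N B - {N} = B" using B by auto
    qed
    have X: "X (Suc m) (Yset (Suc m) C) = t N *s Yset (Suc m) C" if "C \<subseteq> {1..N'}" for C
      using X_Yset[of "Suc m" C "Suc m"] that N by simp
    have ks: "ksubsets (n - m) k = ksubsets (Suc N') (Suc k')" using N Suc by (simp add: N_def)
    show ?thesis
    proof (cases "N \<in> A")
      case True
      let ?A = "A - {N}" and ?E = "Egen z (Suc m) (Suc (m + k))"
      have A': "?A \<in> ksubsets N' k'"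
        using A True Suc N by (auto simp: ksubsets_def le_Suc_eq)
      then have A'': "?A \<subseteq> {1..N'}" by (simp add: ksubsets_def)
      have "?E (Yset m A) = ?E (Psym (Suc m) k (Yset (Suc m) ?A))"
        using Yset_max_in[OF N(3), folded N_def, OF A(1) True] A(2) by simp
      also have "\<dots> = Psym (Suc m) k (?E (Yset (Suc m) ?A))"
        using kN N_def by (intro Psym_comm linear_Egen T_Egen[symmetric]) auto
      also have "?E (Yset (Suc m) ?A) = (1 + z * t N) *s Egen z (Suc (Suc m)) (Suc (Suc m + k')) (Yset (Suc m) ?A)"
        using Suc by (simp add: Egen_Cons[of "Suc m"] X[OF A''] algebra_simps)
      also have "Psym (Suc m) k \<dots> = (\<Sum>B\<in>ksubsets N' k'. ((1 + z * t N) * gcoef z p q h t k' ?A B) *s Yset m (insert N B))"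
        unfolding IH[OF A'] by (simp add: in_Yset scale_sum_right cong: sum.cong)
      also have "\<dots> = (\<Sum>B\<in>ksubsets N' k'. gcoef z p q h t k A (insert N B) *s Yset m (insert N B))"
      proof (intro sum.cong refl)
        fix B assume B: "B \<in> ksubsets N' k'"
        have "\<forall>a\<in>A. a \<le> N" using A by auto
        then have "gcoef z p q h t k A (insert N B) = (1 + z * t N) * gcoef z p q h t k' ?A B"
          unfolding Suc gcoef.simps MaxN[OF B] using True by simp
        then show "((1 + z * t N) * gcoef z p q h t k' ?A B) *s Yset m (insert N B) =
          gcoef z p q h t k A (insert N B) *s Yset m (insert N B)" by simp
      qed
      also have "\<dots> = (\<Sum>B\<in>ksubsets (n - m) k. gcoef z p q h t k A B *s Yset m B)"
      proof -
        \<comment> \<open>Elements are only ever moved up, so a set without N cannot be reached from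
          one containing N.\<close>
        have "gcoef z p q h t k A B = 0" if "B \<in> ksubsets N' (Suc k')" for B
        proof -
          have "B \<noteq> {}" "finite B" "B \<subseteq> {1..N'}"
            using that ksubsets_finite[OF that] by (auto simp: ksubsets_def)
          then have "Max B \<in> {1..N'}" using Max_in by blast
          then have "\<not> N \<le> Max B" "\<not> N < Max B" using N by auto
          then show ?thesis unfolding Suc gcoef.simps using True by auto
        qed
        then show ?thesis unfolding ks sum_ksubsets_Suc using N by simp
      qed
      finally show ?thesis .
    next
      case False
      let ?E = "Egen z (Suc m) (Suc (m + k))" and ?P = "Psym (Suc (m + k)) (N - k)"
        and ?D = "Tdown (Suc m) (Suc (m + k))" and ?v = "Yset (Suc m) A"
        and ?E' = "Egen z (Suc (Suc m)) (Suc (Suc m + k'))"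
      have A': "A \<subseteq> {1..N'}"
      proof
        fix x assume x: "x \<in> A"
        then have "x \<noteq> N" using False by auto
        then show "x \<in> {1..N'}" using x A(1) N by (auto simp: le_Suc_eq)
      qed
      have Ak: "A \<in> ksubsets N' k" using A A' by (simp add: ksubsets_def)
      have kN': "k \<le> N'" using card_mono[OF _ A'] A(2) by simp
      have mk: "Suc m + k \<le> n" using kN' N by linarith
      have nin: "?P (?D (Yset (Suc m) B)) = Yset m B" if "B \<in> ksubsets N' k" for B
      proof -
        have B: "B \<subseteq> {1..N'}" "card B = k" "N \<notin> B" using that N by (auto simp: ksubsets_def)
        have "B \<subseteq> {1..N}" using B(1) N(1) by auto
        then show ?thesis using Yset_max_notin[OF N(3), folded N_def, of B] B by simp
      qed
      have "?E (Yset m A) = ?E (?P (?D ?v))" using nin[OF Ak] by simp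
      also have "\<dots> = ?P (?E (?D ?v))"
        by (intro Psym_comm linear_Egen T_Egen_far[symmetric]) auto
      also have "?E (?D ?v) = ?D (Egen z (Suc (Suc m)) (Suc (Suc m + k)) ?v) + z *s Psym (Suc m) k (?E' (h *s ?v - (p - q) *s X (Suc m) ?v))"
      proof -
        have "T i ?v = q *s ?v" if "Suc m < i" "i < Suc m + k" for i
          using T_Yset[of "Suc m" A i] that N A A' by simp
        then show ?thesis using Egen_Tdown[of "Suc m" k ?v z] mk Suc by simp
      qed
      also have "?P \<dots> = ?P (?D (Egen z (Suc (Suc m)) (Suc (Suc m + k)) ?v))
         + (z * (h - (p - q) * t N)) *s ?P (Psym (Suc m) k (?E' ?v))"
        by (simp add: X[OF A'] algebra_simps del: Psym.simps)
      also have "?P (?D (Egen z (Suc (Suc m)) (Suc (Suc m + k)) ?v)) = (\<Sum>B\<in>ksubsets N' k. gcoef z p q h t k A B *s Yset m B)"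
        unfolding IH[OF Ak] by (simp only: Tdown_lin Psym_lin nin cong: sum.cong)
      \<comment> \<open>The two symmetrisers use generators of index below m + k and above m + k
        respectively, hence far apart; x_{m+2}, ..., x_{m+k} are likewise out of reach of
        \<open>?P\<close>.\<close>
      also have "?P (Psym (Suc m) k (?E' ?v)) = Psym (Suc m) k (?E' (?P ?v))"
      proof -
        have "?P (T i v) = T i (?P v)" if "Suc m \<le> i" "Suc i < Suc m + k" for i v
          using that by (intro Psym_comm[OF linear_T, symmetric]) (auto intro: T_far)
        then have "?P (Psym (Suc m) k (?E' ?v)) = Psym (Suc m) k (?P (?E' ?v))"
          by (intro Psym_comm linear_Psym)
        also have "?P (?E' ?v) = ?E' (?P ?v)"
          using Suc by (intro Psym_comm[OF linear_Egen, symmetric] T_Egen_far[symmetric]) auto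
        finally show ?thesis .
      qed
      \<comment> \<open>At level m + 1 the first block reaches one position further right, so
        \<open>?P\<close> begins at its last letter and releases it. The outer symmetriser then
        brings N into the first block: in total a is replaced by N.\<close>
      also have "?P ?v = (\<Sum>a\<in>A. (p ^ card {x\<in>A. a < x} * q ^ card ({a<..<N} - A)) *s Yset (Suc m) (A - {a}))"
      proof -
        have "{x\<in>{1..N'} - A. a < x} = {a<..<N} - A" for a using N by auto
        moreover have "N - k = N' - k'" "Suc (m + k) = Suc (Suc m + k')" using Suc N by auto
        ultimately show ?thesis using Psym_Yset[of "Suc m" A k'] N A A' Suc by simp
      qed
      also have "Psym (Suc m) k (?E' \<dots>) = (\<Sum>a\<in>A. (p ^ card {x\<in>A. a < x} * q ^ card ({a<..<N} - A)) *s
          (\<Sum>B\<in>ksubsets N' k'. gcoef z p q h t k' (A - {a}) B *s Yset m (insert N B)))"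
      proof -
        have "?E' (Yset (Suc m) (A - {a})) = (\<Sum>B\<in>ksubsets N' k'. gcoef z p q h t k' (A - {a}) B *s Yset (Suc m) B)"
          if "a \<in> A" for a
        proof -
          have "A - {a} \<in> ksubsets N' k'" using A A' that Suc by (auto simp: ksubsets_def)
          then show ?thesis by (rule IH)
        qed
        then show ?thesis by (simp only: Psym_lin Egen_lin in_Yset cong: sum.cong)
      qed
      also have "\<dots> = (\<Sum>B\<in>ksubsets N' k'. (\<Sum>a\<in>A. p ^ card {x\<in>A. a < x} * q ^ card ({a<..<N} - A) *
          gcoef z p q h t k' (A - {a}) B) *s Yset m (insert N B))"
        by (simp only: scale_sum_right scale_sum_left scale_scale sum.swap[of _ A])
      also have "(z * (h - (p - q) * t N)) *s \<dots> = (\<Sum>B\<in>ksubsets N' k'. gcoef z p q h t k A (insert N B) *s Yset m (insert N B))"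
      proof -
        have "\<forall>a\<in>A. a < N" using A' N by auto
        then have "gcoef z p q h t k A (insert N B) = z * (h - (p - q) * t N) *
          (\<Sum>a\<in>A. p ^ card {x\<in>A. a < x} * q ^ card ({a<..<N} - A) * gcoef z p q h t k' (A - {a}) B)"
          if "B \<in> ksubsets N' k'" for B
          unfolding Suc gcoef.simps MaxN[OF that] using False by simp
        then show ?thesis by (simp only: scale_sum_right scale_scale cong: sum.cong)
      qed
      also have "(\<Sum>B\<in>ksubsets N' k. gcoef z p q h t k A B *s Yset m B) + \<dots> =
          (\<Sum>B\<in>ksubsets (n - m) k. gcoef z p q h t k A B *s Yset m B)"
        unfolding ks sum_ksubsets_Suc using Suc N by simp
      finally show ?thesis .
    qed
  qed
qed

end

subsection \<open>Ribbons\<close>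

text \<open>Explicit form of a ribbon in rows i to j: row l ends exactly below the first box of row
  l - 1, so consecutive rows share one column.\<close>

definition rib :: "nat \<Rightarrow> nat \<Rightarrow> nat \<Rightarrow> (nat \<Rightarrow> nat) \<Rightarrow> (nat \<Rightarrow> nat) \<Rightarrow> bool" where
  "rib k i j \<mu> \<nu> \<longleftrightarrow> 1 \<le> i \<and> i \<le> j \<and> j \<le> k \<and> \<nu> i < \<mu> i
     \<and> (\<forall>l. i < l \<and> l \<le> j \<longrightarrow> \<mu> l = Suc (\<nu> (l - 1)))
     \<and> (\<forall>l. 1 \<le> l \<and> l \<le> k \<and> (l < i \<or> j < l) \<longrightarrow> \<mu> l = \<nu> l)"

lemma parts_antimono: "\<nu> \<in> parts n k \<Longrightarrow> 1 \<le> i \<Longrightarrow> i \<le> j \<Longrightarrow> j \<le> k \<Longrightarrow> \<nu> j \<le> \<nu> i"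
  by (simp add: parts_def)

lemma rib_less:
  assumes "rib k i j \<mu> \<nu>" "\<nu> \<in> parts n k" "i \<le> l" "l \<le> j"
  shows "\<nu> l < \<mu> l"
proof (cases "l = i")
  case True
  then show ?thesis using assms(1) by (simp add: rib_def)
next
  case False
  then have "\<mu> l = Suc (\<nu> (l - 1))" using assms by (simp add: rib_def)
  moreover have "\<nu> l \<le> \<nu> (l - 1)"
    using assms False by (intro parts_antimono[OF assms(2)]) (auto simp: rib_def)
  ultimately show ?thesis by simp
qed

lemma rib_cells:
  assumes "rib k i j \<mu> \<nu>"
  shows "cells k \<mu> \<nu> = {(l, c). i \<le> l \<and> l \<le> j \<and> \<nu> l < c \<and> c \<le> \<mu> l}"
proof -
  have "\<not> (\<nu> l < c \<and> c \<le> \<mu> l)" if "1 \<le> l" "l \<le> k" "\<not> (i \<le> l \<and> l \<le> j)" for l c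
  proof -
    have "\<mu> l = \<nu> l" using assms that by (simp add: rib_def not_le)
    then show ?thesis by simp
  qed
  moreover have "1 \<le> i" "j \<le> k" using assms by (auto simp: rib_def)
  ultimately show ?thesis unfolding cells_def by fastforce
qed

lemma rib_fst_cells:
  assumes "rib k i j \<mu> \<nu>" "\<nu> \<in> parts n k"
  shows "fst ` cells k \<mu> \<nu> = {i..j}"
proof (intro equalityI subsetI)
  fix l assume "l \<in> fst ` cells k \<mu> \<nu>"
  then show "l \<in> {i..j}" unfolding rib_cells[OF assms(1)] by auto
next
  fix l assume "l \<in> {i..j}"
  then have "(l, \<mu> l) \<in> cells k \<mu> \<nu>"
    unfolding rib_cells[OF assms(1)] using rib_less[OF assms, of l] by simp
  then show "l \<in> fst ` cells k \<mu> \<nu>" by force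
qed

lemma rib_head_row:
  assumes "rib k i j \<mu> \<nu>" "\<nu> \<in> parts n k"
  shows "head_row k \<mu> \<nu> = i"
proof -
  have "i \<le> j" using assms by (simp add: rib_def)
  then show ?thesis unfolding head_row_def rib_fst_cells[OF assms] by (intro Min_eqI) auto
qed

lemma rib_rib_ht:
  assumes "rib k i j \<mu> \<nu>" "\<nu> \<in> parts n k"
  shows "rib_ht k \<mu> \<nu> = Suc j - i"
  unfolding rib_ht_def rib_fst_cells[OF assms] by simp

lemma rib_rib_wd:
  assumes r: "rib k i j \<mu> \<nu>" and \<nu>: "\<nu> \<in> parts n k" and \<mu>: "\<mu> \<in> parts n k"
  shows "rib_wd k \<mu> \<nu> = \<mu> i - \<nu> j"
proof -
  have ij: "1 \<le> i" "i \<le> j" "j \<le> k" using r by (auto simp: rib_def)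
  have "snd ` cells k \<mu> \<nu> = {\<nu> j<..\<mu> i}"
  proof (intro equalityI subsetI)
    fix c assume "c \<in> snd ` cells k \<mu> \<nu>"
    then obtain l where l: "i \<le> l" "l \<le> j" "\<nu> l < c" "c \<le> \<mu> l" unfolding rib_cells[OF r] by auto
    then have "\<nu> j \<le> \<nu> l" "\<mu> l \<le> \<mu> i"
      using ij parts_antimono[OF \<nu>, of l j] parts_antimono[OF \<mu>, of i l] by auto
    then show "c \<in> {\<nu> j<..\<mu> i}" using l by simp
  next
    fix c assume c: "c \<in> {\<nu> j<..\<mu> i}"
    \<comment> \<open>The topmost ribbon row starting at or left of column c. The row above starts
      to the right of c, and this row ends below that start, so it contains column c.\<close>
    define l where "l = (LEAST l. i \<le> l \<and> \<nu> l < c)"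
    have l: "i \<le> l \<and> \<nu> l < c" unfolding l_def by (rule LeastI[of _ j]) (use c ij in auto)
    have lj: "l \<le> j" unfolding l_def by (rule Least_le) (use c ij in auto)
    have "c \<le> \<mu> l"
    proof (cases "l = i")
      case False
      then have "l - 1 < l" "i \<le> l - 1" using l by auto
      then have "\<not> \<nu> (l - 1) < c" using not_less_Least[of "l - 1"] unfolding l_def by blast
      moreover have "\<mu> l = Suc (\<nu> (l - 1))" using r l lj False by (simp add: rib_def)
      ultimately show ?thesis by simp
    qed (use c in simp)
    then have "(l, c) \<in> cells k \<mu> \<nu>" unfolding rib_cells[OF r] using l lj by simp
    then show "c \<in> snd ` cells k \<mu> \<nu>" by force
  qed
  then show ?thesis by (simp add: rib_wd_def)
qed

text \<open>From any box one walks right to the end of its row and then up, since that end lies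
  below a box of the row above; thus every box is joined to the head. A square of four boxes would
  need two shared columns.\<close>

lemma rib_is_ribbon:
  assumes r: "rib k i j \<mu> \<nu>" and \<nu>: "\<nu> \<in> parts n k"
  shows "is_ribbon k \<mu> \<nu>"
proof -
  let ?C = "cells k \<mu> \<nu>"
  let ?R = "{(c, d). c \<in> ?C \<and> d \<in> ?C \<and> adjacent c d}"
  have ij: "1 \<le> i" "i \<le> j" "j \<le> k" using r by (auto simp: rib_def)
  have cell: "(l, c) \<in> ?C \<longleftrightarrow> i \<le> l \<and> l \<le> j \<and> \<nu> l < c \<and> c \<le> \<mu> l" for l c
    unfolding rib_cells[OF r] by simp
  have sym: "sym (?R\<^sup>*)" by (rule sym_rtrancl) (auto simp: sym_def adjacent_def)
  have row: "(l, c) \<in> ?C \<Longrightarrow> ((l, c), (l, \<mu> l)) \<in> ?R\<^sup>*" for l c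
  proof (induction "\<mu> l - c" arbitrary: c)
    case 0
    then show ?case by (auto simp: cell)
  next
    case (Suc d)
    then have c: "(l, Suc c) \<in> ?C" by (auto simp: cell)
    then have "((l, c), (l, Suc c)) \<in> ?R" using Suc.prems by (auto simp: adjacent_def)
    moreover have "((l, Suc c), (l, \<mu> l)) \<in> ?R\<^sup>*" using Suc.hyps(1)[OF _ c] Suc.hyps(2) by simp
    ultimately show ?case by (rule converse_rtrancl_into_rtrancl)
  qed
  have top: "i + d \<le> j \<Longrightarrow> ((i + d, \<mu> (i + d)), (i, \<mu> i)) \<in> ?R\<^sup>*" for d
  proof (induction d)
    case (Suc d)
    have eq: "\<mu> (i + Suc d) = Suc (\<nu> (i + d))" using r Suc.prems by (simp add: rib_def)
    have "(i + Suc d, \<mu> (i + Suc d)) \<in> ?C"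
      using rib_less[OF r \<nu>, of "i + Suc d"] Suc.prems by (simp add: cell)
    moreover have m: "(i + d, \<mu> (i + Suc d)) \<in> ?C"
      using rib_less[OF r \<nu>, of "i + d"] Suc.prems unfolding eq by (simp add: cell)
    ultimately have "((i + Suc d, \<mu> (i + Suc d)), (i + d, \<mu> (i + Suc d))) \<in> ?R"
      by (auto simp: adjacent_def)
    then show ?case using row[OF m] Suc by (meson Suc_leD add_Suc_right converse_rtrancl_into_rtrancl le_simps(1) rtrancl_trans order.trans lessI less_imp_le add_le_cancel_left)
  qed simp
  have all: "(a, (i, \<mu> i)) \<in> ?R\<^sup>*" if "a \<in> ?C" for a
  proof -
    obtain l c where a: "a = (l, c)" by force
    have "i \<le> l" "l \<le> j" using that a by (auto simp: cell)
    then have "((l, \<mu> l), (i, \<mu> i)) \<in> ?R\<^sup>*" using top[of "l - i"] by simp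
    then show ?thesis using row[of l c] that a by (meson rtrancl_trans)
  qed
  have "(a, b) \<in> ?R\<^sup>*" if "a \<in> ?C" "b \<in> ?C" for a b
    using all[OF that(1)] all[OF that(2)] sym by (meson rtrancl_trans symD)
  moreover have "\<nu> l \<le> \<mu> l" if "1 \<le> l" "l \<le> k" for l
  proof (cases "i \<le> l \<and> l \<le> j")
    case True
    then show ?thesis using rib_less[OF r \<nu>, of l] by simp
  next
    case False
    then show ?thesis using r that by (simp add: rib_def not_le)
  qed
  moreover have "?C \<noteq> {}"
  proof -
    have "(i, \<mu> i) \<in> ?C" using r by (simp add: cell) (simp add: rib_def)
    then show ?thesis by blast
  qed
  moreover have "\<not> ((l, c) \<in> ?C \<and> (l, c + 1) \<in> ?C \<and> (l + 1, c) \<in> ?C \<and> (l + 1, c + 1) \<in> ?C)" for l c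
  proof
    assume A: "(l, c) \<in> ?C \<and> (l, c + 1) \<in> ?C \<and> (l + 1, c) \<in> ?C \<and> (l + 1, c + 1) \<in> ?C"
    then have "i \<le> l" "Suc l \<le> j" "\<nu> l < c" "c + 1 \<le> \<mu> (Suc l)" by (auto simp: cell)
    moreover have "\<mu> (Suc l) = Suc (\<nu> l)" using calculation r by (simp add: rib_def)
    ultimately show False by simp
  qed
  ultimately show ?thesis unfolding is_ribbon_def by blast
qed

text \<open>Connectedness gives a shared column for any two consecutive rows between head and foot,
  and the absence of a square forbids a second one. Together they determine where the lower row
  ends.\<close>

lemma is_ribbon_rib:
  assumes r: "is_ribbon k \<mu> \<nu>" and \<nu>: "\<nu> \<in> parts n k" and \<mu>: "\<mu> \<in> parts n k"
  shows "\<exists>j. rib k (head_row k \<mu> \<nu>) j \<mu> \<nu>"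
proof -
  let ?C = "cells k \<mu> \<nu>"
  let ?R = "{(c, d). c \<in> ?C \<and> d \<in> ?C \<and> adjacent c d}"
  define i where "i = head_row k \<mu> \<nu>"
  define j where "j = Max (fst ` ?C)"
  have le: "\<nu> l \<le> \<mu> l" if "1 \<le> l" "l \<le> k" for l using r that by (simp add: is_ribbon_def)
  have ne: "fst ` ?C \<noteq> {}" using r by (simp add: is_ribbon_def)
  have fin: "finite (fst ` ?C)" by (rule finite_subset[of _ "{1..k}"]) (auto simp: cells_def)
  have "i \<in> fst ` ?C" "j \<in> fst ` ?C"
    unfolding i_def j_def head_row_def using Min_in[OF fin ne] Max_in[OF fin ne] by auto
  then obtain ci cj where ci: "(i, ci) \<in> ?C" and cj: "(j, cj) \<in> ?C" by force
  have bnd: "i \<le> l \<and> l \<le> j" if "(l, c) \<in> ?C" for l c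
  proof -
    have "l \<in> fst ` ?C" using that by force
    then show ?thesis unfolding i_def j_def head_row_def using fin by simp
  qed
  have mid: "\<mu> (Suc l) = Suc (\<nu> l)" if l: "i \<le> l" "l < j" for l
  proof -
    have "((i, ci), (j, cj)) \<in> ?R\<^sup>*" using r ci cj unfolding is_ribbon_def by blast
    \<comment> \<open>A path from the top row to the bottom row must contain a step crossing the
      border between rows l and l + 1.\<close>
    then have "\<exists>x y. (x, y) \<in> ?R \<and> fst x \<le> l \<and> l < fst y"
    proof -
      have "(a, b) \<in> ?R\<^sup>* \<Longrightarrow> fst a \<le> l \<Longrightarrow> l < fst b \<Longrightarrow> \<exists>x y. (x, y) \<in> ?R \<and> fst x \<le> l \<and> l < fst y" for a b
        by (induction rule: rtrancl_induct) (auto, (metis not_le)+)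
      then show ?thesis using \<open>((i, ci), (j, cj)) \<in> ?R\<^sup>*\<close> l by fastforce
    qed
    then obtain x y where xy: "x \<in> ?C" "y \<in> ?C" "adjacent x y" "fst x \<le> l" "l < fst y" by blast
    then have "fst x = l" "fst y = Suc l" "snd x = snd y" by (auto simp: adjacent_def)
    then have c: "(l, snd x) \<in> ?C" "(Suc l, snd x) \<in> ?C" using xy(1,2) by (metis prod.collapse)+
    then have ge: "Suc (\<nu> l) \<le> \<mu> (Suc l)" by (auto simp: cells_def)
    have lk: "1 \<le> l" "Suc l \<le> k" using c by (auto simp: cells_def)
    have "\<not> Suc (Suc (\<nu> l)) \<le> \<mu> (Suc l)"
    proof
      assume A: "Suc (Suc (\<nu> l)) \<le> \<mu> (Suc l)"
      have "\<mu> (Suc l) \<le> \<mu> l" "\<nu> (Suc l) \<le> \<nu> l"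
        using lk parts_antimono[OF \<mu>, of l "Suc l"] parts_antimono[OF \<nu>, of l "Suc l"] by auto
      then have "(l, Suc (\<nu> l)) \<in> ?C" "(l, Suc (\<nu> l) + 1) \<in> ?C" "(l + 1, Suc (\<nu> l)) \<in> ?C" "(l + 1, Suc (\<nu> l) + 1) \<in> ?C"
        using A lk by (auto simp: cells_def)
      then show False using r unfolding is_ribbon_def by blast
    qed
    then show ?thesis using ge by simp
  qed
  have "rib k i j \<mu> \<nu>"
    unfolding rib_def
  proof (intro conjI allI impI)
    show "1 \<le> i" "\<nu> i < \<mu> i" using ci by (auto simp: cells_def)
    show "i \<le> j" using bnd[OF ci] by simp
    show "j \<le> k" using cj by (auto simp: cells_def)
    show "\<mu> l = Suc (\<nu> (l - 1))" if "i < l \<and> l \<le> j" for l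
      using mid that by (cases l) auto
    show "\<mu> l = \<nu> l" if "1 \<le> l \<and> l \<le> k \<and> (l < i \<or> j < l)" for l
    proof -
      have "(l, \<mu> l) \<notin> ?C" using bnd[of l] that by auto
      then show ?thesis using le[of l] that by (auto simp: cells_def)
    qed
  qed
  then show ?thesis unfolding i_def by blast
qed

lemma is_ribbon_iff:
  assumes "\<nu> \<in> parts n k" "\<mu> \<in> parts n k"
  shows "is_ribbon k \<mu> \<nu> \<and> head_row k \<mu> \<nu> = i \<longleftrightarrow> (\<exists>j. rib k i j \<mu> \<nu>)"
  using rib_is_ribbon[OF _ assms(1)] rib_head_row[OF _ assms(1)] is_ribbon_rib[OF _ assms] by blast

subsection \<open>Partitions as sets\<close>

text \<open>Prepends a first row of length m. The remaining rows range over
  \<open>parts (m + k) k\<close>, the box of height k and width m, which expresses that they fit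
  below that row.\<close>

definition pcons :: "nat \<Rightarrow> (nat \<Rightarrow> nat) \<Rightarrow> nat \<Rightarrow> nat" where
  "pcons m \<nu> = (\<lambda>i. if i = 0 then 0 else if i = 1 then m else \<nu> (i - 1))"

lemma pcons_simps [simp]:
  "pcons m \<nu> 0 = 0" "pcons m \<nu> (Suc 0) = m" "1 \<le> i \<Longrightarrow> pcons m \<nu> (Suc i) = \<nu> i"
  by (auto simp: pcons_def)

lemma pcons_in_parts:
  assumes "\<nu> \<in> parts (m + k) k" "m \<le> n - Suc k"
  shows "pcons m \<nu> \<in> parts n (Suc k)"
proof -
  have *: "\<nu> i \<le> m" if "1 \<le> i" "i \<le> k" for i using assms that by (simp add: parts_def)
  show ?thesis unfolding parts_def mem_Collect_eq
  proof (intro conjI allI impI)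
    fix i assume i: "1 \<le> i \<and> i \<le> Suc k"
    show "pcons m \<nu> i \<le> n - Suc k"
    proof (cases "i = 1")
      case False
      then have "\<nu> (i - 1) \<le> m" using i by (intro *) auto
      then show ?thesis using False i assms(2) by (simp add: pcons_def)
    qed (use assms(2) in simp)
  next
    fix i j assume ij: "1 \<le> i \<and> i \<le> j \<and> j \<le> Suc k"
    show "pcons m \<nu> j \<le> pcons m \<nu> i"
    proof (cases "j = 1 \<or> i = 1")
      case True
      then show ?thesis using ij * [of "j - 1"] by (cases "j = 1") (auto simp: pcons_def)
    next
      case False
      then have "\<nu> (j - 1) \<le> \<nu> (i - 1)" using ij by (intro parts_antimono[OF assms(1)]) auto
      then show ?thesis using False ij by (simp add: pcons_def)
    qed
  next
    fix i assume "\<not> (1 \<le> i \<and> i \<le> Suc k)"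
    then have "i = 0 \<or> (i \<noteq> 1 \<and> \<not> (1 \<le> i - 1 \<and> i - 1 \<le> k))" by auto
    moreover have "\<nu> (i - 1) = 0" if "\<not> (1 \<le> i - 1 \<and> i - 1 \<le> k)"
      using assms(1) that unfolding parts_def by blast
    ultimately show "pcons m \<nu> i = 0" by (auto simp: pcons_def)
  qed
qed

lemma parts_Suc_cases:
  assumes "\<mu> \<in> parts n (Suc k)"
  obtains m \<nu> where "\<mu> = pcons m \<nu>" "m \<le> n - Suc k" "\<nu> \<in> parts (m + k) k"
proof
  define \<nu> where "\<nu> i = (if i = 0 then 0 else \<mu> (Suc i))" for i
  have z: "\<mu> i = 0" if "i = 0 \<or> Suc k < i" for i using assms that by (auto simp: parts_def)
  show "\<mu> = pcons (\<mu> 1) \<nu>" using z by (auto simp: pcons_def \<nu>_def fun_eq_iff)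
  show "\<mu> 1 \<le> n - Suc k" using assms by (simp add: parts_def)
  show "\<nu> \<in> parts (\<mu> 1 + k) k" unfolding parts_def mem_Collect_eq
  proof (intro conjI allI impI)
    fix i assume "1 \<le> i \<and> i \<le> k"
    then show "\<nu> i \<le> \<mu> 1 + k - k" using parts_antimono[OF assms, of 1 "Suc i"] by (simp add: \<nu>_def)
  next
    fix i j assume "1 \<le> i \<and> i \<le> j \<and> j \<le> k"
    then show "\<nu> j \<le> \<nu> i" using parts_antimono[OF assms, of "Suc i" "Suc j"] by (simp add: \<nu>_def)
  next
    fix i assume "\<not> (1 \<le> i \<and> i \<le> k)"
    then show "\<nu> i = 0" using z[of "Suc i"] by (auto simp: \<nu>_def)
  qed
qed

lemma pcons_eq_iff:
  assumes "\<nu> \<in> parts a k" "\<nu>' \<in> parts b k'"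
  shows "pcons m \<nu> = pcons m' \<nu>' \<longleftrightarrow> m = m' \<and> \<nu> = \<nu>'"
proof
  assume eq: "pcons m \<nu> = pcons m' \<nu>'"
  have "m = m'" using fun_cong[OF eq, of "Suc 0"] by simp
  moreover have "\<nu> i = \<nu>' i" for i
  proof (cases "i = 0")
    case True
    then show ?thesis using assms by (simp add: parts_def)
  next
    case False
    then show ?thesis using fun_cong[OF eq, of "Suc i"] by simp
  qed
  ultimately show "m = m' \<and> \<nu> = \<nu>'" by auto
qed simp

text \<open>The beta-set of the partition; by \<open>wpart_image\<close> it is the set of values of
  \<open>w_nu\<close> on {1..k}.\<close>

definition beads :: "nat \<Rightarrow> (nat \<Rightarrow> nat) \<Rightarrow> nat set" where
  "beads k \<nu> = (\<lambda>i. \<nu> i + k + 1 - i) ` {1..k}"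

lemma bead_less:
  assumes "\<nu> \<in> parts n k" "1 \<le> i" "i < j" "j \<le> k"
  shows "\<nu> j + k + 1 - j < \<nu> i + k + 1 - i"
  using parts_antimono[OF assms(1), of i j] assms by linarith

lemma inj_on_bead: "\<nu> \<in> parts n k \<Longrightarrow> inj_on (\<lambda>i. \<nu> i + k + 1 - i) {1..k}"
  by (rule linorder_inj_onI) (auto dest: bead_less[of \<nu> n k] simp: atLeastAtMost_iff)

lemma beads_pcons:
  "beads (Suc k) (pcons m \<nu>) = insert (m + Suc k) (beads k \<nu>)"
proof -
  have "{1..Suc k} = insert 1 (Suc ` {1..k})" 
    by (simp add: image_Suc_atLeastAtMost atLeastAtMost_insertL)
  then have "beads (Suc k) (pcons m \<nu>) = insert (m + Suc k) ((\<lambda>i. pcons m \<nu> (Suc i) + Suc k + 1 - Suc i) ` {1..k})"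
    unfolding beads_def by (simp add: image_image del: image_Suc_atLeastAtMost)
  also have "(\<lambda>i. pcons m \<nu> (Suc i) + Suc k + 1 - Suc i) ` {1..k} = beads k \<nu>"
    unfolding beads_def by (intro image_cong) auto
  finally show ?thesis .
qed

lemma beads_in_ksubsets:
  assumes "\<nu> \<in> parts n k" "k \<le> n"
  shows "beads k \<nu> \<in> ksubsets n k"
proof -
  have "card (beads k \<nu>) = k" unfolding beads_def using card_image[OF inj_on_bead[OF assms(1)]] by simp
  moreover have "beads k \<nu> \<subseteq> {1..n}"
  proof
    fix x assume "x \<in> beads k \<nu>"
    then obtain i where i: "1 \<le> i" "i \<le> k" "x = \<nu> i + k + 1 - i" by (auto simp: beads_def)
    moreover have "\<nu> i \<le> n - k" using assms i by (simp add: parts_def)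
    ultimately show "x \<in> {1..n}" using assms(2) by auto
  qed
  ultimately show ?thesis by (simp add: ksubsets_def)
qed

lemma Max_beads_pcons:
  assumes "\<nu> \<in> parts (m + k) k"
  shows "Max (insert (m + Suc k) (beads k \<nu>)) = m + Suc k" "m + Suc k \<notin> beads k \<nu>"
    "\<forall>a\<in>beads k \<nu>. a < m + Suc k"
proof -
  have s: "beads k \<nu> \<subseteq> {1..m + k}" using beads_in_ksubsets[OF assms] by (simp add: ksubsets_def)
  show "\<forall>a\<in>beads k \<nu>. a < m + Suc k" using s by auto
  then show "m + Suc k \<notin> beads k \<nu>" "Max (insert (m + Suc k) (beads k \<nu>)) = m + Suc k"
    using finite_subset[OF s] by (auto intro!: Max_eqI)
qed

lemma parts_0: "parts n 0 = {\<lambda>_. 0}"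
  by (auto simp: parts_def)

lemma inj_on_beads: "inj_on (beads k) (parts n k)"
proof (induction k arbitrary: n)
  case 0
  then show ?case by (simp add: parts_0)
next
  case (Suc k)
  show ?case
  proof (rule inj_onI)
    fix \<mu> \<mu>' assume A: "\<mu> \<in> parts n (Suc k)" "\<mu>' \<in> parts n (Suc k)" "beads (Suc k) \<mu> = beads (Suc k) \<mu>'"
    obtain m \<nu> where 1: "\<mu> = pcons m \<nu>" "\<nu> \<in> parts (m + k) k" using A(1) by (rule parts_Suc_cases)
    obtain m' \<nu>' where 2: "\<mu>' = pcons m' \<nu>'" "\<nu>' \<in> parts (m' + k) k" using A(2) by (rule parts_Suc_cases)
    have eq: "insert (m + Suc k) (beads k \<nu>) = insert (m' + Suc k) (beads k \<nu>')"
      using A(3) unfolding 1 2 beads_pcons .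
    then have "m + Suc k = m' + Suc k" using Max_beads_pcons(1)[OF 1(2)] Max_beads_pcons(1)[OF 2(2)] by metis
    then have m: "m = m'" by simp
    have "beads k \<nu> = beads k \<nu>'"
      using eq Max_beads_pcons(2)[OF 1(2)] Max_beads_pcons(2)[OF 2(2)] unfolding m by (metis insert_ident)
    then have "\<nu> = \<nu>'" using inj_onD[OF Suc.IH] 1(2) 2(2) m by blast
    then show "\<mu> = \<mu>'" using 1 2 m by simp
  qed
qed

lemma beads_surj: "B \<in> ksubsets n k \<Longrightarrow> \<exists>\<nu>\<in>parts n k. beads k \<nu> = B"
proof (induction k arbitrary: n B)
  case 0
  then show ?case by (auto simp: ksubsets_0 parts_0 beads_def)
next
  case (Suc k)
  have fin: "finite B" and sub: "B \<subseteq> {1..n}" and card: "card B = Suc k"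
    using Suc.prems ksubsets_finite[OF Suc.prems] by (auto simp: ksubsets_def)
  then have ne: "B \<noteq> {}" by auto
  define b where "b = Max B"
  have b: "b \<in> B" "\<And>x. x \<in> B \<Longrightarrow> x \<le> b" using Max_in[OF fin ne] fin by (auto simp: b_def)
  have "B \<subseteq> {1..b}" using sub b(2) by fastforce
  then have "Suc k \<le> b" using card_mono[of "{1..b}" B] card by simp
  then obtain m where m: "b = m + Suc k" by (metis add.commute le_Suc_ex)
  have "B - {b} \<subseteq> {1..m + k}"
  proof
    fix x assume "x \<in> B - {b}"
    then show "x \<in> {1..m + k}" using b(2)[of x] sub m by fastforce
  qed
  then have "B - {b} \<in> ksubsets (m + k) k" using b(1) card by (simp add: ksubsets_def)
  then obtain \<nu> where \<nu>: "\<nu> \<in> parts (m + k) k" "beads k \<nu> = B - {b}" using Suc.IH by blast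
  have "b \<le> n" using b(1) sub by auto
  then have "m \<le> n - Suc k" using m by linarith
  then have "pcons m \<nu> \<in> parts n (Suc k)" using pcons_in_parts \<nu>(1) by blast
  moreover have "beads (Suc k) (pcons m \<nu>) = B"
    unfolding beads_pcons \<nu>(2) m[symmetric] using b(1) by blast
  ultimately show ?case by blast
qed

lemma bij_betw_beads: "k \<le> n \<Longrightarrow> bij_betw (beads k) (parts n k) (ksubsets n k)"
  unfolding bij_betw_def using inj_on_beads beads_in_ksubsets beads_surj by blast

lemma finite_parts: "finite (parts n k)"
proof (cases "k \<le> n")
  case True
  then show ?thesis using bij_betw_finite[OF bij_betw_beads] by auto
next
  case False
  have "\<nu> = (\<lambda>_. 0)" if "\<nu> \<in> parts n k" for \<nu>
  proof
    fix i
    show "\<nu> i = 0" using that False by (cases "1 \<le> i \<and> i \<le> k") (auto simp: parts_def)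
  qed
  then have "parts n k \<subseteq> {\<lambda>_. 0}" by blast
  then show ?thesis using finite_subset by blast
qed

subsection \<open>The operators \<open>R\<^sub>i\<close>\<close>

lemma rib_pcons:
  assumes "1 \<le> i"
  shows "rib (Suc k) (Suc i) (Suc j) (pcons m \<mu>) (pcons m' \<nu>) \<longleftrightarrow> m = m' \<and> rib k i j \<mu> \<nu>"
proof
  assume r: "rib (Suc k) (Suc i) (Suc j) (pcons m \<mu>) (pcons m' \<nu>)"
  have r1: "pcons m \<mu> l = Suc (pcons m' \<nu> (l - 1))" if "Suc i < l" "l \<le> Suc j" for l
    using r that unfolding rib_def by blast
  have r2: "pcons m \<mu> l = pcons m' \<nu> l" if "1 \<le> l" "l \<le> Suc k" "l < Suc i \<or> Suc j < l" for l
    using r that unfolding rib_def by blast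
  have "m = m'" using r2[of "Suc 0"] assms by simp
  moreover have "rib k i j \<mu> \<nu>" unfolding rib_def
  proof (intro conjI allI impI)
    show "1 \<le> i" "i \<le> j" "j \<le> k" "\<nu> i < \<mu> i" using r assms by (simp_all add: rib_def)
  next
    fix l assume l: "i < l \<and> l \<le> j"
    then obtain l' where "l = Suc l'" "1 \<le> l'" using assms by (cases l) auto
    then show "\<mu> l = Suc (\<nu> (l - 1))" using r1[of "Suc l"] l by simp
  next
    fix l assume l: "1 \<le> l \<and> l \<le> k \<and> (l < i \<or> j < l)"
    then show "\<mu> l = \<nu> l" using r2[of "Suc l"] by simp
  qed
  ultimately show "m = m' \<and> rib k i j \<mu> \<nu>" by simp
next
  assume r: "m = m' \<and> rib k i j \<mu> \<nu>"
  have r1: "\<mu> l = Suc (\<nu> (l - 1))" if "i < l" "l \<le> j" for l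
    using r that unfolding rib_def by blast
  have r2: "\<mu> l = \<nu> l" if "1 \<le> l" "l \<le> k" "l < i \<or> j < l" for l
    using r that unfolding rib_def by blast
  show "rib (Suc k) (Suc i) (Suc j) (pcons m \<mu>) (pcons m' \<nu>)" unfolding rib_def
  proof (intro conjI allI impI)
    show "1 \<le> Suc i" "Suc i \<le> Suc j" "Suc j \<le> Suc k" "pcons m' \<nu> (Suc i) < pcons m \<mu> (Suc i)"
      using r assms by (simp_all add: rib_def)
  next
    fix l assume l: "Suc i < l \<and> l \<le> Suc j"
    define l' where "l' = l - 2"
    have l': "l = Suc (Suc l')" "1 \<le> l'" using assms l unfolding l'_def by linarith+
    then show "pcons m \<mu> l = Suc (pcons m' \<nu> (l - 1))" using r1[of "Suc l'"] l by simp
  next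
    fix l assume l: "1 \<le> l \<and> l \<le> Suc k \<and> (l < Suc i \<or> Suc j < l)"
    show "pcons m \<mu> l = pcons m' \<nu> l"
    proof (cases "l = 1")
      case True
      then show ?thesis using r by simp
    next
      case False
      then obtain l' where l': "l = Suc l'" "1 \<le> l'" using l by (cases l) auto
      then have "\<mu> l' = \<nu> l'" using l by (intro r2) auto
      then show ?thesis using l' by simp
    qed
  qed
qed

lemma Rco_cong:
  assumes "\<And>\<nu>. \<nu> \<in> parts n k \<Longrightarrow> c \<nu> = d \<nu>" "\<mu> \<in> parts n k"
  shows "Rco n k p q h t i c \<mu> = Rco n k p q h t i d \<mu>"
proof -
  let ?S = "{\<nu> \<in> parts n k. is_ribbon k \<mu> \<nu> \<and> head_row k \<mu> \<nu> = i}"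
  have "(\<Sum>\<nu>\<in>?S. w \<nu> * c \<nu>) = (\<Sum>\<nu>\<in>?S. w \<nu> * d \<nu>)" for w
    by (intro sum.cong) (simp_all add: assms(1))
  then show ?thesis unfolding Rco_def assms(1)[OF assms(2)] by simp
qed

text \<open>A ribbon with head below row 1 leaves the first row alone, so source and target share
  it. Its height, width and head value depend only on the lower rows, the head value because
  \<open>k + 1 - i\<close> is unchanged when k and i both grow by one.\<close>

lemma Rco_pcons:
  assumes m: "m \<le> n - Suc k" and \<mu>: "\<mu> \<in> parts (m + k) k" and i: "1 \<le> i" "i \<le> k"
  shows "Rco n (Suc k) p q h t (Suc i) c (pcons m \<mu>) = Rco (m + k) k p q h t i (\<lambda>\<nu>. c (pcons m \<nu>)) \<mu>"
proof -
  let ?S = "{\<nu> \<in> parts n (Suc k). is_ribbon (Suc k) (pcons m \<mu>) \<nu> \<and> head_row (Suc k) (pcons m \<mu>) \<nu> = Suc i}"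
  let ?S' = "{\<nu> \<in> parts (m + k) k. is_ribbon k \<mu> \<nu> \<and> head_row k \<mu> \<nu> = i}"
  have \<mu>': "pcons m \<mu> \<in> parts n (Suc k)" using pcons_in_parts[OF \<mu> m] .
  have iff: "is_ribbon (Suc k) (pcons m \<mu>) (pcons m' \<nu>) \<and> head_row (Suc k) (pcons m \<mu>) (pcons m' \<nu>) = Suc i \<longleftrightarrow>
     m = m' \<and> (\<exists>j. rib k i j \<mu> \<nu>)" if "\<nu> \<in> parts (m' + k) k" "m' \<le> n - Suc k" for m' \<nu>
  proof -
    have "(\<exists>j. rib (Suc k) (Suc i) j (pcons m \<mu>) (pcons m' \<nu>)) \<longleftrightarrow> m = m' \<and> (\<exists>j. rib k i j \<mu> \<nu>)" (is "?L = ?R")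
    proof
      assume ?L
      then obtain j where j: "rib (Suc k) (Suc i) j (pcons m \<mu>) (pcons m' \<nu>)" by blast
      then have "Suc i \<le> j" by (simp add: rib_def)
      then obtain j' where "j = Suc j'" by (cases j) auto
      then show ?R using j rib_pcons[OF i(1)] by blast
    next
      assume ?R
      then show ?L using rib_pcons[OF i(1)] by blast
    qed
    then show ?thesis using is_ribbon_iff[OF pcons_in_parts[OF that] \<mu>'] by simp
  qed
  have S: "?S = pcons m ` ?S'"
  proof (intro equalityI subsetI)
    fix \<nu> assume \<nu>: "\<nu> \<in> ?S"
    then have "\<nu> \<in> parts n (Suc k)" by simp
    then obtain m' \<nu>' where 1: "\<nu> = pcons m' \<nu>'" "m' \<le> n - Suc k" "\<nu>' \<in> parts (m' + k) k"
      by (rule parts_Suc_cases)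
    then have m': "m = m'" and "\<exists>j. rib k i j \<mu> \<nu>'" using iff[OF 1(3,2)] \<nu> by blast+
    then have "is_ribbon k \<mu> \<nu>' \<and> head_row k \<mu> \<nu>' = i"
      using is_ribbon_iff[of \<nu>' "m + k" k \<mu> i] \<mu> 1(3) by blast
    then show "\<nu> \<in> pcons m ` ?S'" using 1 m' by blast
  next
    fix \<nu> assume "\<nu> \<in> pcons m ` ?S'"
    then obtain \<nu>' where 1: "\<nu> = pcons m \<nu>'" "\<nu>' \<in> ?S'" by blast
    then have p: "\<nu>' \<in> parts (m + k) k" by blast
    then have "\<exists>j. rib k i j \<mu> \<nu>'" using is_ribbon_iff[OF p \<mu>, of i] 1(2) by blast
    then show "\<nu> \<in> ?S" unfolding 1(1) using iff[OF p m] pcons_in_parts[OF p m] by blast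
  qed
  have inj: "inj_on (pcons m) ?S'"
  proof (rule inj_onI)
    fix \<nu> \<nu>' assume "\<nu> \<in> ?S'" "\<nu>' \<in> ?S'" "pcons m \<nu> = pcons m \<nu>'"
    then show "\<nu> = \<nu>'" using pcons_eq_iff[of \<nu> "m + k" k \<nu>' "m + k" k m m] by blast
  qed
  have w: "head_col (Suc k) (pcons m \<mu>) (pcons m \<nu>) = head_col k \<mu> \<nu>"
    "rib_ht (Suc k) (pcons m \<mu>) (pcons m \<nu>) = rib_ht k \<mu> \<nu>"
    "rib_wd (Suc k) (pcons m \<mu>) (pcons m \<nu>) = rib_wd k \<mu> \<nu>" if \<nu>S: "\<nu> \<in> ?S'" for \<nu>
  proof -
    have \<nu>: "\<nu> \<in> parts (m + k) k" using \<nu>S by simp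
    obtain j where j: "rib k i j \<mu> \<nu>" using \<nu>S is_ribbon_iff[OF \<nu> \<mu>, of i] by blast
    have j': "rib (Suc k) (Suc i) (Suc j) (pcons m \<mu>) (pcons m \<nu>)" using rib_pcons[OF i(1)] j by blast
    have ij: "i \<le> j" using j by (simp add: rib_def)
    note \<nu>' = pcons_in_parts[OF \<nu> m]
    show "head_col (Suc k) (pcons m \<mu>) (pcons m \<nu>) = head_col k \<mu> \<nu>"
      unfolding head_col_def rib_head_row[OF j \<nu>] rib_head_row[OF j' \<nu>'] using i by simp
    show "rib_ht (Suc k) (pcons m \<mu>) (pcons m \<nu>) = rib_ht k \<mu> \<nu>"
      unfolding rib_rib_ht[OF j \<nu>] rib_rib_ht[OF j' \<nu>'] by simp
    show "rib_wd (Suc k) (pcons m \<mu>) (pcons m \<nu>) = rib_wd k \<mu> \<nu>"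
      unfolding rib_rib_wd[OF j \<nu> \<mu>] rib_rib_wd[OF j' \<nu>' \<mu>'] using i ij by simp
  qed
  have "(\<Sum>\<nu>\<in>?S. (h - (p - q) * t (head_col (Suc k) (pcons m \<mu>) \<nu>)) * p ^ (rib_ht (Suc k) (pcons m \<mu>) \<nu> - 1)
      * q ^ (rib_wd (Suc k) (pcons m \<mu>) \<nu> - 1) * c \<nu>) =
    (\<Sum>\<nu>\<in>?S'. (h - (p - q) * t (head_col k \<mu> \<nu>)) * p ^ (rib_ht k \<mu> \<nu> - 1)
      * q ^ (rib_wd k \<mu> \<nu> - 1) * c (pcons m \<nu>))"
    unfolding S sum.reindex[OF inj] o_def by (intro sum.cong refl) (simp only: w)
  then show ?thesis unfolding Rco_def using i by simp
qed

text \<open>Removing the bead of row \<open>j\<close>; the rows above it slide down and gain one box each.\<close>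

definition rem_row :: "nat \<Rightarrow> nat \<Rightarrow> (nat \<Rightarrow> nat) \<Rightarrow> nat \<Rightarrow> nat" where
  "rem_row k j \<nu> = (\<lambda>i. if 1 \<le> i \<and> i \<le> k then (if i < j then Suc (\<nu> i) else \<nu> (Suc i)) else 0)"

lemma rem_row_in_parts:
  assumes \<nu>: "\<nu> \<in> parts n (Suc k)" and m: "\<nu> 1 < m" and j: "1 \<le> j" "j \<le> Suc k"
  shows "rem_row k j \<nu> \<in> parts (m + k) k"
proof -
  have le: "\<nu> b \<le> \<nu> a" if "1 \<le> a" "a \<le> b" "b \<le> Suc k" for a b
    using parts_antimono[OF \<nu>] that by blast
  show ?thesis unfolding parts_def mem_Collect_eq
  proof (intro conjI allI impI)
    fix i assume "1 \<le> i \<and> i \<le> k"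
    then show "rem_row k j \<nu> i \<le> m + k - k"
      using le[of 1 i] le[of 1 "Suc i"] m by (auto simp: rem_row_def)
  next
    fix a b assume "1 \<le> a \<and> a \<le> b \<and> b \<le> k"
    then show "rem_row k j \<nu> b \<le> rem_row k j \<nu> a"
      using le[of a b] le[of a "Suc b"] le[of "Suc a" "Suc b"] by (auto simp: rem_row_def)
  next
    fix i assume "\<not> (1 \<le> i \<and> i \<le> k)"
    then show "rem_row k j \<nu> i = 0" unfolding rem_row_def by (simp only: if_False)
  qed
qed

text \<open>Once the new first row m and the row j of the foot are chosen, the ribbon determines all
  lower rows: down to j each copies the old row above it plus one box, and beyond j nothing
  changes.\<close>

lemma rib_rem_row:
  assumes "\<nu>' \<in> parts (m + k) k" "\<nu> 1 < m" "1 \<le> j" "j \<le> Suc k"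
  shows "rib (Suc k) 1 j (pcons m \<nu>') \<nu> \<longleftrightarrow> \<nu>' = rem_row k j \<nu>"
proof
  assume r: "rib (Suc k) 1 j (pcons m \<nu>') \<nu>"
  show "\<nu>' = rem_row k j \<nu>"
  proof
    fix i
    consider "\<not> (1 \<le> i \<and> i \<le> k)" | "1 \<le> i" "i \<le> k" "i < j" | "1 \<le> i" "i \<le> k" "j \<le> i" by linarith
    then show "\<nu>' i = rem_row k j \<nu> i"
    proof cases
      case 1
      then have "\<nu>' i = 0" using assms(1) unfolding parts_def by blast
      then show ?thesis using 1 unfolding rem_row_def by (simp only: if_False)
    next
      case 2
      have "1 < Suc i \<and> Suc i \<le> j" using 2 by simp
      then have "pcons m \<nu>' (Suc i) = Suc (\<nu> (Suc i - 1))" using r unfolding rib_def by blast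
      then show ?thesis using 2 by (simp add: rem_row_def)
    next
      case 3
      have "1 \<le> Suc i \<and> Suc i \<le> Suc k \<and> (Suc i < 1 \<or> j < Suc i)" using 3 by simp
      then have "pcons m \<nu>' (Suc i) = \<nu> (Suc i)" using r unfolding rib_def by blast
      then show ?thesis using 3 by (simp add: rem_row_def)
    qed
  qed
next
  assume eq: "\<nu>' = rem_row k j \<nu>"
  show "rib (Suc k) 1 j (pcons m \<nu>') \<nu>" unfolding rib_def
  proof (intro conjI allI impI)
    show "1 \<le> (1::nat)" "1 \<le> j" "j \<le> Suc k" "\<nu> 1 < pcons m \<nu>' 1" using assms by (simp_all add: pcons_def)
  next
    fix l assume l: "1 < l \<and> l \<le> j"
    then obtain l' where l': "l = Suc l'" "1 \<le> l'" by (cases l) auto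
    then show "pcons m \<nu>' l = Suc (\<nu> (l - 1))" using l assms(4) by (simp add: eq rem_row_def)
  next
    fix l assume l: "1 \<le> l \<and> l \<le> Suc k \<and> (l < 1 \<or> j < l)"
    then obtain l' where l': "l = Suc l'" "1 \<le> l'" using assms(3) by (cases l) auto
    then show "pcons m \<nu>' l = \<nu> l" using l by (simp add: eq rem_row_def)
  qed
qed

section \<open>Ribbons in terms of beads\<close>

lemma beads_rem_row:
  assumes \<nu>: "\<nu> \<in> parts n (Suc k)" and j: "1 \<le> j" "j \<le> Suc k"
  shows "beads k (rem_row k j \<nu>) = beads (Suc k) \<nu> - {\<nu> j + Suc k + 1 - j}"
proof -
  let ?f = "\<lambda>i. \<nu> i + Suc k + 1 - i"
  have "beads k (rem_row k j \<nu>) = ?f ` ({1..Suc k} - {j})"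
  proof (intro equalityI subsetI)
    fix x assume "x \<in> beads k (rem_row k j \<nu>)"
    then obtain i where i: "1 \<le> i" "i \<le> k" "x = rem_row k j \<nu> i + k + 1 - i" by (auto simp: beads_def)
    show "x \<in> ?f ` ({1..Suc k} - {j})"
    proof (cases "i < j")
      case True
      then have "x = ?f i" "i \<in> {1..Suc k} - {j}" using i by (auto simp: rem_row_def)
      then show ?thesis by blast
    next
      case False
      then have "x = ?f (Suc i)" "Suc i \<in> {1..Suc k} - {j}" using i by (auto simp: rem_row_def)
      then show ?thesis by blast
    qed
  next
    fix x assume "x \<in> ?f ` ({1..Suc k} - {j})"
    then obtain i where "i \<in> {1..Suc k} - {j}" "x = ?f i" by blast
    then have i: "1 \<le> i" "i \<le> Suc k" "i \<noteq> j" "x = ?f i" by simp_all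
    define i' where "i' = (if i < j then i else i - 1)"
    have "i' \<in> {1..k}" "x = rem_row k j \<nu> i' + k + 1 - i'"
      using i j by (auto simp: i'_def rem_row_def)
    then show "x \<in> beads k (rem_row k j \<nu>)" unfolding beads_def by blast
  qed
  also have "\<dots> = beads (Suc k) \<nu> - {?f j}"
    unfolding beads_def using inj_on_image_set_diff[OF inj_on_bead[OF \<nu>], of "{1..Suc k}" "{j}"] j by simp
  finally show ?thesis .
qed

lemma card_beads_above:
  assumes \<nu>: "\<nu> \<in> parts n k" and j: "1 \<le> j" "j \<le> k"
  shows "card {x\<in>beads k \<nu>. \<nu> j + k + 1 - j < x} = j - 1"
proof -
  let ?f = "\<lambda>i. \<nu> i + k + 1 - i"
  have "{x\<in>beads k \<nu>. ?f j < x} = ?f ` {1..<j}"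
  proof (intro equalityI subsetI)
    fix x assume "x \<in> {x\<in>beads k \<nu>. ?f j < x}"
    then obtain i where i: "1 \<le> i" "i \<le> k" "x = ?f i" "?f j < ?f i" by (auto simp: beads_def)
    have "i < j"
    proof (rule ccontr)
      assume "\<not> i < j"
      then have "j = i \<or> j < i" by auto
      then show False using bead_less[OF \<nu> j(1), of i] i(2,4) by auto
    qed
    then show "x \<in> ?f ` {1..<j}" using i by auto
  next
    fix x assume "x \<in> ?f ` {1..<j}"
    then obtain i where i: "1 \<le> i" "i < j" "x = ?f i" by auto
    then show "x \<in> {x\<in>beads k \<nu>. ?f j < x}"
      using bead_less[OF \<nu> i(1,2) j(2)] j by (auto simp: beads_def)
  qed
  moreover have "inj_on ?f {1..<j}" by (rule inj_on_subset[OF inj_on_bead[OF \<nu>]]) (use j in auto)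
  ultimately show ?thesis using card_image[of ?f "{1..<j}"] by simp
qed

text \<open>The dictionary between ribbons and beads: a ribbon with head in row 1 and foot in row j
  moves the bead a of row j to m + k + 1. It passes the j - 1 beads above a, one for each row except
  the foot, and the unoccupied positions in between number one less than the columns.\<close>

lemma sum_ribbons_head_1:
  fixes p q :: "'f::field" and g :: "nat set \<Rightarrow> 'f"
  assumes \<nu>: "\<nu> \<in> parts n (Suc k)" and m: "\<nu> 1 < m" "m \<le> n - Suc k"
  shows "(\<Sum>\<nu>'\<in>{\<nu>'\<in>parts (m + k) k. is_ribbon (Suc k) (pcons m \<nu>') \<nu> \<and> head_row (Suc k) (pcons m \<nu>') \<nu> = 1}.
      p ^ (rib_ht (Suc k) (pcons m \<nu>') \<nu> - 1) * q ^ (rib_wd (Suc k) (pcons m \<nu>') \<nu> - 1) * g (beads k \<nu>')) =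
    (\<Sum>a\<in>beads (Suc k) \<nu>. p ^ card {x\<in>beads (Suc k) \<nu>. a < x} *
      q ^ card ({a<..<m + Suc k} - beads (Suc k) \<nu>) * g (beads (Suc k) \<nu> - {a}))"
proof -
  let ?f = "\<lambda>i. \<nu> i + Suc k + 1 - i" and ?A = "beads (Suc k) \<nu>" and ?J = "{1..Suc k}"
  let ?S = "{\<nu>'\<in>parts (m + k) k. is_ribbon (Suc k) (pcons m \<nu>') \<nu> \<and> head_row (Suc k) (pcons m \<nu>') \<nu> = 1}"
  have rp: "rem_row k j \<nu> \<in> parts (m + k) k" if "j \<in> ?J" for j
    using rem_row_in_parts[of \<nu> n k m j] \<nu> m(1) that by simp
  have rr: "rib (Suc k) 1 j (pcons m (rem_row k j \<nu>)) \<nu>" if "j \<in> ?J" for j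
    using rib_rem_row[of "rem_row k j \<nu>" m k \<nu> j] rp[OF that] m(1) that by simp
  have S: "?S = (\<lambda>j. rem_row k j \<nu>) ` ?J"
  proof (intro equalityI subsetI)
    fix \<nu>' assume "\<nu>' \<in> ?S"
    then have \<nu>': "\<nu>' \<in> parts (m + k) k" and "\<exists>j. rib (Suc k) 1 j (pcons m \<nu>') \<nu>"
      using is_ribbon_iff[OF \<nu> pcons_in_parts[OF _ m(2)], of \<nu>' 1] by blast+
    then obtain j where j: "rib (Suc k) 1 j (pcons m \<nu>') \<nu>" by blast
    then have "1 \<le> j" "j \<le> Suc k" by (auto simp: rib_def)
    then show "\<nu>' \<in> (\<lambda>j. rem_row k j \<nu>) ` ?J" using rib_rem_row[of \<nu>' m k \<nu> j] \<nu>' m(1) j by auto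
  next
    fix \<nu>' assume "\<nu>' \<in> (\<lambda>j. rem_row k j \<nu>) ` ?J"
    then obtain j where j: "j \<in> ?J" "\<nu>' = rem_row k j \<nu>" by blast
    show "\<nu>' \<in> ?S" unfolding j(2)
      using rp[OF j(1)] rr[OF j(1)] is_ribbon_iff[OF \<nu> pcons_in_parts[OF rp[OF j(1)] m(2)], of 1] by blast
  qed
  have injf: "inj_on ?f ?J" using inj_on_bead[OF \<nu>] by simp
  have inj: "inj_on (\<lambda>j. rem_row k j \<nu>) ?J"
  proof (rule inj_onI)
    fix i j assume ij: "i \<in> ?J" "j \<in> ?J" "rem_row k i \<nu> = rem_row k j \<nu>"
    have "?A - {?f i} = ?A - {?f j}"
      using beads_rem_row[OF \<nu>, of i] beads_rem_row[OF \<nu>, of j] ij by simp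
    moreover have "?f i \<in> ?A" "?f j \<in> ?A" using ij by (auto simp: beads_def)
    ultimately have "?f i = ?f j" by blast
    then show "i = j" using inj_onD[OF injf] ij by blast
  qed
  have summand: "p ^ (rib_ht (Suc k) (pcons m (rem_row k j \<nu>)) \<nu> - 1) * q ^ (rib_wd (Suc k) (pcons m (rem_row k j \<nu>)) \<nu> - 1)
       * g (beads k (rem_row k j \<nu>)) =
     p ^ card {x\<in>?A. ?f j < x} * q ^ card ({?f j<..<m + Suc k} - ?A) * g (?A - {?f j})" if j: "j \<in> ?J" for j
  proof -
    have j': "1 \<le> j" "j \<le> Suc k" using j by auto
    have ht: "rib_ht (Suc k) (pcons m (rem_row k j \<nu>)) \<nu> = j"
      using rib_rib_ht[OF rr[OF j] \<nu>] by simp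
    have wd: "rib_wd (Suc k) (pcons m (rem_row k j \<nu>)) \<nu> = m - \<nu> j"
      using rib_rib_wd[OF rr[OF j] \<nu> pcons_in_parts[OF rp[OF j] m(2)]] by simp
    have ab: "card {x\<in>?A. ?f j < x} = j - 1" using card_beads_above[OF \<nu> j'] .
    have le: "\<nu> i \<le> \<nu> 1" if "1 \<le> i" "i \<le> Suc k" for i using parts_antimono[OF \<nu>, of 1 i] that by simp
    have "x < m + Suc k" if "x \<in> ?A" for x
    proof -
      obtain i where "1 \<le> i" "i \<le> Suc k" "x = ?f i" using \<open>x \<in> ?A\<close> by (auto simp: beads_def)
      then show ?thesis using le[of i] m(1) by linarith
    qed
    then have "{?f j<..<m + Suc k} \<inter> ?A = {x\<in>?A. ?f j < x}" by auto
    then have "card ({?f j<..<m + Suc k} - ?A) = (m + Suc k - Suc (?f j)) - (j - 1)"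
      using card_Diff_subset_Int[of "{?f j<..<m + Suc k}" ?A, OF finite_Int[OF disjI1[OF finite_greaterThanLessThan]]] ab
      by (simp only: card_greaterThanLessThan)
    also have "\<dots> = m - \<nu> j - 1" using j' le[of j] m(1) by linarith
    finally show ?thesis using ht wd ab beads_rem_row[OF \<nu> j'] by simp
  qed
  have "(\<Sum>\<nu>'\<in>?S. p ^ (rib_ht (Suc k) (pcons m \<nu>') \<nu> - 1) * q ^ (rib_wd (Suc k) (pcons m \<nu>') \<nu> - 1) * g (beads k \<nu>')) =
    (\<Sum>j\<in>?J. p ^ card {x\<in>?A. ?f j < x} * q ^ card ({?f j<..<m + Suc k} - ?A) * g (?A - {?f j}))"
    unfolding S sum.reindex[OF inj] o_def using summand by (intro sum.cong refl)
  also have "\<dots> = (\<Sum>a\<in>?f ` ?J. p ^ card {x\<in>?A. a < x} * q ^ card ({a<..<m + Suc k} - ?A) * g (?A - {a}))"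
    unfolding sum.reindex[OF injf] o_def ..
  finally show ?thesis unfolding beads_def[of "Suc k" \<nu>, symmetric] .
qed

section \<open>The product of the operators 1 + z R_i\<close>

definition Rgen :: "nat \<Rightarrow> nat \<Rightarrow> 'f::field \<Rightarrow> 'f \<Rightarrow> 'f \<Rightarrow> (nat \<Rightarrow> 'f) \<Rightarrow> 'f \<Rightarrow> nat
    \<Rightarrow> ((nat \<Rightarrow> nat) \<Rightarrow> 'f) \<Rightarrow> (nat \<Rightarrow> nat) \<Rightarrow> 'f" where
  "Rgen n k p q h t z i c = (\<lambda>\<mu>. c \<mu> + z * Rco n k p q h t i c \<mu>)"

lemma Rgen_apply: "Rgen n k p q h t z i c \<mu> = c \<mu> + z * Rco n k p q h t i c \<mu>"
  by (simp add: Rgen_def)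

lemma fold_Rgen_pcons:
  assumes m: "m \<le> n - Suc k"
  shows "set xs \<subseteq> {1..k} \<Longrightarrow> \<mu> \<in> parts (m + k) k \<Longrightarrow>
    fold (Rgen n (Suc k) p q h t z) (map Suc xs) c (pcons m \<mu>)
      = fold (Rgen (m + k) k p q h t z) xs (\<lambda>\<nu>. c (pcons m \<nu>)) \<mu>"
proof (induction xs arbitrary: \<mu> rule: rev_induct)
  case (snoc i xs)
  let ?g = "fold (Rgen n (Suc k) p q h t z) (map Suc xs) c"
  let ?g' = "fold (Rgen (m + k) k p q h t z) xs (\<lambda>\<nu>. c (pcons m \<nu>))"
  have IH: "?g (pcons m \<nu>) = ?g' \<nu>" if "\<nu> \<in> parts (m + k) k" for \<nu>
    using snoc.IH snoc.prems(1) that by simp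
  have "Rco n (Suc k) p q h t (Suc i) ?g (pcons m \<mu>) = Rco (m + k) k p q h t i (\<lambda>\<nu>. ?g (pcons m \<nu>)) \<mu>"
    using snoc.prems by (intro Rco_pcons m) auto
  also have "\<dots> = Rco (m + k) k p q h t i ?g' \<mu>"
    by (rule Rco_cong[OF IH snoc.prems(2)])
  finally have R: "Rco n (Suc k) p q h t (Suc i) ?g (pcons m \<mu>) = Rco (m + k) k p q h t i ?g' \<mu>" .
  have "fold (Rgen n (Suc k) p q h t z) (map Suc (xs @ [i])) c (pcons m \<mu>)
      = ?g (pcons m \<mu>) + z * Rco n (Suc k) p q h t (Suc i) ?g (pcons m \<mu>)"
    by (subst Rgen_apply[symmetric]) simp
  also have "\<dots> = fold (Rgen (m + k) k p q h t z) (xs @ [i]) (\<lambda>\<nu>. c (pcons m \<nu>)) \<mu>"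
    unfolding R IH[OF snoc.prems(2)] by (subst Rgen_apply[symmetric]) simp
  finally show ?case .
qed simp

text \<open>The recursion of \<open>gcoef\<close> on the largest target element is the effect of 1 +
  z R_1 on the first row: either that row is kept, or it is reached by a ribbon with head in row 1.
  If the first row of \<nu> is longer than m, both sides vanish, since R_1 never shortens
  it.\<close>

lemma gcoef_beads:
  fixes p q h z :: "'f::field"
  assumes \<nu>: "\<nu> \<in> parts n (Suc k)" and m: "m \<le> n - Suc k" and \<mu>: "\<mu> \<in> parts (m + k) k"
  shows "gcoef z p q h t (Suc k) (beads (Suc k) \<nu>) (beads (Suc k) (pcons m \<mu>)) =
    (if \<nu> 1 = m then (1 + z * t (m + Suc k)) * gcoef z p q h t k (beads (Suc k) \<nu> - {m + Suc k}) (beads k \<mu>) else 0)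
    + z * (h - (p - q) * t (m + Suc k)) *
      (\<Sum>\<nu>'\<in>{\<nu>'\<in>parts (m + k) k. is_ribbon (Suc k) (pcons m \<nu>') \<nu> \<and> head_row (Suc k) (pcons m \<nu>') \<nu> = 1}.
        p ^ (rib_ht (Suc k) (pcons m \<nu>') \<nu> - 1) * q ^ (rib_wd (Suc k) (pcons m \<nu>') \<nu> - 1)
          * gcoef z p q h t k (beads k \<nu>') (beads k \<mu>))"
proof -
  define b where "b = m + Suc k"
  let ?S = "{\<nu>'\<in>parts (m + k) k. is_ribbon (Suc k) (pcons m \<nu>') \<nu> \<and> head_row (Suc k) (pcons m \<nu>') \<nu> = 1}"
  obtain l \<nu>0 where \<nu>0: "\<nu> = pcons l \<nu>0" "\<nu>0 \<in> parts (l + k) k" using \<nu> by (rule parts_Suc_cases)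
  have l: "\<nu> 1 = l" using \<nu>0 by simp
  have A: "beads (Suc k) \<nu> = insert (l + Suc k) (beads k \<nu>0)" unfolding \<nu>0 beads_pcons ..
  note lt = Max_beads_pcons(3)[OF \<nu>0(2)]
  have B: "Max (beads (Suc k) (pcons m \<mu>)) = b" "beads (Suc k) (pcons m \<mu>) - {b} = beads k \<mu>"
    unfolding beads_pcons b_def using Max_beads_pcons[OF \<mu>] by auto
  have S: "\<nu> 1 < m" if "\<nu>' \<in> ?S" for \<nu>'
  proof -
    have \<nu>': "\<nu>' \<in> parts (m + k) k" using that by blast
    obtain j where "rib (Suc k) 1 j (pcons m \<nu>') \<nu>"
      using is_ribbon_iff[OF \<nu> pcons_in_parts[OF \<nu>' m], of 1] \<open>\<nu>' \<in> ?S\<close> by blast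
    then show ?thesis by (simp add: rib_def)
  qed
  consider "l = m" | "m < l" | "l < m" by linarith
  then show ?thesis
  proof cases
    case 1
    have e: "?S = {}" using S l 1 by blast
    have "b \<in> beads (Suc k) \<nu>" "\<forall>a\<in>beads (Suc k) \<nu>. a \<le> b"
      unfolding A using lt 1 by (auto simp: b_def)
    then show ?thesis unfolding gcoef.simps B b_def[symmetric] e sum.empty using l 1 by (simp del: One_nat_def)
  next
    case 2
    have e: "?S = {}" using S l 2 by fastforce
    have nle: "(\<forall>a\<in>beads (Suc k) \<nu>. a \<le> b) = False" "(\<forall>a\<in>beads (Suc k) \<nu>. a < b) = False"
      unfolding A using 2 by (auto simp: b_def)
    have "gcoef z p q h t (Suc k) (beads (Suc k) \<nu>) (beads (Suc k) (pcons m \<mu>)) = 0"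
      unfolding gcoef.simps B nle by (simp only: if_False if_cancel)
    then show ?thesis unfolding e sum.empty using l 2 by (simp del: One_nat_def gcoef.simps)
  next
    case 3
    have "\<forall>a\<in>beads (Suc k) \<nu>. a < b" unfolding A using lt 3 by (auto simp: b_def)
    moreover from this have "b \<notin> beads (Suc k) \<nu>" by blast
    ultimately have "gcoef z p q h t (Suc k) (beads (Suc k) \<nu>) (beads (Suc k) (pcons m \<mu>)) =
      z * (h - (p - q) * t b) * (\<Sum>a\<in>beads (Suc k) \<nu>. p ^ card {x \<in> beads (Suc k) \<nu>. a < x} *
        q ^ card ({a<..<b} - beads (Suc k) \<nu>) * gcoef z p q h t k (beads (Suc k) \<nu> - {a}) (beads k \<mu>))"
      unfolding gcoef.simps B by simp
    then show ?thesis
      using sum_ribbons_head_1[OF \<nu> _ m, of p q "\<lambda>A. gcoef z p q h t k A (beads k \<mu>)"] l 3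
      unfolding b_def by simp
  qed
qed

text \<open>R_1 is applied first and no later factor changes the first row. So the first row m of
  the target can be split off after R_1, the other factors act on the lower rows in the box of width
  m, and induction on k applies to them.\<close>

lemma fold_Rgen:
  fixes p q h z :: "'f::field"
  shows "k \<le> n \<Longrightarrow> \<mu> \<in> parts n k \<Longrightarrow>
    fold (Rgen n k p q h t z) [1..<Suc k] c \<mu> =
      (\<Sum>\<nu>\<in>parts n k. c \<nu> * gcoef z p q h t k (beads k \<nu>) (beads k \<mu>))"
proof (induction k arbitrary: n \<mu> c)
  case 0
  then show ?case by (simp add: parts_0)
next
  case (Suc k)
  obtain m \<mu>' where \<mu>': "\<mu> = pcons m \<mu>'" and m: "m \<le> n - Suc k" and \<mu>p: "\<mu>' \<in> parts (m + k) k"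
    using Suc.prems(2) by (rule parts_Suc_cases)
  define f where "f = Rgen n (Suc k) p q h t z 1 c"
  define b where "b = m + Suc k"
  define g where "g A = gcoef z p q h t k A (beads k \<mu>')" for A
  let ?P = "parts n (Suc k)" and ?P' = "parts (m + k) k"
  let ?rib = "\<lambda>\<nu>' \<nu>. is_ribbon (Suc k) (pcons m \<nu>') \<nu> \<and> head_row (Suc k) (pcons m \<nu>') \<nu> = 1"
  let ?w = "\<lambda>\<nu>' \<nu>. p ^ (rib_ht (Suc k) (pcons m \<nu>') \<nu> - 1) * q ^ (rib_wd (Suc k) (pcons m \<nu>') \<nu> - 1)"
  have up: "[1..<Suc (Suc k)] = 1 # map Suc [1..<Suc k]"
    by (simp add: map_Suc_upt upt_conv_Cons del: upt_Suc)
  have "fold (Rgen n (Suc k) p q h t z) [1..<Suc (Suc k)] c \<mu> =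
      fold (Rgen n (Suc k) p q h t z) (map Suc [1..<Suc k]) f (pcons m \<mu>')"
    unfolding up \<mu>' f_def by (simp del: upt_Suc)
  also have "\<dots> = fold (Rgen (m + k) k p q h t z) [1..<Suc k] (\<lambda>\<nu>. f (pcons m \<nu>)) \<mu>'"
    using m \<mu>p by (intro fold_Rgen_pcons) auto
  also have "\<dots> = (\<Sum>\<nu>'\<in>?P'. f (pcons m \<nu>') * g (beads k \<nu>'))"
    unfolding g_def using \<mu>p by (intro Suc.IH) auto
  also have "\<dots> = (\<Sum>\<nu>'\<in>?P'. (1 + z * t b) * c (pcons m \<nu>') * g (beads k \<nu>')
      + (\<Sum>\<nu> | \<nu> \<in> ?P \<and> ?rib \<nu>' \<nu>. z * (h - (p - q) * t b) * ?w \<nu>' \<nu> * c \<nu> * g (beads k \<nu>')))"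
  proof (intro sum.cong refl)
    fix \<nu>' assume \<nu>': "\<nu>' \<in> ?P'"
    have "f (pcons m \<nu>') = c (pcons m \<nu>') + z * (t b * c (pcons m \<nu>')
       + (\<Sum>\<nu> | \<nu> \<in> ?P \<and> ?rib \<nu>' \<nu>. (h - (p - q) * t (head_col (Suc k) (pcons m \<nu>') \<nu>)) *
          p ^ (rib_ht (Suc k) (pcons m \<nu>') \<nu> - 1) * q ^ (rib_wd (Suc k) (pcons m \<nu>') \<nu> - 1) * c \<nu>))"
      unfolding f_def Rgen_def Rco_def b_def by simp
    also have "(\<Sum>\<nu> | \<nu> \<in> ?P \<and> ?rib \<nu>' \<nu>. (h - (p - q) * t (head_col (Suc k) (pcons m \<nu>') \<nu>)) *
          p ^ (rib_ht (Suc k) (pcons m \<nu>') \<nu> - 1) * q ^ (rib_wd (Suc k) (pcons m \<nu>') \<nu> - 1) * c \<nu>) =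
        (\<Sum>\<nu> | \<nu> \<in> ?P \<and> ?rib \<nu>' \<nu>. (h - (p - q) * t b) * ?w \<nu>' \<nu> * c \<nu>)"
      by (intro sum.cong refl) (simp add: head_col_def b_def)
    finally show "f (pcons m \<nu>') * g (beads k \<nu>') = (1 + z * t b) * c (pcons m \<nu>') * g (beads k \<nu>')
      + (\<Sum>\<nu> | \<nu> \<in> ?P \<and> ?rib \<nu>' \<nu>. z * (h - (p - q) * t b) * ?w \<nu>' \<nu> * c \<nu> * g (beads k \<nu>'))"
      by (simp only: distrib_right distrib_left sum_distrib_left sum_distrib_right mult.assoc mult_1_left add.assoc)
  qed
  \<comment> \<open>Exchanging the sums makes the intermediate partition \<nu>' the inner variable
    for a fixed source \<nu>, the form in which \<open>gcoef_beads\<close> applies.\<close>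
  also have "\<dots> = (\<Sum>\<nu>'\<in>?P'. (1 + z * t b) * c (pcons m \<nu>') * g (beads k \<nu>'))
      + (\<Sum>\<nu>\<in>?P. \<Sum>\<nu>' | \<nu>' \<in> ?P' \<and> ?rib \<nu>' \<nu>. z * (h - (p - q) * t b) * ?w \<nu>' \<nu> * c \<nu> * g (beads k \<nu>'))"
    unfolding sum.distrib by (subst sum.swap_restrict[OF finite_parts finite_parts]) simp
  also have "(\<Sum>\<nu>'\<in>?P'. (1 + z * t b) * c (pcons m \<nu>') * g (beads k \<nu>')) =
      (\<Sum>\<nu>\<in>?P. if \<nu> 1 = m then (1 + z * t b) * c \<nu> * g (beads (Suc k) \<nu> - {b}) else 0)"
  proof -
    have im: "{\<nu> \<in> ?P. \<nu> 1 = m} = pcons m ` ?P'"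
    proof (intro equalityI subsetI)
      fix \<nu> assume "\<nu> \<in> {\<nu> \<in> ?P. \<nu> 1 = m}"
      then have \<nu>: "\<nu> \<in> ?P" "\<nu> 1 = m" by auto
      obtain l \<nu>0 where "\<nu> = pcons l \<nu>0" "\<nu>0 \<in> parts (l + k) k" using \<nu>(1) by (rule parts_Suc_cases)
      then show "\<nu> \<in> pcons m ` ?P'" using \<nu>(2) by auto
    next
      fix \<nu> assume "\<nu> \<in> pcons m ` ?P'"
      then obtain \<nu>' where "\<nu> = pcons m \<nu>'" "\<nu>' \<in> ?P'" by blast
      then show "\<nu> \<in> {\<nu> \<in> ?P. \<nu> 1 = m}" using pcons_in_parts[OF _ m] by simp
    qed
    have inj: "inj_on (pcons m) ?P'"
    proof (rule inj_onI)
      fix \<nu> \<nu>' assume "\<nu> \<in> ?P'" "\<nu>' \<in> ?P'" "pcons m \<nu> = pcons m \<nu>'"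
      then show "\<nu> = \<nu>'" using pcons_eq_iff[of \<nu> "m + k" k \<nu>' "m + k" k m m] by blast
    qed
    have "(\<Sum>\<nu>\<in>?P. if \<nu> 1 = m then (1 + z * t b) * c \<nu> * g (beads (Suc k) \<nu> - {b}) else 0) =
       (\<Sum>\<nu>\<in>pcons m ` ?P'. (1 + z * t b) * c \<nu> * g (beads (Suc k) \<nu> - {b}))"
      unfolding im[symmetric] by (rule sum.inter_filter[OF finite_parts, symmetric])
    also have "\<dots> = (\<Sum>\<nu>'\<in>?P'. (1 + z * t b) * c (pcons m \<nu>') * g (beads (Suc k) (pcons m \<nu>') - {b}))"
      unfolding sum.reindex[OF inj] o_def ..
    also have "\<dots> = (\<Sum>\<nu>'\<in>?P'. (1 + z * t b) * c (pcons m \<nu>') * g (beads k \<nu>'))"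
    proof (intro sum.cong refl)
      fix \<nu>' assume "\<nu>' \<in> ?P'"
      then have "beads (Suc k) (pcons m \<nu>') - {b} = beads k \<nu>'"
        unfolding beads_pcons b_def using Max_beads_pcons(2)[of \<nu>' m k] by simp
      then show "(1 + z * t b) * c (pcons m \<nu>') * g (beads (Suc k) (pcons m \<nu>') - {b}) =
         (1 + z * t b) * c (pcons m \<nu>') * g (beads k \<nu>')" by simp
    qed
    finally show ?thesis by simp
  qed
  also have "(\<Sum>\<nu>\<in>?P. if \<nu> 1 = m then (1 + z * t b) * c \<nu> * g (beads (Suc k) \<nu> - {b}) else 0)
      + (\<Sum>\<nu>\<in>?P. \<Sum>\<nu>' | \<nu>' \<in> ?P' \<and> ?rib \<nu>' \<nu>. z * (h - (p - q) * t b) * ?w \<nu>' \<nu> * c \<nu> * g (beads k \<nu>')) =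
     (\<Sum>\<nu>\<in>?P. c \<nu> * gcoef z p q h t (Suc k) (beads (Suc k) \<nu>) (beads (Suc k) \<mu>))"
    unfolding sum.distrib[symmetric]
  proof (intro sum.cong refl)
    fix \<nu> assume \<nu>: "\<nu> \<in> ?P"
    define Q where "Q = (\<Sum>\<nu>' | \<nu>' \<in> ?P' \<and> ?rib \<nu>' \<nu>. ?w \<nu>' \<nu> * g (beads k \<nu>'))"
    have E: "(\<Sum>\<nu>' | \<nu>' \<in> ?P' \<and> ?rib \<nu>' \<nu>. z * (h - (p - q) * t b) * ?w \<nu>' \<nu> * c \<nu> * g (beads k \<nu>')) =
      c \<nu> * (z * (h - (p - q) * t b) * Q)"
      unfolding Q_def sum_distrib_left by (intro sum.cong refl) (simp only: ac_simps)
    show "(if \<nu> 1 = m then (1 + z * t b) * c \<nu> * g (beads (Suc k) \<nu> - {b}) else 0)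
      + (\<Sum>\<nu>' | \<nu>' \<in> ?P' \<and> ?rib \<nu>' \<nu>. z * (h - (p - q) * t b) * ?w \<nu>' \<nu> * c \<nu> * g (beads k \<nu>')) =
      c \<nu> * gcoef z p q h t (Suc k) (beads (Suc k) \<nu>) (beads (Suc k) \<mu>)"
      unfolding E \<mu>' gcoef_beads[OF \<nu> m \<mu>p] g_def[symmetric] b_def[symmetric] Q_def[symmetric]
      by (simp add: algebra_simps)
  qed
  finally show ?case .
qed

subsection \<open>Expansion over subsets\<close>

lemma sum_Pow_insert_Suc:
  "(\<Sum>S\<in>Pow {1..Suc k}. f S) = (\<Sum>S\<in>Pow {1..k}. f S) + (\<Sum>S\<in>Pow {1..k}. f (insert (Suc k) S))"
proof -
  have "{1..Suc k} = insert (Suc k) {1..k}" by auto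
  then have "Pow {1..Suc k} = Pow {1..k} \<union> insert (Suc k) ` Pow {1..k}" by (simp only: Pow_insert)
  moreover have "Pow {1..k} \<inter> insert (Suc k) ` Pow {1..k} = {}" by auto
  moreover have "inj_on (insert (Suc k)) (Pow {1..k})"
  proof (rule inj_onI)
    fix S S' assume "S \<in> Pow {1..k}" "S' \<in> Pow {1..k}" "insert (Suc k) S = insert (Suc k) S'"
    moreover from this have "Suc k \<notin> S" "Suc k \<notin> S'" by auto
    ultimately show "S = S'" by (metis insert_ident)
  qed
  ultimately show ?thesis by (simp add: sum.union_disjoint sum.reindex)
qed

lemma sorted_list_of_set_insert_Suc:
  assumes "S \<subseteq> {1..k}"
  shows "sorted_list_of_set (insert (Suc k) S) = sorted_list_of_set S @ [Suc k]"
proof (rule sorted_distinct_set_unique)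
  have fin: "finite S" using assms finite_subset by blast
  have lt: "\<forall>x\<in>S. x < Suc k" using assms by auto
  show "sorted (sorted_list_of_set S @ [Suc k])" "distinct (sorted_list_of_set S @ [Suc k])"
    using fin lt by (auto simp: sorted_append)
  show "set (sorted_list_of_set (insert (Suc k) S)) = set (sorted_list_of_set S @ [Suc k])"
    using fin set_sorted_list_of_set[of "insert (Suc k) S"] by (simp del: sorted_list_of_set_insert_remove)
qed (simp_all del: sorted_list_of_set_insert_remove)

text \<open>Stated over any commutative monoid because it serves twice: for x_i acting on vectors
  and for R_i acting on coefficient functions. Increasing lists give the order
  \<open>G_{i_r} ... G_{i_1}\<close>.\<close>

lemma fold_one_plus:
  fixes G :: "nat \<Rightarrow> 'v::comm_monoid_add \<Rightarrow> 'v"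
  assumes "\<And>i u v. 1 \<le> i \<Longrightarrow> i \<le> k \<Longrightarrow> G i (u + v) = G i u + G i v"
    and "\<And>i. 1 \<le> i \<Longrightarrow> i \<le> k \<Longrightarrow> G i 0 = 0"
  shows "fold (\<lambda>i v. v + G i v) [1..<Suc k] v = (\<Sum>S\<in>Pow {1..k}. fold G (sorted_list_of_set S) v)"
  using assms
proof (induction k)
  case (Suc k)
  have Gsum: "G (Suc k) (sum f A) = (\<Sum>x\<in>A. G (Suc k) (f x))" for f and A :: "nat set set"
    by (induction A rule: infinite_finite_induct) (use Suc.prems in auto)
  have "(\<Sum>S\<in>Pow {1..k}. fold G (sorted_list_of_set (insert (Suc k) S)) v) =
      (\<Sum>S\<in>Pow {1..k}. G (Suc k) (fold G (sorted_list_of_set S) v))"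
    by (intro sum.cong refl) (simp add: sorted_list_of_set_insert_Suc)
  then show ?case using Suc unfolding sum_Pow_insert_Suc by (simp add: Gsum)
qed simp

lemma (in vector_space) fold_scaled:
  assumes "\<And>i a v. i \<in> set xs \<Longrightarrow> G i (scale a v) = scale a (G i v)"
  shows "fold (\<lambda>i v. scale z (G i v)) xs v = scale (z ^ length xs) (fold G xs v)"
  using assms by (induction xs rule: rev_induct) (auto simp: mult.commute)

lemma sum_Pow_by_card:
  fixes f :: "nat set \<Rightarrow> 'v::comm_monoid_add"
  shows "(\<Sum>S\<in>Pow {1..k}. f S) = (\<Sum>r\<le>k. \<Sum>S\<in>{S. S \<subseteq> {1..k} \<and> card S = r}. f S)"
proof -
  have "card ` Pow {1..k} \<subseteq> {..k}"
  proof
    fix r assume "r \<in> card ` Pow {1..k}"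
    then obtain S where "r = card S" "S \<subseteq> {1..k}" by auto
    then show "r \<in> {..k}" using card_mono[of "{1..k}" S] by simp
  qed
  then have "(\<Sum>S\<in>Pow {1..k}. f S) = (\<Sum>r\<le>k. \<Sum>S\<in>{S \<in> Pow {1..k}. card S = r}. f S)"
    by (intro sum.group[symmetric]) auto
  then show ?thesis by simp
qed

text \<open>Eliminating the top coefficient from \<open>f(2z) - 2\<^sup>k f(z)\<close>.\<close>

lemma vector_poly_eq_0:
  fixes scale :: "'f::field_char_0 \<Rightarrow> 'v::ab_group_add \<Rightarrow> 'v"
  assumes vs: "vector_space scale"
  shows "(\<And>z. (\<Sum>r\<le>k. scale (z ^ r) (a r)) = 0) \<Longrightarrow> r \<le> k \<Longrightarrow> a r = 0"
proof (induction k arbitrary: a r)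
  interpret vector_space scale by fact
  case 0
  then show ?case using 0(1)[of 1] by simp
next
  interpret vector_space scale by fact
  case (Suc k)
  have "(\<Sum>r\<le>k. scale (z ^ r) (scale (2 ^ r - 2 ^ Suc k) (a r))) = 0" for z
  proof -
    have "(\<Sum>r\<le>Suc k. scale ((2 * z) ^ r) (a r)) - scale (2 ^ Suc k) (\<Sum>r\<le>Suc k. scale (z ^ r) (a r)) = 0"
      unfolding Suc.prems(1) by simp
    then have "(\<Sum>r\<le>Suc k. scale (z ^ r) (scale (2 ^ r - 2 ^ Suc k) (a r))) = 0"
      unfolding scale_sum_right sum_subtractf[symmetric]
      by (simp only: power_mult_distrib scale_scale scale_left_diff_distrib[symmetric] right_diff_distrib mult.commute)
    then show ?thesis by simp
  qed
  then have z: "scale (2 ^ r - 2 ^ Suc k) (a r) = 0" if "r \<le> k" for r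
    using Suc.IH[of "\<lambda>r. scale (2 ^ r - 2 ^ Suc k) (a r)" r] that by simp
  have ak: "a r = 0" if "r \<le> k" for r
  proof -
    have "(2::nat) ^ r \<noteq> 2 ^ Suc k" using that by (simp add: power_inject_exp del: power_Suc)
    then have "of_nat (2 ^ r) \<noteq> (of_nat (2 ^ Suc k) :: 'f)" using of_nat_eq_iff by blast
    then have "(2::'f) ^ r - 2 ^ Suc k \<noteq> 0" by simp
    then show ?thesis using z[OF that] by (metis scale_eq_0_iff)
  qed
  moreover have "a (Suc k) = 0"
    using Suc.prems(1)[of 1] ak by simp
  ultimately show ?case using Suc.prems(2) by (cases "r = Suc k") auto
qed

subsection \<open>Permutations as words\<close>

definition word_fun :: "nat list \<Rightarrow> nat \<Rightarrow> nat" where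
  "word_fun xs = (\<lambda>i. if 1 \<le> i \<and> i \<le> length xs then xs ! (i - 1) else i)"

lemma word_fun_permutes:
  assumes "xs \<in> permutations_of_set {1..n}"
  shows "word_fun xs permutes {1..n}"
proof -
  have xs: "set xs = {1..n}" "distinct xs" "length xs = n"
    using assms length_finite_permutations_of_set[OF assms] by (auto dest: permutations_of_setD)
  have eq: "{1..n} = Suc ` {..<n}" by (simp add: image_Suc_lessThan)
  have "bij_betw (word_fun xs) {1..n} {1..n}"
  proof (rule bij_betw_imageI)
    show "inj_on (word_fun xs) {1..n}"
      using xs by (auto simp: inj_on_def word_fun_def nth_eq_iff_index_eq)
    have "word_fun xs ` {1..n} = (\<lambda>i. xs ! i) ` {..<n}"
      unfolding eq image_image using xs by (intro image_cong) (auto simp: word_fun_def)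
    also have "\<dots> = set xs" using xs(3) by (auto simp: set_conv_nth)
    finally show "word_fun xs ` {1..n} = {1..n}" using xs by simp
  qed
  then show ?thesis by (rule bij_imp_permutes) (use xs in \<open>auto simp: word_fun_def\<close>)
qed

lemma word_fun_map:
  assumes "u permutes {1..n}"
  shows "word_fun (map u [1..<Suc n]) = u"
proof
  fix i
  show "word_fun (map u [1..<Suc n]) i = u i"
  proof (cases "i \<in> {1..n}")
    case True
    then obtain j where "i = Suc j" "j < n" by (cases i) auto
    then show ?thesis by (simp add: word_fun_def del: upt_Suc)
  next
    case False
    then have "u i = i" using assms by (simp add: permutes_def)
    then show ?thesis using False by (auto simp: word_fun_def simp del: upt_Suc)
  qed
qed

lemma map_word_fun: "length xs = n \<Longrightarrow> map (word_fun xs) [1..<Suc n] = xs"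
  by (rule nth_equalityI) (auto simp: word_fun_def simp del: upt_Suc)

lemma word_fun_swap:
  "word_fun (us @ a # b # vs) \<circ> sref (Suc (length us)) = word_fun (us @ b # a # vs)"
proof
  fix i
  consider "i < Suc (length us)" | "i = Suc (length us)" | "i = Suc (Suc (length us))" | "Suc (Suc (length us)) < i"
    by linarith
  then show "(word_fun (us @ a # b # vs) \<circ> sref (Suc (length us))) i = word_fun (us @ b # a # vs) i"
  proof cases
    case 1
    then show ?thesis by (cases i) (simp_all add: word_fun_def sref_apply nth_append)
  next
    case 2
    then show ?thesis by (simp add: word_fun_def sref_apply nth_append)
  next
    case 3
    then show ?thesis by (simp add: word_fun_def sref_apply nth_append)
  next
    case 4
    define j where "j = i - (length us + 3)"
    have "i = Suc (length us + Suc (Suc j))" using 4 by (simp add: j_def)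
    then show ?thesis by (simp add: word_fun_def sref_apply nth_append)
  qed
qed

lemma word_fun_head_word: "word_fun (head_word n n) = longest n"
proof
  fix i
  show "word_fun (head_word n n) i = longest n i"
    by (auto simp: word_fun_def longest_def head_word_def rev_nth simp del: upt_Suc)
qed

section \<open>Inversions and the permutations \<open>w_nu v\<close>\<close>

lemma inv_list_map_upt:
  "inv_list (map f [a..<b]) = card {(i, j). a \<le> i \<and> i < j \<and> j < b \<and> f j < f i}"
proof (induction b)
  case 0
  have "{(i, j). a \<le> i \<and> i < j \<and> j < 0 \<and> f j < f i} = {}" by auto
  then show ?case by (simp only: upt_0 list.map inv_list.simps card.empty)
next
  case (Suc b)
  let ?P = "\<lambda>b. {(i, j). a \<le> i \<and> i < j \<and> j < b \<and> f j < f i}"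
  show ?case
  proof (cases "a \<le> b")
    case True
    have "?P (Suc b) = ?P b \<union> (\<lambda>i. (i, b)) ` {i \<in> {a..<b}. f b < f i}"
      by (auto simp: less_Suc_eq)
    moreover have "finite (?P b)" by (rule finite_subset[of _ "{..<b} \<times> {..<b}"]) auto
    moreover have "?P b \<inter> (\<lambda>i. (i, b)) ` {i \<in> {a..<b}. f b < f i} = {}" by auto
    moreover have "card ((\<lambda>i. (i, b)) ` {i \<in> {a..<b}. f b < f i}) = card {i \<in> {a..<b}. f b < f i}"
      by (rule card_image) (auto simp: inj_on_def)
    ultimately have "card (?P (Suc b)) = card (?P b) + card {i \<in> {a..<b}. f b < f i}"
      by (simp add: card_Un_disjoint)
    moreover have "length (filter (\<lambda>x. f b < x) (map f [a..<b])) = card {i \<in> {a..<b}. f b < f i}"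
      by (simp add: filter_map comp_def length_filter_distinct)
    ultimately show ?thesis using True Suc by (simp add: inv_list_snoc)
  next
    case False
    then have "?P (Suc b) = {}" by auto
    then have "card (?P (Suc b)) = 0" by (simp only: card.empty)
    then show ?thesis using False by simp
  qed
qed

lemma wpart_facts:
  assumes \<nu>: "\<nu> \<in> parts n k" and k: "k \<le> n"
  shows wpart_permutes: "wpart n k \<nu> permutes {1..n}"
    and wpart_image: "wpart n k \<nu> ` {1..k} = beads k \<nu>"
    and wpart_mono_left: "\<And>i j. 1 \<le> i \<Longrightarrow> i < j \<Longrightarrow> j \<le> k \<Longrightarrow> wpart n k \<nu> i < wpart n k \<nu> j"
    and wpart_mono_right: "\<And>i j. k < i \<Longrightarrow> i < j \<Longrightarrow> j \<le> n \<Longrightarrow> wpart n k \<nu> i < wpart n k \<nu> j"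
proof -
  define R where "R = {1..n} - beads k \<nu>"
  define rs where "rs = sorted_list_of_set R"
  let ?w = "wpart n k \<nu>"
  have B: "beads k \<nu> \<subseteq> {1..n}" "card (beads k \<nu>) = k" "finite (beads k \<nu>)"
    using beads_in_ksubsets[OF assms] ksubsets_finite[OF beads_in_ksubsets[OF assms]] by (auto simp: ksubsets_def)
  have finR: "finite R" by (simp add: R_def)
  have rs: "set rs = R" "distinct rs" "length rs = n - k" "sorted rs"
    using finR B by (auto simp: rs_def R_def card_Diff_subset)
  have left: "?w j = \<nu> (k + 1 - j) + j" if "1 \<le> j" "j \<le> k" for j using that by (simp add: wpart_def)
  have right: "?w j = rs ! (j - k - 1)" if "k < j" "j \<le> n" for j
    using that by (simp add: wpart_def rs_def R_def beads_def)
  show ml: "?w i < ?w j" if "1 \<le> i" "i < j" "j \<le> k" for i j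
  proof -
    have "\<nu> (k + 1 - i) \<le> \<nu> (k + 1 - j)" using that by (intro parts_antimono[OF \<nu>]) auto
    then show ?thesis using that by (simp add: left)
  qed
  show mr: "?w i < ?w j" if "k < i" "i < j" "j \<le> n" for i j
  proof -
    have lt: "i - k - 1 < j - k - 1" "j - k - 1 < length rs" using that rs(3) by auto
    then have "rs ! (i - k - 1) \<le> rs ! (j - k - 1)" using rs(4) by (simp add: sorted_nth_mono)
    moreover have "rs ! (i - k - 1) \<noteq> rs ! (j - k - 1)" using lt rs(2) by (simp add: nth_eq_iff_index_eq)
    ultimately show ?thesis using that by (simp add: right)
  qed
  show im: "?w ` {1..k} = beads k \<nu>"
  proof -
    have "?w ` {1..k} = (\<lambda>j. \<nu> (k + 1 - j) + k + 1 - (k + 1 - j)) ` {1..k}"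
      by (intro image_cong) (auto simp: left)
    also have "\<dots> = (\<lambda>i. \<nu> i + k + 1 - i) ` ((\<lambda>j. k + 1 - j) ` {1..k})"
      unfolding image_image ..
    also have "(\<lambda>j. k + 1 - j) ` {1..k} = {1..k}"
    proof (intro equalityI subsetI)
      fix x assume "x \<in> {1..k}"
      then have "x = k + 1 - (k + 1 - x)" "k + 1 - x \<in> {1..k}" by auto
      then show "x \<in> (\<lambda>j. k + 1 - j) ` {1..k}" by blast
    qed auto
    finally show ?thesis by (simp add: beads_def)
  qed
  have imr: "?w ` {Suc k..n} = R"
  proof -
    have "?w ` {Suc k..n} = (\<lambda>j. rs ! (j - k - 1)) ` {Suc k..n}"
      by (intro image_cong) (auto simp: right)
    also have "\<dots> = (\<lambda>i. rs ! i) ` ((\<lambda>j. j - k - 1) ` {Suc k..n})" unfolding image_image ..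
    also have "(\<lambda>j. j - k - 1) ` {Suc k..n} = {..<length rs}"
    proof (intro equalityI subsetI)
      fix x assume "x \<in> {..<length rs}"
      then have "x = (x + Suc k) - k - 1" "x + Suc k \<in> {Suc k..n}" using rs(3) by auto
      then show "x \<in> (\<lambda>j. j - k - 1) ` {Suc k..n}" by blast
    qed (use rs(3) in auto)
    also have "(\<lambda>i. rs ! i) ` {..<length rs} = set rs" by (auto simp: set_conv_nth)
    finally show ?thesis using rs(1) by simp
  qed
  have un: "{1..n} = {1..k} \<union> {Suc k..n}" using k by auto
  have "?w ` {1..n} = {1..n}" unfolding un image_Un im imr using B(1) un by (auto simp: R_def)
  moreover from this have "inj_on ?w {1..n}" by (intro eq_card_imp_inj_on) auto
  ultimately have "bij_betw ?w {1..n} {1..n}" by (simp add: bij_betw_def)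
  then show "?w permutes {1..n}" by (rule bij_imp_permutes) (use k in \<open>auto simp: wpart_def\<close>)
qed

lemma young_right:
  assumes "v \<in> Sk_young n k" "k < i" "i \<le> n" "k \<le> n"
  shows "k < v i \<and> v i \<le> n"
proof -
  have v: "v permutes {1..n}" "v ` {1..k} = {1..k}" using assms by (auto simp: Sk_young_def)
  have "v i \<in> {1..n}" using permutes_in_image[OF v(1)] assms by simp
  moreover have "v i \<notin> {1..k}"
  proof
    assume "v i \<in> {1..k}"
    then obtain j where j: "j \<in> {1..k}" "v j = v i" using v(2) by (metis imageE)
    then have "j = i" using injD[OF permutes_inj[OF v(1)]] by blast
    then show False using j assms by simp
  qed
  ultimately show ?thesis by auto
qed

lemma young_left:
  assumes "v \<in> Sk_young n k" "1 \<le> i" "i \<le> k"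
  shows "1 \<le> v i \<and> v i \<le> k"
proof -
  have "v ` {1..k} = {1..k}" "i \<in> {1..k}" using assms by (auto simp: Sk_young_def)
  then have "v i \<in> {1..k}" by blast
  then show ?thesis by simp
qed

text \<open>As \<open>w\<close> is increasing on each block, \<open>w \<circ> v\<close> and
  \<open>v\<close> have the same inversions inside a block, and \<open>v\<close> has none across the
  blocks because it preserves them. So the exponent of p in Y_nu is the sum of the inversion numbers
  of the two parts of the word.\<close>

lemma perm_len_young:
  assumes v: "v \<in> Sk_young n k" and k: "k \<le> n"
    and l: "\<And>i j. 1 \<le> i \<Longrightarrow> i < j \<Longrightarrow> j \<le> k \<Longrightarrow> w i < w j"
    and r: "\<And>i j. k < i \<Longrightarrow> i < j \<Longrightarrow> j \<le> n \<Longrightarrow> w i < w j"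
  shows "perm_len n v = inv_list (map (w \<circ> v) [1..<Suc k]) + inv_list (map (w \<circ> v) [Suc k..<Suc n])"
proof -
  let ?L = "{(i, j). 1 \<le> i \<and> i < j \<and> j < Suc k \<and> (w \<circ> v) j < (w \<circ> v) i}"
  let ?R = "{(i, j). Suc k \<le> i \<and> i < j \<and> j < Suc n \<and> (w \<circ> v) j < (w \<circ> v) i}"
  have vp: "v permutes {1..n}" using v by (simp add: Sk_young_def)
  have neq: "v i \<noteq> v j" if "i < j" for i j using injD[OF permutes_inj[OF vp], of i j] that by blast
  have L: "w (v j) < w (v i) \<longleftrightarrow> v j < v i" if "1 \<le> i" "i < j" "j \<le> k" for i j
  proof -
    have "1 \<le> v i" "v i \<le> k" "1 \<le> v j" "v j \<le> k"
      using young_left[OF v, of i] young_left[OF v, of j] that by simp_all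
    then have "v i < v j \<Longrightarrow> w (v i) < w (v j)" "v j < v i \<Longrightarrow> w (v j) < w (v i)"
      using l by blast+
    then show ?thesis using neq[OF that(2)] by linarith
  qed
  have R: "w (v j) < w (v i) \<longleftrightarrow> v j < v i" if "k < i" "i < j" "j \<le> n" for i j
  proof -
    have "k < v i" "v i \<le> n" "k < v j" "v j \<le> n"
      using young_right[OF v _ _ k, of i] young_right[OF v _ _ k, of j] that by simp_all
    then have "v i < v j \<Longrightarrow> w (v i) < w (v j)" "v j < v i \<Longrightarrow> w (v j) < w (v i)"
      using r by blast+
    then show ?thesis using neq[OF that(2)] by linarith
  qed
  have cross: "v i < v j" if "1 \<le> i" "i \<le> k" "k < j" "j \<le> n" for i j
    using young_left[OF v that(1,2)] young_right[OF v that(3,4) k] by simp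
  have "inversions n v = ?L \<union> ?R"
  proof (intro set_eqI)
    fix x :: "nat \<times> nat"
    obtain i j where x: "x = (i, j)" by force
    consider "j \<le> k" | "i \<le> k" "k < j" | "k < i" "k < j" | "j \<le> i" by linarith
    then show "x \<in> inversions n v \<longleftrightarrow> x \<in> ?L \<union> ?R"
    proof cases
      case 1
      have "x \<in> inversions n v \<longleftrightarrow> 1 \<le> i \<and> i < j \<and> v j < v i"
        using 1 k by (simp add: x inversions_def)
      also have "\<dots> \<longleftrightarrow> 1 \<le> i \<and> i < j \<and> w (v j) < w (v i)" using L[OF _ _ 1] by blast
      also have "\<dots> \<longleftrightarrow> x \<in> ?L \<union> ?R"
      proof -
        have "x \<notin> ?R" using 1 by (auto simp: x)
        moreover have "x \<in> ?L \<longleftrightarrow> 1 \<le> i \<and> i < j \<and> w (v j) < w (v i)"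
          using 1 by (simp add: x less_Suc_eq_le)
        ultimately show ?thesis by blast
      qed
      finally show ?thesis .
    next
      case 2
      have "\<not> v j < v i" if "1 \<le> i" "j \<le> n" using cross[OF that(1) 2 that(2)] by simp
      then have "x \<notin> inversions n v" unfolding x inversions_def by blast
      then show ?thesis using 2 by (simp add: x)
    next
      case 3
      have "x \<in> inversions n v \<longleftrightarrow> i < j \<and> j \<le> n \<and> v j < v i"
        using 3 by (simp add: x inversions_def)
      also have "\<dots> \<longleftrightarrow> i < j \<and> j \<le> n \<and> w (v j) < w (v i)" using R[OF 3(1)] by blast
      also have "\<dots> \<longleftrightarrow> x \<in> ?L \<union> ?R" using 3 by (simp add: x less_Suc_eq_le Suc_le_eq)
      finally show ?thesis .
    next
      case 4
      then show ?thesis by (simp add: x inversions_def)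
    qed
  qed
  moreover have "finite ?L" by (rule finite_subset[of _ "{..k} \<times> {..k}"]) auto
  moreover have "finite ?R" by (rule finite_subset[of _ "{..n} \<times> {..n}"]) auto
  moreover have "?L \<inter> ?R = {}" by auto
  ultimately show ?thesis unfolding perm_len_inversions inv_list_map_upt by (simp only: card_Un_disjoint)
qed

text \<open>The bijection sends v to the one-line word of \<open>w_nu v\<close>, cut after k
  letters; the first part then arranges the beads and the second their complement.\<close>

lemma Ypart_eq_sum_words:
  fixes scale :: "'f::field \<Rightarrow> 'v::ab_group_add \<Rightarrow> 'v"
  assumes \<nu>: "\<nu> \<in> parts n k" and k: "k \<le> n"
  shows "Ypart n k scale T y0 p \<nu> = (\<Sum>xs\<in>permutations_of_set (beads k \<nu>).
    \<Sum>ys\<in>permutations_of_set ({1..n} - beads k \<nu>).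
      scale (p ^ (inv_list xs + inv_list ys)) (Ybas n T y0 (word_fun (xs @ ys))))"
proof -
  let ?w = "wpart n k \<nu>" and ?A = "beads k \<nu>" and ?R = "{1..n} - beads k \<nu>"
  note w = wpart_facts[OF assms]
  have up: "[1..<Suc n] = [1..<Suc k] @ [Suc k..<Suc n]"
    using k upt_add_eq_append[of 1 "Suc k" "n - k"] by (simp del: upt_Suc)
  have winj: "inj ?w" using permutes_inj[OF w(1)] .
  have A: "?A \<subseteq> {1..n}" "card ?A = k" "finite ?A"
    using beads_in_ksubsets[OF assms] ksubsets_finite[OF beads_in_ksubsets[OF assms]] by (auto simp: ksubsets_def)
  let ?P = "permutations_of_set ?A \<times> permutations_of_set ?R"
  let ?to = "\<lambda>v. (map (?w \<circ> v) [1..<Suc k], map (?w \<circ> v) [Suc k..<Suc n])"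
  let ?from = "\<lambda>(xs, ys). inv ?w \<circ> word_fun (xs @ ys)"
  have joined: "fst (?to v) @ snd (?to v) = map (?w \<circ> v) [1..<Suc n]" for v
    unfolding up by simp
  have "Ypart n k scale T y0 p \<nu> = (\<Sum>(xs, ys)\<in>?P. scale (p ^ (inv_list xs + inv_list ys)) (Ybas n T y0 (word_fun (xs @ ys))))"
    unfolding Ypart_def
  proof (rule sum.reindex_bij_witness[where i = ?from and j = ?to], goal_cases)
    case (1 v)
    then have v: "v permutes {1..n}" by (simp add: Sk_young_def)
    have "?from (?to v) = inv ?w \<circ> word_fun (map (?w \<circ> v) [1..<Suc n])"
      using joined[of v] by simp
    also have "\<dots> = inv ?w \<circ> (?w \<circ> v)"
      using word_fun_map[OF permutes_compose[OF v w(1)]] by (simp only:)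
    also have "\<dots> = v" using winj by (simp add: fun_eq_iff)
    finally show ?case .
  next
    case (2 v)
    then have v: "v permutes {1..n}" "v ` {1..k} = {1..k}" by (auto simp: Sk_young_def)
    have inj: "inj (?w \<circ> v)" using winj permutes_inj[OF v(1)] by (rule inj_compose)
    have l: "(?w \<circ> v) ` {1..k} = ?A" unfolding image_comp[symmetric] v(2) w(2) ..
    have all: "(?w \<circ> v) ` {1..n} = {1..n}"
      using permutes_image[OF permutes_compose[OF v(1) w(1)]] .
    have "{Suc k..n} = {1..n} - {1..k}" using k by auto
    then have r: "(?w \<circ> v) ` {Suc k..n} = ?R"
      using image_set_diff[OF inj, of "{1..n}" "{1..k}"] l all by simp
    have s: "set [1..<Suc k] = {1..k}" "set [Suc k..<Suc n] = {Suc k..n}" by auto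
    have "map (?w \<circ> v) [1..<Suc k] \<in> permutations_of_set ?A"
      by (rule permutations_of_setI) (simp_all only: set_map s l distinct_map distinct_upt simp_thms, rule inj_on_subset[OF inj], simp)
    moreover have "map (?w \<circ> v) [Suc k..<Suc n] \<in> permutations_of_set ?R"
      by (rule permutations_of_setI) (simp_all only: set_map s r distinct_map distinct_upt simp_thms, rule inj_on_subset[OF inj], simp)
    ultimately show ?case by blast
  next
    case (3 xy)
    then obtain xs ys where xy: "xy = (xs, ys)" "xs \<in> permutations_of_set ?A" "ys \<in> permutations_of_set ?R" by auto
    have len: "length xs = k" "length ys = n - k"
      using xy A length_finite_permutations_of_set[OF xy(2)] length_finite_permutations_of_set[OF xy(3)]
      by (auto simp: card_Diff_subset)
    have "?w \<circ> (inv ?w \<circ> word_fun (xs @ ys)) = word_fun (xs @ ys)"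
      using surj_f_inv_f[OF permutes_surj[OF w(1)]] by (simp add: fun_eq_iff)
    moreover have "map (word_fun (xs @ ys)) [1..<Suc k] @ map (word_fun (xs @ ys)) [Suc k..<Suc n] = xs @ ys"
      using map_word_fun[of "xs @ ys" n] len k unfolding up map_append by simp
    then have "map (word_fun (xs @ ys)) [1..<Suc k] = xs" "map (word_fun (xs @ ys)) [Suc k..<Suc n] = ys"
      using len by (auto simp: append_eq_append_conv simp del: upt_Suc)
    ultimately show ?case unfolding xy(1) by (simp del: upt_Suc)
  next
    case (4 xy)
    then obtain xs ys where xy: "xy = (xs, ys)" "xs \<in> permutations_of_set ?A" "ys \<in> permutations_of_set ?R" by auto
    have sx: "set xs = ?A" "distinct xs" "set ys = ?R" "distinct ys" using xy by (auto dest: permutations_of_setD)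
    have len: "length xs = k" using distinct_card[OF sx(2)] sx(1) A by simp
    have "xs @ ys \<in> permutations_of_set {1..n}"
      by (rule permutations_of_setI) (use sx A(1) in auto)
    then have f: "word_fun (xs @ ys) permutes {1..n}" by (rule word_fun_permutes)
    have "inv ?w \<circ> word_fun (xs @ ys) permutes {1..n}"
      using permutes_compose[OF f permutes_inv[OF w(1)]] .
    moreover have "word_fun (xs @ ys) ` {1..k} = ?A"
    proof -
      have "{1..k} = Suc ` {..<k}" by (simp add: image_Suc_lessThan)
      then have "word_fun (xs @ ys) ` {1..k} = (\<lambda>i. xs ! i) ` {..<k}"
        using len by (simp only: image_image) (intro image_cong, auto simp: word_fun_def nth_append)
      also have "\<dots> = set xs" using len by (auto simp: set_conv_nth)
      finally show ?thesis using sx by simp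
    qed
    then have "(inv ?w \<circ> word_fun (xs @ ys)) ` {1..k} = inv ?w ` (?w ` {1..k})"
      unfolding w(2) by (simp only: image_comp[symmetric])
    then have "(inv ?w \<circ> word_fun (xs @ ys)) ` {1..k} = {1..k}"
      using winj by (simp add: image_inv_f_f)
    ultimately show ?case unfolding xy(1) by (simp add: Sk_young_def)
  next
    case (5 v)
    then have v: "v permutes {1..n}" by (simp add: Sk_young_def)
    have "word_fun (fst (?to v) @ snd (?to v)) = ?w \<circ> v"
      unfolding joined by (rule word_fun_map[OF permutes_compose[OF v w(1)]])
    moreover have "perm_len n v = inv_list (fst (?to v)) + inv_list (snd (?to v))"
      unfolding fst_conv snd_conv by (rule perm_len_young[OF 5 k w(3,4)])
    ultimately show ?case by (simp only: prod.case fst_conv snd_conv)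
  qed
  then show ?thesis by (simp only: sum.cartesian_product)
qed

subsection \<open>Linearity of the operators \<open>R\<^sub>i\<close>\<close>

lemma Rco_add: "Rco n k p q h t i (\<lambda>\<nu>. c \<nu> + d \<nu>) \<mu> = Rco n k p q h t i c \<mu> + Rco n k p q h t i d \<mu>"
  by (simp add: Rco_def distrib_left sum.distrib)

lemma Rco_scale: "Rco n k p q h t i (\<lambda>\<nu>. a * c \<nu>) \<mu> = a * Rco n k p q h t i c \<mu>"
  by (simp add: Rco_def distrib_left sum_distrib_left mult.left_commute)

lemma fold_Rco_scaled:
  "fold (\<lambda>i c \<mu>. z * Rco n k p q h t i c \<mu>) xs c = (\<lambda>\<mu>. z ^ length xs * fold (Rco n k p q h t) xs c \<mu>)"
proof (induction xs rule: rev_induct)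
  case (snoc x xs)
  have "fold (\<lambda>i c \<mu>. z * Rco n k p q h t i c \<mu>) (xs @ [x]) c
      = (\<lambda>\<mu>. z * Rco n k p q h t x (\<lambda>\<mu>. z ^ length xs * fold (Rco n k p q h t) xs c \<mu>) \<mu>)"
    by (simp only: fold_append fold_simps comp_apply snoc)
  then show ?case by (simp add: Rco_scale mult.assoc)
qed simp

lemma sum_fun_apply: "(\<Sum>x\<in>A. f x) \<mu> = (\<Sum>x\<in>A. f x \<mu>)" for f :: "'a \<Rightarrow> 'b \<Rightarrow> 'c::comm_monoid_add"
  by (induction A rule: infinite_finite_induct) auto

text \<open>Coefficient functions are added pointwise, so the general expansion of a product of
  factors 1 + G applies to them with G = z R_i.\<close>

lemma fold_Rgen_expand:
  "fold (Rgen n k p q h t z) [1..<Suc k] c \<mu>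
    = (\<Sum>S\<in>Pow {1..k}. z ^ card S * fold (Rco n k p q h t) (sorted_list_of_set S) c \<mu>)"
proof -
  let ?G = "\<lambda>i c \<mu>. z * Rco n k p q h t i c \<mu>"
  have R: "Rgen n k p q h t z = (\<lambda>i c. c + ?G i c)"
    by (auto simp: Rgen_def fun_eq_iff)
  have "fold (Rgen n k p q h t z) [1..<Suc k] c = (\<Sum>S\<in>Pow {1..k}. fold ?G (sorted_list_of_set S) c)"
    unfolding R
  proof (rule fold_one_plus)
    show "?G i (u + v) = ?G i u + ?G i v" for i u v
      by (rule ext) (simp add: plus_fun_def Rco_add distrib_left)
    show "?G i 0 = 0" for i
      by (rule ext) (simp add: zero_fun_def Rco_def)
  qed
  then show ?thesis
    by (simp only: sum_fun_apply fold_Rco_scaled length_sorted_list_of_set)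
qed

theorem theorem5p1:
  fixes scale :: "'f::field_char_0 \<Rightarrow> 'v::ab_group_add \<Rightarrow> 'v"
    and T X :: "nat \<Rightarrow> 'v \<Rightarrow> 'v" and p q h :: 'f and t :: "nat \<Rightarrow> 'f"
    and y0 :: 'v and ev :: "'v \<Rightarrow> 'f" and n k r :: nat and lam :: "nat \<Rightarrow> nat"
  assumes "schubert_rep n scale T X p q h t y0 ev"
    and "k \<le> n"
    and "lam \<in> parts n k"
    and "r \<le> k"
  shows "(\<Sum>S \<in> {S. S \<subseteq> {1..k} \<and> card S = r}.
            fold X (sorted_list_of_set S) (Ypart n k scale T y0 p lam))
       = (\<Sum>S \<in> {S. S \<subseteq> {1..k} \<and> card S = r}.
            vec_of n k scale T y0 p
              (fold (Rco n k p q h t) (sorted_list_of_set S) (\<lambda>\<nu>. if \<nu> = lam then 1 else 0)))"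
proof -
  note rep = assms(1)
  interpret V: vector_space scale using rep by (simp add: schubert_rep_def)
  \<comment> \<open>Off the index range the operators are arbitrary; setting them to zero there makes all
    linearity and commutation relations hold unconditionally.\<close>
  define T' where "T' i = (if i \<in> {1..<n} then T i else (\<lambda>_. 0))" for i
  define X' where "X' i = (if i \<in> {1..n} then X i else (\<lambda>_. 0))" for i
  define Y where "Y xs = Ybas n T y0 (word_fun xs)" for xs
  have linT: "Vector_Spaces.linear scale scale (T i)" if "i \<in> {1..<n}" for i
    using rep that by (simp add: schubert_rep_def)
  have linX: "Vector_Spaces.linear scale scale (X i)" if "i \<in> {1..n}" for i
    using rep that by (simp add: schubert_rep_def)
  have far: "T i (T j v) = T j (T i v)" if "i \<in> {1..<n}" "j \<in> {1..<n}" "i + 2 \<le> j" for i j v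
    using rep that by (simp add: schubert_rep_def)
  have braid: "T i (T (Suc i) (T i v)) = T (Suc i) (T i (T (Suc i) v))" if "1 \<le> i" "Suc i < n" for i v
    using rep that by (simp add: schubert_rep_def)
  have quad: "T i (T i v) + scale (p - q) (T i v) - scale (p * q) v = 0" if "1 \<le> i" "i < n" for i v
    using rep that by (simp add: schubert_rep_def)
  have XX: "X i (X j v) = X j (X i v)" if "i \<in> {1..n}" "j \<in> {1..n}" for i j v
    using rep that by (simp add: schubert_rep_def)
  have TXf: "T i (X j v) = X j (T i v)" if "i \<in> {1..<n}" "j \<in> {1..n}" "j \<noteq> i" "j \<noteq> Suc i" for i j v
    using rep that by (simp add: schubert_rep_def)
  have TX: "T i (X i v) = X (Suc i) (T i v) + (scale h v - scale (p - q) (X i v))" if "1 \<le> i" "i < n" for i v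
    using rep that by (simp add: schubert_rep_def)
  have TXS: "T i (X (Suc i) v) = X i (T i v) - (scale h v - scale (p - q) (X i v))" if "1 \<le> i" "i < n" for i v
    using rep that by (simp add: schubert_rep_def)
  have T0: "T i 0 = 0" if "i \<in> {1..<n}" for i
    using linT[OF that] by (rule Vector_Spaces.linear.axioms(3)[THEN module_hom.zero]) 
  have X0: "X i 0 = 0" if "i \<in> {1..n}" for i
    using linX[OF that] by (rule Vector_Spaces.linear.axioms(3)[THEN module_hom.zero])
  have lin0: "Vector_Spaces.linear scale scale (\<lambda>_. 0)"
    by unfold_locales simp_all
  interpret H: hecke_words scale n T' X' p q h Y t
  proof (intro hecke_words.intro affine_hecke.intro hecke_words_axioms.intro affine_hecke_axioms.intro
      V.vector_space_axioms)
    show "Vector_Spaces.linear scale scale (T' i)" for i using linT lin0 by (simp add: T'_def)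
    show "Vector_Spaces.linear scale scale (X' i)" for i using linX lin0 by (simp add: X'_def)
    show "T' i (T' i v) = scale (p * q) v - scale (p - q) (T' i v)" if "1 \<le> i" "i < n" for i v
      using quad[OF that, of v] that by (simp add: T'_def algebra_simps)
    show "T' i (T' j v) = T' j (T' i v)" if "i + 2 \<le> j" for i j v
      using far[of i j v] that T0 by (simp add: T'_def)
    show "T' i (T' (Suc i) (T' i v)) = T' (Suc i) (T' i (T' (Suc i) v))" for i v
      using braid[of i v] T0 by (simp add: T'_def)
    show "X' i (X' j v) = X' j (X' i v)" for i j v
      using XX[of i j v] X0 by (simp add: X'_def)
    show "T' i (X' j v) = X' j (T' i v)" if "j \<noteq> i" "j \<noteq> Suc i" for i j v
      using TXf[of i j v] T0[of i] X0[of j] that by (simp add: X'_def T'_def)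
    show "T' i (X' i v) = X' (Suc i) (T' i v) + (scale h v - scale (p - q) (X' i v))" if "1 \<le> i" "i < n" for i v
      using TX[OF that, of v] that by (simp add: X'_def T'_def)
    show "T' i (X' (Suc i) v) = X' i (T' i v) - (scale h v - scale (p - q) (X' i v))" if "1 \<le> i" "i < n" for i v
      using TXS[OF that, of v] that by (simp add: X'_def T'_def)
  next
    fix us a b vs
    assume perm: "us @ a # b # vs \<in> permutations_of_set {1..n}" and "b < a"
    let ?i = "Suc (length us)"
    have len: "length (us @ a # b # vs) = n" using length_finite_permutations_of_set[OF perm] by simp
    have "T ?i (Ybas n T y0 (word_fun (us @ a # b # vs))) = Ybas n T y0 (word_fun (us @ a # b # vs) \<circ> sref ?i)"
    proof (rule Ybas_descent[of n T, OF far braid word_fun_permutes[OF perm]])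
      show "1 \<le> ?i" "?i < n" using len by auto
      show "word_fun (us @ a # b # vs) (Suc ?i) < word_fun (us @ a # b # vs) ?i"
        using \<open>b < a\<close> by (simp add: word_fun_def nth_append)
    qed
    then show "T' ?i (Y (us @ a # b # vs)) = Y (us @ b # a # vs)"
      using len by (simp only: Y_def word_fun_swap) (simp add: T'_def)
  next
    fix i assume "1 \<le> i" "i \<le> n"
    then show "X' i (Y (head_word n n)) = scale (t (n + 1 - i)) (Y (head_word n n))"
      using schubert_rep_longest_eigen[OF rep, of i]
      by (simp add: Y_def word_fun_head_word Ybas_longest X'_def)
  qed
  have Yp: "Ypart n k scale T y0 p \<nu> = H.Yset 0 (beads k \<nu>)" if "\<nu> \<in> parts n k" for \<nu>
    unfolding Ypart_eq_sum_words[OF that assms(2)] H.Yset_def H.Ysum_def Y_def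
    by (simp add: V.scale_sum_right power_add)
  let ?\<delta> = "\<lambda>\<nu>. if \<nu> = lam then 1 else (0 :: 'f)"
  let ?Y = "Ypart n k scale T y0 p"
  let ?S = "\<lambda>r. {S. S \<subseteq> {1..k} \<and> card S = r}"
  define L where "L r = (\<Sum>S\<in>?S r. fold X (sorted_list_of_set S) (?Y lam))" for r
  define R where "R r = (\<Sum>S\<in>?S r. vec_of n k scale T y0 p (fold (Rco n k p q h t) (sorted_list_of_set S) ?\<delta>))" for r
  have "(\<Sum>r\<le>k. scale (z ^ r) (L r)) = (\<Sum>r\<le>k. scale (z ^ r) (R r))" for z
  proof -
    have "(\<Sum>r\<le>k. scale (z ^ r) (L r)) = (\<Sum>r\<le>k. \<Sum>S\<in>?S r. scale (z ^ card S) (fold X (sorted_list_of_set S) (?Y lam)))"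
      unfolding L_def V.scale_sum_right by (intro sum.cong refl) auto
    also have "\<dots> = (\<Sum>S\<in>Pow {1..k}. scale (z ^ card S) (fold X (sorted_list_of_set S) (?Y lam)))"
      by (rule sum_Pow_by_card[symmetric])
    also have "\<dots> = (\<Sum>S\<in>Pow {1..k}. fold (\<lambda>i v. scale z (X' i v)) (sorted_list_of_set S) (?Y lam))"
    proof (intro sum.cong refl)
      fix S assume "S \<in> Pow {1..k}"
      then have S: "finite S" "S \<subseteq> {1..n}" using finite_subset assms(2) by auto
      have "fold X (sorted_list_of_set S) (?Y lam) = fold X' (sorted_list_of_set S) (?Y lam)"
        using S by (intro fold_cong) (auto simp: X'_def)
      moreover have "fold (\<lambda>i v. scale z (X' i v)) (sorted_list_of_set S) (?Y lam) =
          scale (z ^ length (sorted_list_of_set S)) (fold X' (sorted_list_of_set S) (?Y lam))"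
        by (rule V.fold_scaled) simp
      ultimately show "scale (z ^ card S) (fold X (sorted_list_of_set S) (?Y lam)) =
          fold (\<lambda>i v. scale z (X' i v)) (sorted_list_of_set S) (?Y lam)"
        by (simp only: length_sorted_list_of_set)
    qed
    also have "\<dots> = fold (\<lambda>i v. v + scale z (X' i v)) [1..<Suc k] (?Y lam)"
      by (rule fold_one_plus[symmetric]) (simp_all add: V.scale_right_distrib)
    also have "\<dots> = H.Egen z (Suc 0) (Suc (0 + k)) (H.Yset 0 (beads k lam))"
      by (simp only: H.Egen_def Yp[OF assms(3)] One_nat_def add_0)
    also have "\<dots> = (\<Sum>B\<in>ksubsets n k. scale (gcoef z p q h t k (beads k lam) B) (H.Yset 0 B))"
      using H.Egen_Yset[of 0 "beads k lam" k z] beads_in_ksubsets[OF assms(3,2)] by simp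
    also have "\<dots> = (\<Sum>\<mu>\<in>parts n k. scale (gcoef z p q h t k (beads k lam) (beads k \<mu>)) (H.Yset 0 (beads k \<mu>)))"
      by (rule sum.reindex_bij_betw[OF bij_betw_beads[OF assms(2)], symmetric])
    also have "\<dots> = (\<Sum>\<mu>\<in>parts n k. scale (fold (Rgen n k p q h t z) [1..<Suc k] ?\<delta> \<mu>) (?Y \<mu>))"
    proof (intro sum.cong refl)
      fix \<mu> assume \<mu>: "\<mu> \<in> parts n k"
      have "fold (Rgen n k p q h t z) [1..<Suc k] ?\<delta> \<mu> =
          (\<Sum>\<nu>\<in>parts n k. ?\<delta> \<nu> * gcoef z p q h t k (beads k \<nu>) (beads k \<mu>))"
        by (rule fold_Rgen[OF assms(2) \<mu>])
      \<comment> \<open>Starting from the unit coefficient function at \<open>lam\<close> leaves a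
        single matrix entry.\<close>
      also have "\<dots> = (\<Sum>\<nu>\<in>parts n k. if \<nu> = lam then gcoef z p q h t k (beads k \<nu>) (beads k \<mu>) else 0)"
        by (intro sum.cong) auto
      also have "\<dots> = gcoef z p q h t k (beads k lam) (beads k \<mu>)"
        using assms(3) finite_parts by (subst sum.delta) auto
      finally show "scale (gcoef z p q h t k (beads k lam) (beads k \<mu>)) (H.Yset 0 (beads k \<mu>)) =
         scale (fold (Rgen n k p q h t z) [1..<Suc k] ?\<delta> \<mu>) (?Y \<mu>)"
        using Yp[OF \<mu>] by (simp only:)
    qed
    also have "\<dots> = (\<Sum>S\<in>Pow {1..k}. scale (z ^ card S) (vec_of n k scale T y0 p (fold (Rco n k p q h t) (sorted_list_of_set S) ?\<delta>)))"
      unfolding fold_Rgen_expand vec_of_def V.scale_sum_left V.scale_sum_right V.scale_scale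
      by (rule sum.swap)
    also have "\<dots> = (\<Sum>r\<le>k. scale (z ^ r) (R r))"
      unfolding sum_Pow_by_card R_def V.scale_sum_right by (intro sum.cong refl) auto
    finally show ?thesis .
  qed
  \<comment> \<open>The identity holds for every scalar z, so the coefficients of the powers of z
    agree, and degree r is the claim.\<close>
  then have "(\<Sum>r\<le>k. scale (z ^ r) (L r - R r)) = 0" for z
    by (simp add: V.scale_right_diff_distrib sum_subtractf)
  then have "L r - R r = 0"
    by (rule vector_poly_eq_0[OF V.vector_space_axioms _ assms(4), where a = "\<lambda>r. L r - R r"])
  then show ?thesis by (simp add: L_def R_def)
qed

end
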